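(* Assume $n\ge 2$, let $\varepsilon\in(0,0.3)$ be a constant and $j\in[n]$. Even restricted to instances of the Round-Robin protocol in which every agent in $[n]\setminus\{j\}$ has an additive objective function and follows the greedy policy, there is no polynomial-time algorithm that is a $(1+\varepsilon)$-improvement of agent $j$ over the greedy policy of agent $j$, unless $\mathrm{P}=\mathrm{NP}$.
   Context: Setting: $n$ agents, a finite item set $M$, $|M|=m$; each agent $i$ has a normalized nonnegative monotone submodular objective $f_i:2^M\to\mathbb{R}_{\ge0}$ (accessed via a value oracle) and an independence-system constraint $\mathcal{I}_i$ (accessed via an independence oracle); the hardness applies even when there are no feasibility constraints ($\mathcal{I}_i=2^M$). Write $f(x\,|\,S)=f(S\cup\{x\})-f(S)$. Round-Robin protocol: initially the available set is $Q=M$; for rounds $r=1,\dots,\lceil m/n\rceil$ and within each round for agents $1,\dots,n$ in order, the current agent either selects one item of $Q$, which is removed from $Q$, or selects nothing; each agent's choices are determined by its policy/algorithm, which may use full information about all objectives, constraints and choices. Greedy policy of agent $i$: maintain $S_i$ (initially $\emptyset$); at each turn let $A=\{x\in Q: S_i\cup\{x\}\in\mathcal{I}_i\}$; if $A\neq\emptyset$ select some $x\in\arg\max_{y\in A}f_i(y\,|\,S_i)$ and add it to $S_i$, otherwise select nothing. Given fixed objectives and policies of all other agents, an algorithm $\mathcal{A}_j$ for agent $j$ is a $\rho$-improvement of agent $j$ over its greedy policy if, whenever some way of choosing for agent $j$ yields a set of value at least $\rho$ times the value agent $j$ obtains by choosing greedily, running $\mathcal{A}_j$ (the other agents keeping their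 policies) gives agent $j$ a set of value at least $\rho$ times the value obtained by choosing greedily. A polynomial-time algorithm here determines the choices of the single agent $j$ with full information about all objective functions, with number of steps and value-oracle queries bounded by a polynomial in the number of agents. *)

theory Defs
  imports Complex_Main "HOL-Computational_Algebra.Polynomial"
begin

section \<open>Machine model, P and NP\<close>

text \<open>
  Programs work on finitely many stacks of bits; every elementary operation costs one step.  A
  stack program and a multi-tape Turing machine simulate each other with polynomial
  overhead: a tape is a pair of stacks, and the finite control can be kept on a stack.
  A query replaces the contents of a stack by the answer to the query; the query word
  has to be written bit by bit, and the answer can only be read bit by bit.
\<close>

type_synonym word = "bool list"
type_synonym store = "nat \<Rightarrow> word"

datatype com =
    Skip
  | Push bool nat
  | Pop nat
  | Query nat nat
  | Seq com com
  | Branch nat com com com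
  | While nat com

inductive exec :: "(word \<Rightarrow> word) \<Rightarrow> com \<Rightarrow> store \<Rightarrow> nat \<Rightarrow> store \<Rightarrow> bool"
  for orc :: "word \<Rightarrow> word" where
  Skip: "exec orc Skip s 1 s"
| Push: "exec orc (Push b x) s 1 (s(x := b # s x))"
| Pop: "exec orc (Pop x) s 1 (s(x := tl (s x)))"
| Query: "exec orc (Query x y) s 1 (s(y := orc (s x)))"
| Seq: "exec orc c s t s' \<Longrightarrow> exec orc d s' t' s'' \<Longrightarrow> exec orc (Seq c d) s (t + t') s''"
| Branch_empty:
    "s x = [] \<Longrightarrow> exec orc c s t s' \<Longrightarrow> exec orc (Branch x c d e) s (Suc t) s'"
| Branch_False:
    "s x = False # w \<Longrightarrow> exec orc d s t s' \<Longrightarrow> exec orc (Branch x c d e) s (Suc t) s'"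
| Branch_True:
    "s x = True # w \<Longrightarrow> exec orc e s t s' \<Longrightarrow> exec orc (Branch x c d e) s (Suc t) s'"
| While_empty: "s x = [] \<Longrightarrow> exec orc (While x c) s 1 s"
| While_step:
    "s x \<noteq> [] \<Longrightarrow> exec orc c s t s' \<Longrightarrow> exec orc (While x c) s' t' s''
      \<Longrightarrow> exec orc (While x c) s (Suc (t + t')) s''"

inductive_cases exec_SkipE: "exec orc Skip s t s'"
inductive_cases exec_PushE: "exec orc (Push b x) s t s'"
inductive_cases exec_PopE: "exec orc (Pop x) s t s'"
inductive_cases exec_QueryE: "exec orc (Query x y) s t s'"
inductive_cases exec_SeqE: "exec orc (Seq c d) s t s'"
inductive_cases exec_BranchE: "exec orc (Branch x c d e) s t s'"
inductive_cases exec_WhileE: "exec orc (While x c) s t s'"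

lemma exec_deterministic:
  "exec orc c s t s' \<Longrightarrow> exec orc c s u s'' \<Longrightarrow> t = u \<and> s' = s''"
proof (induction arbitrary: u s'' rule: exec.induct)
  case (Skip s)
  then show ?case by (rule exec_SkipE) simp
next
  case (Push b x s)
  then show ?case by (rule exec_PushE) simp
next
  case (Pop x s)
  then show ?case by (rule exec_PopE) simp
next
  case (Query x y s)
  then show ?case by (rule exec_QueryE) simp
next
  case (Seq c s t s' d t' r)
  from Seq.prems show ?case by (rule exec_SeqE) (metis Seq.IH)
next
  case (Branch_empty s x c t s' d e)
  from Branch_empty.prems show ?case
    by (rule exec_BranchE) (simp_all add: Branch_empty.IH Branch_empty.hyps(1))
next
  case (Branch_False s x w d t s' c e)
  from Branch_False.prems show ?case
    by (rule exec_BranchE) (simp_all add: Branch_False.IH Branch_False.hyps(1))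
next
  case (Branch_True s x w e t s' c d)
  from Branch_True.prems show ?case
    by (rule exec_BranchE) (simp_all add: Branch_True.IH Branch_True.hyps(1))
next
  case (While_empty s x c)
  from While_empty.prems show ?case
    by (rule exec_WhileE) (simp_all add: While_empty.hyps)
next
  case (While_step s x c t s' t' r)
  from While_step.prems show ?case
    by (rule exec_WhileE) (use While_step.hyps(1) in simp, metis While_step.IH)
qed

definition init :: "word list \<Rightarrow> store" where
  "init ws = (\<lambda>x. if x < length ws then ws ! x else [])"

definition halts_within :: "(word \<Rightarrow> word) \<Rightarrow> com \<Rightarrow> word list \<Rightarrow> nat \<Rightarrow> bool" where
  "halts_within orc c ws T \<longleftrightarrow> (\<exists>t s. exec orc c (init ws) t s \<and> t \<le> T)"

text \<open>The result is read off stack 0; it is meaningful only for terminating runs.\<close>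

definition result :: "(word \<Rightarrow> word) \<Rightarrow> com \<Rightarrow> word list \<Rightarrow> word" where
  "result orc c ws = (THE s. \<exists>t. exec orc c (init ws) t s) 0"

text \<open>Computation without outside help: every query is answered by the empty word.\<close>

definition no_oracle :: "word \<Rightarrow> word" where
  "no_oracle w = []"

definition class_P :: "word set set" where
  "class_P = {L. \<exists>c p. \<forall>w.
      halts_within no_oracle c [w] (poly p (length w)) \<and>
      (w \<in> L \<longleftrightarrow> result no_oracle c [w] = [True])}"

definition class_NP :: "word set set" where
  "class_NP = {L. \<exists>c p q.
      (\<forall>w u. halts_within no_oracle c [w, u] (poly p (length w + length u))) \<and>
      (\<forall>w. w \<in> L \<longleftrightarrow>
        (\<exists>u. length u \<le> poly q (length w) \<and> result no_oracle c [w, u] = [True]))}"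


section \<open>Objectives and constraints\<close>

definition marginal :: "('a set \<Rightarrow> real) \<Rightarrow> 'a \<Rightarrow> 'a set \<Rightarrow> real" where
  "marginal f x S = f (S \<union> {x}) - f S"

definition normalized :: "('a set \<Rightarrow> real) \<Rightarrow> bool" where
  "normalized f \<longleftrightarrow> f {} = 0"

definition nonneg_on :: "'a set \<Rightarrow> ('a set \<Rightarrow> real) \<Rightarrow> bool" where
  "nonneg_on M f \<longleftrightarrow> (\<forall>S\<subseteq>M. 0 \<le> f S)"

definition submodular_on :: "'a set \<Rightarrow> ('a set \<Rightarrow> real) \<Rightarrow> bool" where
  "submodular_on M f \<longleftrightarrow>
    (\<forall>S T x. S \<subseteq> T \<and> T \<subseteq> M \<and> x \<in> M - T \<longrightarrow> marginal f x T \<le> marginal f x S)"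

definition additive_on :: "'a set \<Rightarrow> ('a set \<Rightarrow> real) \<Rightarrow> bool" where
  "additive_on M f \<longleftrightarrow> (\<forall>S\<subseteq>M. f S = (\<Sum>x\<in>S. f {x}))"

definition indep_system :: "'a set \<Rightarrow> 'a set set \<Rightarrow> bool" where
  "indep_system M F \<longleftrightarrow>
    F \<subseteq> Pow M \<and> {} \<in> F \<and> (\<forall>T\<in>F. \<forall>S\<subseteq>T. S \<in> F)"

text \<open>The agents are \<open>0, \<dots>, agents I - 1\<close> and the items are \<open>0, \<dots>, items I - 1\<close>.\<close>

record rr_instance =
  agents :: nat
  items :: nat
  obj :: "nat \<Rightarrow> nat set \<Rightarrow> real"
  indep :: "nat \<Rightarrow> nat set set"

definition item_set :: "rr_instance \<Rightarrow> nat set" where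
  "item_set I = {..<items I}"

definition valid_instance :: "rr_instance \<Rightarrow> bool" where
  "valid_instance I \<longleftrightarrow> (\<forall>i<agents I.
      normalized (obj I i) \<and> nonneg_on (item_set I) (obj I i) \<and>
      mono_on (Pow (item_set I)) (obj I i) \<and> submodular_on (item_set I) (obj I i) \<and>
      indep_system (item_set I) (indep I i))"

definition unconstrained :: "rr_instance \<Rightarrow> bool" where
  "unconstrained I \<longleftrightarrow> (\<forall>i<agents I. indep I i = Pow (item_set I))"

definition rational_valued :: "rr_instance \<Rightarrow> bool" where
  "rational_valued I \<longleftrightarrow> (\<forall>i<agents I. \<forall>S\<subseteq>item_set I. obj I i S \<in> \<rat>)"


section \<open>The Round-Robin protocol\<close>

text \<open>
  A history lists the choices made so far; its entry \<open>k\<close> is the choice of agent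
  \<open>k mod agents I\<close>, and \<open>None\<close> means that nothing was selected.
\<close>

type_synonym history = "nat option list"
type_synonym policy = "history \<Rightarrow> nat option"

definition available :: "rr_instance \<Rightarrow> history \<Rightarrow> nat set" where
  "available I h = item_set I - {x. Some x \<in> set h}"

definition owned :: "rr_instance \<Rightarrow> history \<Rightarrow> nat \<Rightarrow> nat set" where
  "owned I h i = {x. \<exists>k<length h. k mod agents I = i \<and> h ! k = Some x}"

text \<open>Naming an item that is not available counts as selecting nothing.\<close>

definition legal :: "rr_instance \<Rightarrow> history \<Rightarrow> nat option \<Rightarrow> nat option" where
  "legal I h ch = (case ch of None \<Rightarrow> None
     | Some x \<Rightarrow> if x \<in> available I h then Some x else None)"

primrec play :: "rr_instance \<Rightarrow> (nat \<Rightarrow> policy) \<Rightarrow> nat \<Rightarrow> history" where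
  "play I \<pi> 0 = []"
| "play I \<pi> (Suc k) =
    (let h = play I \<pi> k in h @ [legal I h (\<pi> (k mod agents I) h)])"

definition turns :: "rr_instance \<Rightarrow> nat" where
  "turns I = agents I * nat \<lceil>real (items I) / real (agents I)\<rceil>"

definition outcome :: "rr_instance \<Rightarrow> (nat \<Rightarrow> policy) \<Rightarrow> nat \<Rightarrow> nat set" where
  "outcome I \<pi> i = owned I (play I \<pi> (turns I)) i"

text \<open>
  A tie-breaking rule picks, for every agent, one element of the set of items with maximum
  marginal value.
\<close>

type_synonym tie_rule = "nat \<Rightarrow> nat set \<Rightarrow> nat"

definition tie_breaking :: "tie_rule \<Rightarrow> bool" where
  "tie_breaking tb \<longleftrightarrow> (\<forall>i X. X \<noteq> {} \<longrightarrow> tb i X \<in> X)"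

definition greedy :: "tie_rule \<Rightarrow> rr_instance \<Rightarrow> nat \<Rightarrow> policy" where
  "greedy tb I i h =
    (let S = owned I h i; A = {x \<in> available I h. S \<union> {x} \<in> indep I i}
     in if A = {} then None
        else Some (tb i {x \<in> A. \<forall>y\<in>A. marginal (obj I i) y S \<le> marginal (obj I i) x S}))"

text \<open>
  \<open>achieves \<rho> tb I \<pi> j \<sigma>\<close>: playing \<open>\<sigma>\<close> against the policies \<open>\<pi>\<close> of the other agents, agent
  \<open>j\<close> gets a feasible set worth at least \<open>\<rho>\<close> times what greedy play would give it.
\<close>

definition achieves ::
    "real \<Rightarrow> tie_rule \<Rightarrow> rr_instance \<Rightarrow> (nat \<Rightarrow> policy) \<Rightarrow> nat \<Rightarrow> policy \<Rightarrow> bool" where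
  "achieves \<rho> tb I \<pi> j \<sigma> \<longleftrightarrow>
    outcome I (\<pi>(j := \<sigma>)) j \<in> indep I j \<and>
    obj I j (outcome I (\<pi>(j := \<sigma>)) j) \<ge> \<rho> * obj I j (outcome I (\<pi>(j := greedy tb I j)) j)"

definition improvement ::
    "real \<Rightarrow> tie_rule \<Rightarrow> rr_instance \<Rightarrow> (nat \<Rightarrow> policy) \<Rightarrow> nat \<Rightarrow> policy \<Rightarrow> bool" where
  "improvement \<rho> tb I \<pi> j \<sigma> \<longleftrightarrow>
    ((\<exists>\<tau>. achieves \<rho> tb I \<pi> j \<tau>) \<longrightarrow> achieves \<rho> tb I \<pi> j \<sigma>)"


section \<open>Algorithms with query access to the instance\<close>

fun bits :: "nat \<Rightarrow> word" where
  "bits 0 = []"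
| "bits (Suc k) = odd (Suc k) # bits (Suc k div 2)"

text \<open>
  Code of a nonnegative rational number: numerator and denominator in binary, least significant
  bit first, preceded by the length of the numerator in unary.
\<close>

definition value_code :: "real \<Rightarrow> word" where
  "value_code r =
    (let (a, b) = quotient_of (THE q. of_rat q = r); u = bits (nat a); v = bits (nat b)
     in replicate (length u) True @ False # u @ v)"

text \<open>
  A query about agent \<open>i\<close> and a set \<open>S\<close> of items is a tag bit, followed by \<open>i\<close> in unary, the
  separator \<open>False\<close> and the characteristic vector of \<open>S\<close>.  Tag \<open>False\<close> asks for the value of
  \<open>S\<close>, tag \<open>True\<close> for its independence.  All other words are answered by the empty word.
\<close>

fun query_answer :: "rr_instance \<Rightarrow> word \<Rightarrow> word" where
  "query_answer I [] = []"
| "query_answer I (tag # w) =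
    (let i = length (takeWhile id w); bs = drop (Suc i) w; S = {x. x < length bs \<and> bs ! x}
     in if i < agents I \<and> length bs = items I
        then (if tag then [S \<in> indep I i] else value_code (obj I i S))
        else [])"

definition choice_code :: "nat option \<Rightarrow> word" where
  "choice_code ch = (case ch of None \<Rightarrow> [False] | Some x \<Rightarrow> replicate (Suc x) True @ [False])"

definition choice_of_word :: "word \<Rightarrow> nat option" where
  "choice_of_word w = (case length (takeWhile id w) of 0 \<Rightarrow> None | Suc x \<Rightarrow> Some x)"

definition input_code :: "rr_instance \<Rightarrow> history \<Rightarrow> word list" where
  "input_code I h =
    [replicate (agents I) True, replicate (items I) True, concat (map choice_code h)]"

text \<open>
  A program determines the choice at every turn from all choices made so far and from its
  queries to the objectives and constraints of all agents.
\<close>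

definition program_policy :: "com \<Rightarrow> rr_instance \<Rightarrow> policy" where
  "program_policy c I h = choice_of_word (result (query_answer I) c (input_code I h))"

text \<open>
  The size counts agents, items and the bit length of the largest value, so that polynomial time
  in \<open>agents I\<close> alone, or in \<open>agents I + items I\<close>, is a special case of polynomial time here.
\<close>

definition instance_size :: "rr_instance \<Rightarrow> nat" where
  "instance_size I = agents I + items I +
    Max {length (value_code (obj I i S)) | i S. i < agents I \<and> S \<subseteq> item_set I}"

text \<open>
  Since a run has at most \<open>agents I + items I\<close> turns, bounding the time of each turn of agent
  \<open>j\<close> by a polynomial is the same as bounding their total.  Every query is a step, so the number
  of queries is bounded as well.
\<close>

definition poly_time_on ::
    "rr_instance set \<Rightarrow> (rr_instance \<Rightarrow> nat \<Rightarrow> policy) \<Rightarrow> nat \<Rightarrow> com \<Rightarrow> bool" where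
  "poly_time_on C \<pi> j c \<longleftrightarrow> (\<exists>p. \<forall>I\<in>C. \<forall>k<turns I. k mod agents I = j \<longrightarrow>
     halts_within (query_answer I) c (input_code I (play I ((\<pi> I)(j := program_policy c I)) k))
       (poly p (instance_size I)))"

definition instances_with_additive_others :: "nat \<Rightarrow> nat \<Rightarrow> rr_instance set" where
  "instances_with_additive_others n j =
    {I. valid_instance I \<and> agents I = n \<and> unconstrained I \<and> rational_valued I \<and>
        (\<forall>i<n. i \<noteq> j \<longrightarrow> additive_on (item_set I) (obj I i))}"

end

theory Submission
  imports Defs
begin

text \<open>
  Let a verifier decide a language in NP, and let \<open>k\<close> exceed the length of all certificates of an
  input \<open>w\<close>.  In the first \<open>k\<close> rounds agent \<open>j\<close> spells a bit string of length \<open>k\<close>: the block of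
  round \<open>r\<close> consists of \<open>n\<close> items, and which of its first two items is taken determines the bit
  \<open>r\<close>.  All other agents prefer items with small numbers, so they clear the blocks in order.
  Every item from the blocks is worth \<open>2\<close> to agent \<open>j\<close>, up to a total of \<open>2 k\<close>, with a penalty of
  \<open>1\<close> if exactly \<open>k\<close> of them are held and they do not spell a certificate; this is still monotone
  and submodular.  In addition there are \<open>T\<close> items, each worth \<open>3\<close>, which nobody else wants.
  Greedy play takes these first and meanwhile loses all the blocks, so it gets exactly \<open>3 T\<close>,
  whereas \<open>3 T + 2 k\<close> is attainable if and only if there is a certificate.

  Hence an improvement by the factor \<open>1 + \<epsilon>\<close> must spell a certificate as soon as
  \<open>2 k - 1 < 3 \<epsilon> T \<le> 2 k\<close>.  Since \<open>3 \<epsilon> < 1\<close>, such a \<open>T\<close> exists, and it satisfies \<open>T \<ge> 2 k\<close>, which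
  is what makes greedy play lose the blocks.  As \<open>\<epsilon>\<close> need not be computable, all \<open>T\<close> up
  to a constant multiple of \<open>k\<close> are tried, and what agent \<open>j\<close> has spelled is checked by the verifier.
  The objectives are computable in polynomial time, so no hardness result for a particular problem is
  needed, and the queries of the given program can be answered by subroutines.
\<close>

section \<open>Executions\<close>

text \<open>The numbers come from ties and integrality. A trap has to beat the marginal 2 of a block
  item strictly, so that greedy play gets all traps under every tie-breaking rule; hence 3. Values
  are integers, so the threshold 3 T + 3 \<epsilon> T singles out the last unit of 2 k exactly when
  3 \<epsilon> T lies in an interval of length 1. The penalty is half of a step, so the marginals on
  reaching and on leaving size k (1 or 2, then 0 or 1) still decrease. With more than k block items
  there would be no penalty. A counting argument excludes this: while blocks are left, the others
  remove n - 1 of their items per round. Certificates are shorter than k and are padded to the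
  single length that the blocks can spell. The given program is known to halt only on histories that
  occur against the greedy agents. So polynomial time is always relative to a domain, and each
  composition must show that intermediate words stay inside it. The protocol itself is easy to
  simulate because the others have no ties: whoever moves takes the least available item.\<close>

lemma poly_mono_nat: "x \<le> y \<Longrightarrow> poly (p :: nat poly) x \<le> poly p y"
  by (induct p) (auto intro: add_mono mult_mono)

section \<open>Growth of stacks and renaming of registers\<close>

definition bnd :: "nat \<Rightarrow> store \<Rightarrow> bool" where
  "bnd l s \<longleftrightarrow> (\<forall>x. length (s x) \<le> l)"

lemma bnd_mono: "bnd l s \<Longrightarrow> l \<le> l' \<Longrightarrow> bnd l' s"
  unfolding bnd_def using order_trans by blast

text \<open>A query replaces a stack by the answer, so \<open>l\<close> has to bound the answers as
  well; every other step lengthens a stack by at most one bit.\<close>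

lemma exec_bnd:
  "exec orc c s t s' \<Longrightarrow> bnd l s \<Longrightarrow> \<forall>q. length (orc q) \<le> l \<Longrightarrow> bnd (l + t) s'"
proof (induction arbitrary: l rule: exec.induct)
  case (Seq c s t s' d t' s'')
  from Seq.IH(1)[OF Seq.prems] Seq.prems(2) show ?case
    using Seq.IH(2)[of "l + t"] by (simp add: add.assoc trans_le_add1)
next
  case (While_step s x c t s' t' s'')
  from While_step.IH(1)[OF While_step.prems] While_step.prems(2) have "bnd (l + t + t') s''"
    using While_step.IH(2)[of "l + t"] by (simp add: trans_le_add1)
  then show ?case by (rule bnd_mono) simp
next
  case (Pop x s)
  then show ?case by (auto simp: bnd_def intro: le_SucI diff_le_self[THEN order_trans])
next
  case (Query x y s)
  then show ?case by (auto simp: bnd_def intro: le_SucI)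
qed (auto simp: bnd_def intro: le_SucI)

primrec regs_below :: "nat \<Rightarrow> com \<Rightarrow> bool" where
  "regs_below N Skip \<longleftrightarrow> True"
| "regs_below N (Push b x) \<longleftrightarrow> x < N"
| "regs_below N (Pop x) \<longleftrightarrow> x < N"
| "regs_below N (Query x y) \<longleftrightarrow> x < N \<and> y < N"
| "regs_below N (Seq c d) \<longleftrightarrow> regs_below N c \<and> regs_below N d"
| "regs_below N (Branch x c d e) \<longleftrightarrow> x < N \<and> regs_below N c \<and> regs_below N d \<and> regs_below N e"
| "regs_below N (While x c) \<longleftrightarrow> x < N \<and> regs_below N c"

lemma regs_below_mono: "regs_below N c \<Longrightarrow> N \<le> N' \<Longrightarrow> regs_below N' c"
  by (induction c) auto

lemma ex_regs_below: "\<exists>N. regs_below N c"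
proof (induction c)
  case (Query x y)
  show ?case by (rule exI[of _ "Suc (x + y)"]) simp
next
  case (Seq c d)
  then obtain N N' where "regs_below N c" "regs_below N' d" by blast
  then show ?case
    by (intro exI[of _ "N + N'"]) (auto intro: regs_below_mono)
next
  case (Branch x c d e)
  then obtain N N' N'' where "regs_below N c" "regs_below N' d" "regs_below N'' e" by blast
  then show ?case
    by (intro exI[of _ "Suc (x + N + N' + N'')"]) (auto intro: regs_below_mono)
next
  case (While x c)
  then obtain N where "regs_below N c" by blast
  then show ?case
    by (intro exI[of _ "Suc (x + N)"]) (auto intro: regs_below_mono)
qed auto

lemma exec_frame: "exec orc c s t s' \<Longrightarrow> regs_below N c \<Longrightarrow> N \<le> x \<Longrightarrow> s' x = s x"
  by (induction rule: exec.induct) auto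

text \<open>Renames stacks along \<open>r\<close> and puts a program in place of each query. With
  \<open>r\<close> a shift into fresh registers this lets one program call another; with subroutines
  for the queries it removes an oracle.\<close>

primrec translate :: "(nat \<Rightarrow> nat) \<Rightarrow> (nat \<Rightarrow> nat \<Rightarrow> com) \<Rightarrow> com \<Rightarrow> com" where
  "translate r q Skip = Skip"
| "translate r q (Push b x) = Push b (r x)"
| "translate r q (Pop x) = Pop (r x)"
| "translate r q (Query x y) = q x y"
| "translate r q (Seq c d) = Seq (translate r q c) (translate r q d)"
| "translate r q (Branch x c d e) =
    Branch (r x) (translate r q c) (translate r q d) (translate r q e)"
| "translate r q (While x c) = While (r x) (translate r q c)"

lemma exec_translate:
  assumes inj: "inj r" and K: "1 \<le> K"
    and Q: "\<And>S x y. x < N \<Longrightarrow> y < N \<Longrightarrow> \<forall>z. z \<notin> range r \<longrightarrow> S z = S0 z \<Longrightarrow> bnd W (S \<circ> r) \<Longrightarrow>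
      \<forall>v\<ge>N. S (r v) = [] \<Longrightarrow> \<exists>u\<le>K. exec orc' (q x y) S u (S(r y := orc (S (r x))))"
  shows "exec orc c s t s' \<Longrightarrow> regs_below N c \<Longrightarrow> bnd l s \<Longrightarrow> \<forall>q. length (orc q) \<le> l \<Longrightarrow>
    l + t \<le> W \<Longrightarrow> S \<circ> r = s \<Longrightarrow> \<forall>z. z \<notin> range r \<longrightarrow> S z = S0 z \<Longrightarrow>
    \<forall>v\<ge>N. s v = [] \<Longrightarrow> \<exists>u S'. exec orc' (translate r q c) S u S' \<and> S' \<circ> r = s' \<and>
      (\<forall>z. z \<notin> range r \<longrightarrow> S' z = S0 z) \<and> u \<le> t * K"
proof -
  have upd: "S(r x := w) \<circ> r = (S \<circ> r)(x := w)" "z \<notin> range r \<Longrightarrow> (S(r x := w)) z = S z"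
    for S :: store and x w z
    using inj by (auto simp: fun_eq_iff inj_eq)
  show "exec orc c s t s' \<Longrightarrow> regs_below N c \<Longrightarrow> bnd l s \<Longrightarrow> \<forall>q. length (orc q) \<le> l \<Longrightarrow>
    l + t \<le> W \<Longrightarrow> S \<circ> r = s \<Longrightarrow> \<forall>z. z \<notin> range r \<longrightarrow> S z = S0 z \<Longrightarrow>
    \<forall>v\<ge>N. s v = [] \<Longrightarrow> \<exists>u S'. exec orc' (translate r q c) S u S' \<and> S' \<circ> r = s' \<and>
      (\<forall>z. z \<notin> range r \<longrightarrow> S' z = S0 z) \<and> u \<le> t * K"
  proof (induction arbitrary: S l rule: exec.induct)
    case (Skip s)
    then show ?case using K by (auto intro!: exI exec.Skip)
  next
    case (Push b x s)
    have "exec orc' (Push b (r x)) S 1 (S(r x := b # S (r x)))" by (rule exec.Push)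
    with Push show ?case using K inj
      by (intro exI[of _ 1] exI[of _ "S(r x := b # S (r x))"])
        (clarify, simp del: fun_upd_apply add: upd, simp add: o_def)
  next
    case (Pop x s)
    have "exec orc' (Pop (r x)) S 1 (S(r x := tl (S (r x))))" by (rule exec.Pop)
    with Pop show ?case using K inj
      by (intro exI[of _ 1] exI[of _ "S(r x := tl (S (r x)))"]) (clarify, simp del: fun_upd_apply add: upd, simp add: o_def)
  next
    case (Query x y s)
    have "bnd W (S \<circ> r)" using bnd_mono[OF Query.prems(2), of W] Query.prems(4) unfolding Query.prems(5) by simp
    then obtain u where "u \<le> K" "exec orc' (q x y) S u (S(r y := orc (S (r x))))"
      using Q[of x y S] Query.prems by auto
    with Query show ?case using inj
      by (intro exI[of _ u] exI[of _ "S(r y := orc (S (r x)))"]) (clarify, simp del: fun_upd_apply add: upd, simp add: o_def)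
  next
    case (Seq c s t s' d t' s'')
    then have p: "regs_below N c" "l + t \<le> W" "regs_below N d" "l + t + t' \<le> W"
      "\<forall>q. length (orc q) \<le> l + t" by (simp_all add: trans_le_add1)
    obtain u S' where 1: "exec orc' (translate r q c) S u S'" "S' \<circ> r = s'"
        "\<forall>z. z \<notin> range r \<longrightarrow> S' z = S0 z" "u \<le> t * K"
      using Seq.IH(1)[OF p(1) Seq.prems(2,3) p(2) Seq.prems(5,6,7)] by blast
    have f: "\<forall>v\<ge>N. s' v = []" using exec_frame[OF Seq.hyps(1) p(1)] Seq.prems(7) by simp
    have "bnd (l + t) s'" using exec_bnd[OF Seq.hyps(1)] Seq.prems by blast
    then obtain u' S'' where 2: "exec orc' (translate r q d) S' u' S''" "S'' \<circ> r = s''"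
        "\<forall>z. z \<notin> range r \<longrightarrow> S'' z = S0 z" "u' \<le> t' * K"
      using Seq.IH(2)[OF p(3) _ p(5,4) 1(2,3) f] by blast
    from exec.Seq[OF 1(1) 2(1)] have "exec orc' (translate r q (Seq c d)) S (u + u') S''" by simp
    moreover have "u + u' \<le> (t + t') * K" using 1(4) 2(4) by (simp add: algebra_simps)
    ultimately show ?case using 2 by blast
  next
    case (Branch_empty s x c t s' d e)
    then have p: "regs_below N c" "l + t \<le> W" by simp_all
    obtain u S' where 1: "exec orc' (translate r q c) S u S'" "S' \<circ> r = s'"
        "\<forall>z. z \<notin> range r \<longrightarrow> S' z = S0 z" "u \<le> t * K"
      using Branch_empty.IH[OF p(1) Branch_empty.prems(2,3) p(2) Branch_empty.prems(5,6,7)] by blast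
    have "S (r x) = []" using Branch_empty.hyps(1) unfolding Branch_empty.prems(5)[symmetric] by simp
    from exec.Branch_empty[OF this 1(1)] have "exec orc' (translate r q (Branch x c d e)) S (Suc u) S'" by simp
    moreover have "Suc u \<le> Suc t * K" using 1(4) K by simp
    ultimately show ?case using 1 by blast
  next
    case (Branch_False s x w d t s' c e)
    then have p: "regs_below N d" "l + t \<le> W" by simp_all
    obtain u S' where 1: "exec orc' (translate r q d) S u S'" "S' \<circ> r = s'"
        "\<forall>z. z \<notin> range r \<longrightarrow> S' z = S0 z" "u \<le> t * K"
      using Branch_False.IH[OF p(1) Branch_False.prems(2,3) p(2) Branch_False.prems(5,6,7)] by blast
    have "S (r x) = False # w" using Branch_False.hyps(1) unfolding Branch_False.prems(5)[symmetric] by simp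
    from exec.Branch_False[OF this 1(1)] have "exec orc' (translate r q (Branch x c d e)) S (Suc u) S'" by simp
    moreover have "Suc u \<le> Suc t * K" using 1(4) K by simp
    ultimately show ?case using 1 by blast
  next
    case (Branch_True s x w e t s' c d)
    then have p: "regs_below N e" "l + t \<le> W" by simp_all
    obtain u S' where 1: "exec orc' (translate r q e) S u S'" "S' \<circ> r = s'"
        "\<forall>z. z \<notin> range r \<longrightarrow> S' z = S0 z" "u \<le> t * K"
      using Branch_True.IH[OF p(1) Branch_True.prems(2,3) p(2) Branch_True.prems(5,6,7)] by blast
    have "S (r x) = True # w" using Branch_True.hyps(1) unfolding Branch_True.prems(5)[symmetric] by simp
    from exec.Branch_True[OF this 1(1)] have "exec orc' (translate r q (Branch x c d e)) S (Suc u) S'" by simp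
    moreover have "Suc u \<le> Suc t * K" using 1(4) K by simp
    ultimately show ?case using 1 by blast
  next
    case (While_empty s x c)
    then have "S (r x) = []" using While_empty.hyps(1) unfolding While_empty.prems(5)[symmetric] by simp
    then have "exec orc' (translate r q (While x c)) S 1 S" using exec.While_empty[of S "r x"] by simp
    then show ?case using While_empty.prems(5,6) K by (metis mult_1)
  next
    case (While_step s x c t s' t' s'')
    then have p: "regs_below N c" "l + t \<le> W" "regs_below N (While x c)" "l + t + t' \<le> W"
      "\<forall>q. length (orc q) \<le> l + t" by (simp_all add: trans_le_add1)
    obtain u S' where 1: "exec orc' (translate r q c) S u S'" "S' \<circ> r = s'"
        "\<forall>z. z \<notin> range r \<longrightarrow> S' z = S0 z" "u \<le> t * K"
      using While_step.IH(1)[OF p(1) While_step.prems(2,3) p(2) While_step.prems(5,6,7)] by blast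
    have f: "\<forall>v\<ge>N. s' v = []" using exec_frame[OF While_step.hyps(2) p(1)] While_step.prems(7) by simp
    have "bnd (l + t) s'" using exec_bnd[OF While_step.hyps(2)] While_step.prems by blast
    then obtain u' S'' where 2: "exec orc' (translate r q (While x c)) S' u' S''" "S'' \<circ> r = s''"
        "\<forall>z. z \<notin> range r \<longrightarrow> S'' z = S0 z" "u' \<le> t' * K"
      using While_step.IH(2)[OF p(3) _ p(5,4) 1(2,3) f] by blast
    have "S (r x) \<noteq> []" using While_step.hyps(1) unfolding While_step.prems(5)[symmetric] by simp
    from exec.While_step[OF this 1(1) 2(1)[simplified]]
    have "exec orc' (translate r q (While x c)) S (Suc (u + u')) S''" by simp
    moreover have "Suc (u + u') \<le> Suc (t + t') * K" using 1(4) 2(4) K by (simp add: algebra_simps)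
    ultimately show ?case using 2 by blast
  qed
qed

section \<open>Clearing, moving and copying stacks\<close>

definition clear :: "nat \<Rightarrow> com" where
  "clear x = While x (Pop x)"

lemma exec_clear: "exec orc (clear x) s (2 * length (s x) + 1) (s(x := []))"
proof (induction "s x" arbitrary: s)
  case Nil
  then have "s(x := []) = s" by auto
  then show ?case using exec.While_empty Nil unfolding clear_def by (simp del: fun_upd_apply)
next
  case (Cons b w)
  have "exec orc (clear x) (s(x := w)) (2 * length w + 1) (s(x := []))"
    using Cons(1)[of "s(x := w)"] by simp
  moreover have "exec orc (Pop x) s 1 (s(x := w))"
    using exec.Pop Cons(2) by (metis list.sel(3))
  ultimately show ?case
    using exec.While_step[where x = x and c = "Pop x" and t = 1] Cons(2)[symmetric] unfolding clear_def by fastforce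
qed

definition move :: "nat \<Rightarrow> nat \<Rightarrow> com" where
  "move x y = While x (Branch x Skip (Seq (Push False y) (Pop x)) (Seq (Push True y) (Pop x)))"

lemma exec_move:
  "x \<noteq> y \<Longrightarrow> exec orc (move x y) s (4 * length (s x) + 1) (s(x := [], y := rev (s x) @ s y))"
proof (induction "s x" arbitrary: s)
  case Nil
  then have "s(x := [], y := rev (s x) @ s y) = s" by auto
  then show ?case using exec.While_empty Nil unfolding move_def by (simp del: fun_upd_apply)
next
  case (Cons b w)
  let ?s = "s(y := b # s y, x := w)"
  let ?B = "Branch x Skip (Seq (Push False y) (Pop x)) (Seq (Push True y) (Pop x))"
  have "exec orc (Seq (Push b y) (Pop x)) s (1 + 1) ?s"
    using exec.Seq[OF exec.Push[of orc b y s] exec.Pop[of orc x]] Cons(2)[symmetric] Cons(3) by simp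
  then have 1: "exec orc ?B s (Suc (1 + 1)) ?s"
    using Cons(2)[symmetric] by (cases b) (auto intro: exec.intros)
  have "s x \<noteq> []" using Cons(2) by auto
  moreover have "exec orc (move x y) ?s (4 * length w + 1) (s(x := [], y := rev (s x) @ s y))"
    using Cons(1)[of ?s] Cons(2)[symmetric] Cons(3) by (simp add: fun_upd_twist)
  ultimately have "exec orc (move x y) s (Suc (Suc (1 + 1) + (4 * length w + 1)))
      (s(x := [], y := rev (s x) @ s y))"
    using exec.While_step[OF _ 1] unfolding move_def by blast
  then show ?case using Cons(2)[symmetric] by (simp add: eval_nat_numeral)
qed

definition move2 :: "nat \<Rightarrow> nat \<Rightarrow> nat \<Rightarrow> com" where
  "move2 z x y = While z (Branch z Skip (Seq (Push False x) (Seq (Push False y) (Pop z)))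
     (Seq (Push True x) (Seq (Push True y) (Pop z))))"

lemma exec_move2:
  "distinct [x, y, z] \<Longrightarrow> exec orc (move2 z x y) s (5 * length (s z) + 1)
    (s(z := [], x := rev (s z) @ s x, y := rev (s z) @ s y))"
proof (induction "s z" arbitrary: s)
  case Nil
  then have "s(z := [], x := rev (s z) @ s x, y := rev (s z) @ s y) = s" by auto
  then show ?case using exec.While_empty Nil unfolding move2_def by (simp del: fun_upd_apply)
next
  case (Cons b w)
  let ?s = "s(x := b # s x, y := b # s y, z := w)"
  let ?B = "Branch z Skip (Seq (Push False x) (Seq (Push False y) (Pop z)))
     (Seq (Push True x) (Seq (Push True y) (Pop z)))"
  have "exec orc (Seq (Push b x) (Seq (Push b y) (Pop z))) s (1 + (1 + 1)) ?s"
    using exec.Seq[OF exec.Push[of orc b x s] exec.Seq[OF exec.Push[of orc b y] exec.Pop[of orc z]]]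
      Cons(2)[symmetric] Cons(3) by simp
  then have 1: "exec orc ?B s (Suc (1 + (1 + 1))) ?s"
    using Cons(2)[symmetric] by (cases b) (auto intro: exec.intros)
  have "s z \<noteq> []" using Cons(2) by auto
  moreover have "exec orc (move2 z x y) ?s (5 * length w + 1)
      (s(z := [], x := rev (s z) @ s x, y := rev (s z) @ s y))"
    using Cons(1)[of ?s] Cons(2)[symmetric] Cons(3) by (simp add: fun_upd_twist)
  ultimately have "exec orc (move2 z x y) s (Suc (Suc (1 + (1 + 1)) + (5 * length w + 1)))
      (s(z := [], x := rev (s z) @ s x, y := rev (s z) @ s y))"
    using exec.While_step[OF _ 1] unfolding move2_def by blast
  then show ?case using Cons(2)[symmetric] by (simp add: eval_nat_numeral)
qed

text \<open>Moving reverses a stack, so a copy takes two passes: into the auxiliary stack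
  \<open>z\<close>, and from there back into \<open>x\<close> and \<open>y\<close> at once.\<close>

definition copy :: "nat \<Rightarrow> nat \<Rightarrow> nat \<Rightarrow> com" where
  "copy x y z = Seq (move x z) (move2 z x y)"

lemma exec_copy:
  assumes "distinct [x, y, z]" "s y = []" "s z = []"
  shows "exec orc (copy x y z) s (9 * length (s x) + 2) (s(y := s x))"
proof -
  let ?s = "s(x := [], z := rev (s x))"
  have 1: "exec orc (move x z) s (4 * length (s x) + 1) ?s"
    using exec_move[of x z orc s] assms by simp
  have 2: "exec orc (move2 z x y) ?s (5 * length (s x) + 1) (s(y := s x))"
    using exec_move2[of x y z orc ?s] assms by (simp add: fun_upd_twist fun_upd_idem)
  show ?thesis using exec.Seq[OF 1 2] unfolding copy_def by simp
qed

primrec copies :: "nat list \<Rightarrow> nat \<Rightarrow> nat \<Rightarrow> com" where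
  "copies [] b z = Skip"
| "copies (x # xs) b z = Seq (copy x b z) (copies xs (Suc b) z)"

lemma exec_copies:
  assumes "set xs \<subseteq> {..<b}" "b + length xs \<le> z" "\<forall>v\<ge>b. s v = []" "bnd l s"
  shows "\<exists>t. exec orc (copies xs b z) s t
      (\<lambda>v. if b \<le> v \<and> v < b + length xs then s (xs ! (v - b)) else s v) \<and>
    t \<le> length xs * (9 * l + 2) + 1"
  using assms
proof (induction xs arbitrary: b s)
  case Nil
  have "(\<lambda>v. if b \<le> v \<and> v < b + length [] then s ([] ! (v - b)) else s v) = s"
    by (rule ext) auto
  then show ?case using exec.Skip by (auto intro!: exI[of _ 1] simp del: One_nat_def)
next
  case (Cons x xs)
  let ?s = "s(b := s x)"
  have 1: "exec orc (copy x b z) s (9 * length (s x) + 2) ?s"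
    by (rule exec_copy) (use Cons.prems in auto)
  have b: "set xs \<subseteq> {..<Suc b}" "Suc b + length xs \<le> z" "\<forall>v\<ge>Suc b. ?s v = []" "bnd l ?s"
    using Cons.prems by (auto simp: bnd_def)
  obtain t where t: "exec orc (copies xs (Suc b) z) ?s t
      (\<lambda>v. if Suc b \<le> v \<and> v < Suc b + length xs then ?s (xs ! (v - Suc b)) else ?s v)"
    "t \<le> length xs * (9 * l + 2) + 1"
    using Cons.IH[OF b] by blast
  have "(\<lambda>v. if Suc b \<le> v \<and> v < Suc b + length xs then ?s (xs ! (v - Suc b)) else ?s v) =
    (\<lambda>v. if b \<le> v \<and> v < b + length (x # xs) then s ((x # xs) ! (v - b)) else s v)"
  proof
    fix v
    consider "v < b \<or> b + length (x # xs) \<le> v" | "v = b" | i where "v = Suc (b + i)" "i < length xs"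
      by (metis add_Suc less_imp_Suc_add linorder_neqE_nat list.size(4) nat_add_left_cancel_less
          not_le One_nat_def Suc_less_eq add.right_neutral add_Suc_right)
    then show "(if Suc b \<le> v \<and> v < Suc b + length xs then ?s (xs ! (v - Suc b)) else ?s v) =
      (if b \<le> v \<and> v < b + length (x # xs) then s ((x # xs) ! (v - b)) else s v)"
    proof cases
      case 3
      then have "xs ! i \<in> set xs" by simp
      then have "xs ! i \<noteq> b" using Cons.prems by auto
      then show ?thesis using 3 by simp
    qed auto
  qed
  moreover have "length (s x) \<le> l" using Cons.prems unfolding bnd_def by auto
  ultimately show ?case
    using exec.Seq[OF 1 t(1)] t(2) by (intro exI[of _ "9 * length (s x) + 2 + t"]) simp
qed

primrec clears :: "nat \<Rightarrow> nat \<Rightarrow> com" where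
  "clears 0 b = Skip"
| "clears (Suc N) b = Seq (clear (b + N)) (clears N b)"

lemma exec_clears:
  assumes "bnd l s"
  shows "\<exists>t. exec orc (clears N b) s t (\<lambda>v. if b \<le> v \<and> v < b + N then [] else s v) \<and>
    t \<le> N * (2 * l + 1) + 1"
  using assms
proof (induction N arbitrary: s)
  case 0
  have "(\<lambda>v. if b \<le> v \<and> v < b + 0 then [] else s v) = s"
    by (rule ext) auto
  then show ?case using exec.Skip by (auto intro!: exI[of _ 1] simp del: One_nat_def)
next
  case (Suc N)
  let ?s = "s(b + N := [])"
  have b: "bnd l ?s" using Suc.prems by (simp add: bnd_def)
  obtain t where t: "exec orc (clears N b) ?s t (\<lambda>v. if b \<le> v \<and> v < b + N then [] else ?s v)"
      "t \<le> N * (2 * l + 1) + 1"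
    using Suc.IH[of ?s] b by blast
  have "(\<lambda>v. if b \<le> v \<and> v < b + N then [] else ?s v) =
      (\<lambda>v. if b \<le> v \<and> v < b + Suc N then [] else s v)"
    by (auto simp: fun_eq_iff)
  moreover have "length (s (b + N)) \<le> l" using Suc.prems unfolding bnd_def by auto
  ultimately show ?case
    using exec.Seq[OF exec_clear t(1)] t(2)
    by (intro exI[of _ "2 * length (s (b + N)) + 1 + t"]) simp
qed

section \<open>Polynomial-time functions\<close>

text \<open>Bounded by a polynomial rather than equal to one: running times can then be written as
  plain expressions and discharged by introduction rules, without exhibiting polynomials.\<close>

definition polyb :: "(nat \<Rightarrow> nat) \<Rightarrow> bool" where
  "polyb f \<longleftrightarrow> (\<exists>p. \<forall>x. f x \<le> poly p x)"

named_theorems polyb_intros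

lemma polyb_const [polyb_intros]: "polyb (\<lambda>x. k)"
  unfolding polyb_def by (rule exI[of _ "[:k:]"]) simp

lemma polyb_id [polyb_intros]: "polyb (\<lambda>x. x)"
  unfolding polyb_def by (rule exI[of _ "[:0, 1:]"]) simp

lemma polyb_add [polyb_intros]: "polyb f \<Longrightarrow> polyb g \<Longrightarrow> polyb (\<lambda>x. f x + g x)"
  unfolding polyb_def by (metis add_mono poly_add)

lemma polyb_mult [polyb_intros]: "polyb f \<Longrightarrow> polyb g \<Longrightarrow> polyb (\<lambda>x. f x * g x)"
  unfolding polyb_def by (metis mult_le_mono poly_mult)

lemma polyb_Suc [polyb_intros]: "polyb f \<Longrightarrow> polyb (\<lambda>x. Suc (f x))"
  using polyb_add[OF polyb_const[of 1]] by simp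

lemma polyb_poly [polyb_intros]: "polyb f \<Longrightarrow> polyb (\<lambda>x. poly q (f x))"
  unfolding polyb_def by (metis order_trans poly_mono_nat poly_pcompose)

definition wbnd :: "nat \<Rightarrow> word list \<Rightarrow> bool" where
  "wbnd l ws \<longleftrightarrow> (\<forall>w\<in>set ws. length w \<le> l)"

lemma no_oracle_length [simp]: "length (no_oracle q) \<le> l"
  by (simp add: no_oracle_def)

lemma bnd_init: "wbnd l ws \<Longrightarrow> bnd l (init ws)"
  by (auto simp: wbnd_def bnd_def init_def)

text \<open>The domain \<open>D\<close> is a promise on the arguments. It is indispensable for the
  simulated play, because the given program may diverge on words that do not code an actual
  history.\<close>

definition ptime :: "nat \<Rightarrow> word list set \<Rightarrow> (word list \<Rightarrow> word) \<Rightarrow> bool" where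
  "ptime a D f \<longleftrightarrow> (\<exists>c p. \<forall>ws\<in>D. \<forall>l. length ws = a \<longrightarrow> wbnd l ws \<longrightarrow>
    (\<exists>t s. exec no_oracle c (init ws) t s \<and> s 0 = f ws \<and> t \<le> poly p l))"

lemma ptimeI:
  assumes "polyb P"
    and "\<And>ws l. ws \<in> D \<Longrightarrow> length ws = a \<Longrightarrow> wbnd l ws \<Longrightarrow>
      \<exists>t s. exec no_oracle c (init ws) t s \<and> s 0 = f ws \<and> t \<le> P l"
  shows "ptime a D f"
  using assms unfolding polyb_def ptime_def by (meson order_trans)

lemma ptimeE:
  assumes "ptime a D f"
  obtains c p where "\<forall>ws l. ws \<in> D \<longrightarrow> length ws = a \<longrightarrow> wbnd l ws \<longrightarrow>
    (\<exists>t s. exec no_oracle c (init ws) t s \<and> s 0 = f ws \<and> t \<le> poly p l)"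
  using assms unfolding ptime_def by blast

lemma ptime_cong:
  assumes "ptime a E g" "\<And>ws. ws \<in> D \<Longrightarrow> length ws = a \<Longrightarrow> ws \<in> E \<and> f ws = g ws"
  shows "ptime a D f"
  using assms unfolding ptime_def by metis

lemma ptime_subset: "ptime a E f \<Longrightarrow> D \<subseteq> E \<Longrightarrow> ptime a D f"
  by (rule ptime_cong[of a E f]) auto

section \<open>Store transformations with clean scratch registers\<close>

definition lows :: "nat \<Rightarrow> store set" where
  "lows b = {s. \<forall>z\<ge>b. s z = []}"

lemma init_lows: "length ws \<le> b \<Longrightarrow> init ws \<in> lows b"
  by (auto simp: lows_def init_def)

text \<open>The counterpart of \<open>ptime\<close> for whole stores. Registers below
  \<open>b\<close> are variables; those from \<open>b\<close> on are scratch space, empty before and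
  after, so that transformations can be chained.\<close>

definition ok :: "nat \<Rightarrow> store set \<Rightarrow> (store \<Rightarrow> store) \<Rightarrow> bool" where
  "ok b D F \<longleftrightarrow> (\<exists>d p. \<forall>s\<in>D \<inter> lows b. \<forall>l. bnd l s \<longrightarrow>
    (\<exists>t. exec no_oracle d s t (F s) \<and> t \<le> poly p l)) \<and> (\<forall>s\<in>D \<inter> lows b. F s \<in> lows b)"

lemma okI:
  assumes "polyb P" "\<And>s. s \<in> D \<Longrightarrow> s \<in> lows b \<Longrightarrow> F s \<in> lows b"
    and "\<And>s l. s \<in> D \<Longrightarrow> s \<in> lows b \<Longrightarrow> bnd l s \<Longrightarrow> \<exists>t. exec no_oracle d s t (F s) \<and> t \<le> P l"
  shows "ok b D F"
  using assms unfolding polyb_def ok_def by (meson IntE order_trans)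

lemma okE:
  assumes "ok b D F"
  obtains d p where "\<forall>s l. s \<in> D \<longrightarrow> s \<in> lows b \<longrightarrow> bnd l s \<longrightarrow>
      (\<exists>t. exec no_oracle d s t (F s) \<and> t \<le> poly p l)"
    and "\<forall>s. s \<in> D \<longrightarrow> s \<in> lows b \<longrightarrow> F s \<in> lows b"
  using assms unfolding ok_def by blast

lemma ok_cong:
  assumes "ok b E G" "\<And>s. s \<in> D \<Longrightarrow> s \<in> lows b \<Longrightarrow> s \<in> E \<and> F s = G s"
  shows "ok b D F"
  using assms unfolding ok_def by (metis IntE IntI)

lemma ok_seq:
  assumes F: "ok b D F" and G: "ok b E G" and D: "\<And>s. s \<in> D \<Longrightarrow> s \<in> lows b \<Longrightarrow> F s \<in> E"
  shows "ok b D (\<lambda>s. G (F s))"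
proof -
  from F obtain d p where d0: "\<forall>s l. s \<in> D \<longrightarrow> s \<in> lows b \<longrightarrow> bnd l s \<longrightarrow>
      (\<exists>t. exec no_oracle d s t (F s) \<and> t \<le> poly p l)"
    and d0': "\<forall>s. s \<in> D \<longrightarrow> s \<in> lows b \<longrightarrow> F s \<in> lows b" by (rule okE)
  note d = d0[rule_format] and d' = d0'[rule_format]
  from G obtain e q where e0: "\<forall>s l. s \<in> E \<longrightarrow> s \<in> lows b \<longrightarrow> bnd l s \<longrightarrow>
      (\<exists>t. exec no_oracle e s t (G s) \<and> t \<le> poly q l)"
    and e0': "\<forall>s. s \<in> E \<longrightarrow> s \<in> lows b \<longrightarrow> G s \<in> lows b" by (rule okE)
  note e = e0[rule_format] and e' = e0'[rule_format]
  show ?thesis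
  proof (rule okI[where d = "Seq d e" and P = "\<lambda>l. poly p l + poly q (l + poly p l)"])
    fix s l assume s: "s \<in> D" "s \<in> lows b" "bnd l s"
    obtain t where t: "exec no_oracle d s t (F s)" "t \<le> poly p l" using d[OF s] by blast
    have "bnd (l + t) (F s)" using exec_bnd[OF t(1) s(3)] by simp
    then obtain u where u: "exec no_oracle e (F s) u (G (F s))" "u \<le> poly q (l + t)"
      using e D d' s by blast
    have "u \<le> poly q (l + poly p l)" using u(2) t(2) by (meson add_left_mono order_trans poly_mono_nat)
    with exec.Seq[OF t(1) u(1)] t(2)
    show "\<exists>t. exec no_oracle (Seq d e) s t (G (F s)) \<and> t \<le> poly p l + poly q (l + poly p l)"
      by (intro exI[of _ "t + u"]) simp
  qed (auto intro!: polyb_intros D d' e')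
qed

lemma ptime_ok:
  assumes "ok b E F" "a \<le> b"
    "\<And>ws. ws \<in> D \<Longrightarrow> length ws = a \<Longrightarrow> init ws \<in> E \<and> F (init ws) 0 = f ws"
  shows "ptime a D f"
proof -
  from assms(1) obtain d p where d0: "\<forall>s l. s \<in> E \<longrightarrow> s \<in> lows b \<longrightarrow> bnd l s \<longrightarrow>
      (\<exists>t. exec no_oracle d s t (F s) \<and> t \<le> poly p l)"
    and d0': "\<forall>s. s \<in> E \<longrightarrow> s \<in> lows b \<longrightarrow> F s \<in> lows b" by (rule okE)
  note d = d0[rule_format] and d' = d0'[rule_format]
  show ?thesis
    by (rule ptimeI[where c = d and P = "poly p"])
      (use d assms init_lows bnd_init in \<open>fastforce intro: polyb_intros\<close>)+
qed

text \<open>The program for \<open>f\<close> runs in the \<open>N\<close> fresh registers from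
  \<open>b\<close> on: arguments are copied in, the result is copied from register \<open>b\<close>
  to \<open>y\<close>, and the block is wiped. Register \<open>b + N\<close>, just behind the block,
  is the auxiliary stack for the copying.\<close>

lemma ok_assign:
  assumes f: "ptime a E f" and xs: "length xs = a" "set xs \<subseteq> {..<b}" and y: "y < b"
    and E: "\<And>s. s \<in> D \<Longrightarrow> s \<in> lows b \<Longrightarrow> map s xs \<in> E"
  shows "ok b D (\<lambda>s. s(y := f (map s xs)))"
proof -
  from f obtain c p where c0: "\<forall>ws l. ws \<in> E \<longrightarrow> length ws = a \<longrightarrow> wbnd l ws \<longrightarrow>
    (\<exists>t s. exec no_oracle c (init ws) t s \<and> s 0 = f ws \<and> t \<le> poly p l)"
    by (rule ptimeE)
  note c = c0[rule_format]
  obtain N0 where "regs_below N0 c" using ex_regs_below by blast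
  then obtain N where N: "regs_below N c" "a < N"
    using regs_below_mono[of N0 c "Suc (N0 + a)"] by force
  define r where "r = (\<lambda>v::nat. v + b)"
  define e where "e = translate r (\<lambda>x y. Query (r x) (r y)) c"
  define d where "d = Seq (copies xs b (b + N)) (Seq e (Seq (clear y)
    (Seq (copy b y (b + N)) (clears N b))))"
  have inj: "inj r" by (auto simp: r_def inj_def)
  have range: "z \<notin> range r \<longleftrightarrow> z < b" for z
    by (auto simp: r_def image_def) (metis le_add_diff_inverse2 not_le)
  let ?P = "\<lambda>l. (a * (9 * l + 2) + 1) + (poly p l + ((2 * l + 1) +
    ((9 * (l + poly p l) + 2) + (N * (2 * (l + poly p l) + 1) + 1))))"
  show ?thesis
  proof (rule okI[where d = d and P = ?P])
    fix s l assume s: "s \<in> D" "s \<in> lows b" and l: "bnd l s"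
    have l0: "wbnd l (map s xs)" using l by (auto simp: wbnd_def bnd_def)
    obtain t i' where t: "exec no_oracle c (init (map s xs)) t i'" "i' 0 = f (map s xs)" "t \<le> poly p l"
      using c[OF E[OF s] _ l0] xs(1) by auto
    define s1 where "s1 = (\<lambda>v. if b \<le> v \<and> v < b + length xs then s (xs ! (v - b)) else s v)"
    obtain t1 where t1: "exec no_oracle (copies xs b (b + N)) s t1 s1" "t1 \<le> a * (9 * l + 2) + 1"
      using exec_copies[OF xs(2), of "b + N" s l no_oracle] s(2) l N(2) xs(1)
      unfolding s1_def by (auto simp: lows_def)
    have s1r: "s1 \<circ> r = init (map s xs)"
      using s(2) by (auto simp: s1_def r_def init_def lows_def fun_eq_iff)
    have "\<exists>u S'. exec no_oracle (translate r (\<lambda>x y. Query (r x) (r y)) c) s1 u S' \<and> S' \<circ> r = i' \<and>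
        (\<forall>z. z \<notin> range r \<longrightarrow> S' z = s1 z) \<and> u \<le> t * 1"
    proof (rule exec_translate[where N = N and W = "l + t" and ?S0.0 = s1,
          OF inj order_refl _ t(1) N(1) bnd_init[OF l0]])
      show "\<exists>u\<le>1. exec no_oracle (Query (r x) (r y)) S u (S(r y := no_oracle (S (r x))))" for S x y
        using exec.Query by blast
    qed (use s1r N xs in \<open>simp_all add: init_def\<close>)
    then obtain u s2 where s2: "exec no_oracle e s1 u s2" "s2 \<circ> r = i'" "\<forall>z<b. s2 z = s1 z" "u \<le> t * 1"
      unfolding e_def[symmetric] range by blast
    have i': "bnd (l + t) i'" using exec_bnd[OF t(1) bnd_init[OF l0]] by simp
    have i'N: "i' v = []" if "N \<le> v" for v
      using exec_frame[OF t(1) N(1) that] that N(2) xs(1) by (simp add: init_def)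
    have s2r: "s2 (v + b) = i' v" for v using s2(2) by (auto simp: r_def)
    have s2l: "s2 v = s v" if "v < b" for v using s2(3) that by (simp add: s1_def)
    have s2b: "length (s2 v) \<le> l + t" for v
    proof (cases "v < b")
      case True
      then show ?thesis using s2l l by (simp add: bnd_def trans_le_add1)
    next
      case False
      then show ?thesis using s2r[of "v - b"] i' by (simp add: bnd_def)
    qed
    define s4 where "s4 = s2(y := f (map s xs))"
    have 3: "exec no_oracle (clear y) s2 (2 * length (s y) + 1) (s2(y := []))"
      using exec_clear[of no_oracle y s2] s2l[OF y] by simp
    have "exec no_oracle (copy b y (b + N)) (s2(y := [])) (9 * length ((s2(y := [])) b) + 2)
        ((s2(y := []))(y := (s2(y := [])) b))"
      by (rule exec_copy) (use y N s2r[of N] i'N in \<open>auto simp: add.commute\<close>)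
    then have 4: "exec no_oracle (copy b y (b + N)) (s2(y := [])) (9 * length (i' 0) + 2) s4"
      using s2r[of 0] y t(2) by (simp add: s4_def)
    have "bnd (l + t) s4" using s2b i' t(2) unfolding s4_def bnd_def by (metis fun_upd_apply)
    from exec_clears[OF this, of no_oracle N b] obtain t5 where
      t5: "exec no_oracle (clears N b) s4 t5 (\<lambda>v. if b \<le> v \<and> v < b + N then [] else s4 v)"
        "t5 \<le> N * (2 * (l + t) + 1) + 1" by blast
    have eq: "(\<lambda>v. if b \<le> v \<and> v < b + N then [] else s4 v) = s(y := f (map s xs))"
    proof
      fix v
      consider "v < b" | "b \<le> v" "v < b + N" | "b + N \<le> v" by linarith
      then show "(if b \<le> v \<and> v < b + N then [] else s4 v) = (s(y := f (map s xs))) v"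
      proof cases
        case 1
        then show ?thesis using s2l by (simp add: s4_def)
      next
        case 2
        then show ?thesis using s(2) y by (simp add: lows_def)
      next
        case 3
        then show ?thesis using s(2) y s2r[of "v - b"] i'N[of "v - b"] by (simp add: lows_def s4_def)
      qed
    qed
    have "exec no_oracle d s (t1 + (u + ((2 * length (s y) + 1) + ((9 * length (i' 0) + 2) + t5))))
        (s(y := f (map s xs)))"
      unfolding d_def by (intro exec.Seq) (rule t1 s2 3 4 t5(1)[unfolded eq])+
    moreover have "t1 + (u + ((2 * length (s y) + 1) + ((9 * length (i' 0) + 2) + t5))) \<le> ?P l"
    proof (intro add_mono)
      show "2 * length (s y) \<le> 2 * l" using l by (simp add: bnd_def)
      have "length (i' 0) \<le> l + t" using i' by (simp add: bnd_def)
      then show "9 * length (i' 0) \<le> 9 * (l + poly p l)" using t(3) by simp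
      have "N * (2 * (l + t) + 1) \<le> N * (2 * (l + poly p l) + 1)"
        using t(3) by (intro mult_le_mono) auto
      then show "t5 \<le> N * (2 * (l + poly p l) + 1) + 1" using t5(2) by linarith
    qed (use t1(2) s2(4) t(3) in auto)
    ultimately show "\<exists>t. exec no_oracle d s t (s(y := f (map s xs))) \<and> t \<le> ?P l" by blast
  qed (use y in \<open>auto simp: lows_def intro!: polyb_intros\<close>)
qed

text \<open>Each pass consumes one bit of stack \<open>x\<close>, so the number of passes is fixed
  at the start. The bound \<open>q\<close> on all intermediate stores is essential: a
  polynomial-time body that doubles a stack would otherwise lead to exponential growth. The
  invariant \<open>J\<close> relates the initial store, the number of passes and the current
  store.\<close>

lemma ok_while:
  assumes H: "ok b E H"
    and J0: "\<And>s. s \<in> D \<Longrightarrow> s \<in> lows b \<Longrightarrow> J s 0 s"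
    and Jx: "\<And>s i s'. s \<in> D \<Longrightarrow> J s i s' \<Longrightarrow> s' x = drop i (s x)"
    and JS: "\<And>s i s'. s \<in> D \<Longrightarrow> J s i s' \<Longrightarrow> s' \<in> lows b \<Longrightarrow> i < length (s x) \<Longrightarrow>
      s' \<in> E \<and> J s (Suc i) (H s')"
    and Jb: "\<And>s i s' l. s \<in> D \<Longrightarrow> J s i s' \<Longrightarrow> i \<le> length (s x) \<Longrightarrow> bnd l s \<Longrightarrow> bnd (q l) s'"
    and q: "polyb q"
  shows "\<exists>F. ok b D F \<and> (\<forall>s\<in>D \<inter> lows b. J s (length (s x)) (F s))"
proof -
  from H obtain d p where d0: "\<forall>s l. s \<in> E \<longrightarrow> s \<in> lows b \<longrightarrow> bnd l s \<longrightarrow>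
      (\<exists>t. exec no_oracle d s t (H s) \<and> t \<le> poly p l)"
    and d0': "\<forall>s. s \<in> E \<longrightarrow> s \<in> lows b \<longrightarrow> H s \<in> lows b" by (rule okE)
  note d = d0[rule_format] and d' = d0'[rule_format]
  define F where "F = (\<lambda>s. (H ^^ length (s x)) s)"
  have J: "J s i ((H ^^ i) s) \<and> (H ^^ i) s \<in> lows b" if "s \<in> D" "s \<in> lows b" "i \<le> length (s x)" for s i
    using that(3)
  proof (induction i)
    case 0
    then show ?case using J0 that by simp
  next
    case (Suc i)
    then show ?case using JS[OF that(1), of i "(H ^^ i) s"] d' by simp
  qed
  from q obtain Q where Q: "\<And>l. q l \<le> poly Q l" unfolding polyb_def by blast
  have run: "\<exists>t. exec no_oracle (While x d) ((H ^^ (length (s x) - i)) s) t (F s) \<and>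
      t \<le> i * (poly p (poly Q l) + 1) + 1"
    if s: "s \<in> D" "s \<in> lows b" "bnd l s" and i: "i \<le> length (s x)" for s l i
    using i
  proof (induction i)
    case 0
    have "F s x = []" using Jx[OF s(1)] J[OF s(1,2)] unfolding F_def by fastforce
    then have "exec no_oracle (While x d) (F s) 1 (F s)" by (rule exec.While_empty)
    then show ?case unfolding F_def by (intro exI[of _ 1]) simp
  next
    case (Suc i)
    let ?m = "length (s x) - Suc i"
    let ?s = "(H ^^ ?m) s"
    have m: "length (s x) - i = Suc ?m" "?m < length (s x)" using Suc.prems by auto
    have Jm: "J s ?m ?s" "?s \<in> lows b" using J[OF s(1,2)] m by auto
    have ne: "?s x \<noteq> []" using Jx[OF s(1) Jm(1)] m by simp
    have "bnd (poly Q l) ?s" using Jb[OF s(1) Jm(1) _ s(3)] m Q bnd_mono by (metis less_imp_le)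
    moreover have "?s \<in> E" using JS[OF s(1) Jm] m by blast
    ultimately obtain t where t: "exec no_oracle d ?s t (H ?s)" "t \<le> poly p (poly Q l)"
      using d Jm(2) by blast
    obtain u where u: "exec no_oracle (While x d) (H ?s) u (F s)" "u \<le> i * (poly p (poly Q l) + 1) + 1"
      using Suc unfolding m(1) by auto
    show ?case
      using exec.While_step[where x = x, OF ne t(1) u(1)] t(2) u(2)
      by (intro exI[of _ "Suc (t + u)"]) simp
  qed
  have "ok b D F"
  proof (rule okI[where d = "While x d" and P = "\<lambda>l. l * (poly p (poly Q l) + 1) + 1"])
    fix s l assume s: "s \<in> D" "s \<in> lows b" "bnd l s"
    then obtain t where "exec no_oracle (While x d) s t (F s)"
        "t \<le> length (s x) * (poly p (poly Q l) + 1) + 1"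
      using run[OF s order_refl] by auto
    moreover have "length (s x) * (poly p (poly Q l) + 1) \<le> l * (poly p (poly Q l) + 1)"
      using s(3) by (intro mult_le_mono) (auto simp: bnd_def)
    ultimately show "\<exists>t. exec no_oracle (While x d) s t (F s) \<and> t \<le> l * (poly p (poly Q l) + 1) + 1"
      by (intro exI[of _ t] conjI) (assumption, linarith)
  next
    show "\<And>s. s \<in> D \<Longrightarrow> s \<in> lows b \<Longrightarrow> F s \<in> lows b" unfolding F_def using J by blast
  qed (intro polyb_intros)
  then show ?thesis using J unfolding F_def by blast
qed

lemma ok_branch:
  assumes "ok b {s \<in> D. s x = []} F" "ok b {s \<in> D. \<exists>w. s x = False # w} G"
    "ok b {s \<in> D. \<exists>w. s x = True # w} H"
  shows "ok b D (\<lambda>s. case s x of [] \<Rightarrow> F s | c # w \<Rightarrow> if c then H s else G s)"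
proof -
  from assms(1) obtain d p where d: "\<forall>s l. s \<in> {s \<in> D. s x = []} \<longrightarrow> s \<in> lows b \<longrightarrow> bnd l s \<longrightarrow>
      (\<exists>t. exec no_oracle d s t (F s) \<and> t \<le> poly p l)"
    "\<forall>s. s \<in> {s \<in> D. s x = []} \<longrightarrow> s \<in> lows b \<longrightarrow> F s \<in> lows b" by (rule okE)
  from assms(2) obtain d1 p1 where d1: "\<forall>s l. s \<in> {s \<in> D. \<exists>w. s x = False # w} \<longrightarrow> s \<in> lows b \<longrightarrow> bnd l s \<longrightarrow>
      (\<exists>t. exec no_oracle d1 s t (G s) \<and> t \<le> poly p1 l)"
    "\<forall>s. s \<in> {s \<in> D. \<exists>w. s x = False # w} \<longrightarrow> s \<in> lows b \<longrightarrow> G s \<in> lows b" by (rule okE)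
  from assms(3) obtain d2 p2 where d2: "\<forall>s l. s \<in> {s \<in> D. \<exists>w. s x = True # w} \<longrightarrow> s \<in> lows b \<longrightarrow> bnd l s \<longrightarrow>
      (\<exists>t. exec no_oracle d2 s t (H s) \<and> t \<le> poly p2 l)"
    "\<forall>s. s \<in> {s \<in> D. \<exists>w. s x = True # w} \<longrightarrow> s \<in> lows b \<longrightarrow> H s \<in> lows b" by (rule okE)
  let ?R = "\<lambda>s. case s x of [] \<Rightarrow> F s | c # w \<Rightarrow> if c then H s else G s"
  show ?thesis
  proof (rule okI[where d = "Branch x d d1 d2" and P = "\<lambda>l. Suc (poly p l + poly p1 l + poly p2 l)"])
    fix s l assume s: "s \<in> D" "s \<in> lows b" "bnd l s"
    consider "s x = []" | w where "s x = False # w" | w where "s x = True # w"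
      by (metis (full_types) list.exhaust)
    then show "\<exists>t. exec no_oracle (Branch x d d1 d2) s t (?R s) \<and>
        t \<le> Suc (poly p l + poly p1 l + poly p2 l)"
    proof cases
      case 1
      then obtain t where "exec no_oracle d s t (F s)" "t \<le> poly p l" using d(1) s by blast
      then show ?thesis using exec.Branch_empty[of s x, OF 1] 1 by fastforce
    next
      case 2
      then obtain t where "exec no_oracle d1 s t (G s)" "t \<le> poly p1 l" using d1(1) s by blast
      then show ?thesis using exec.Branch_False[of s x, OF 2] 2 by fastforce
    next
      case 3
      then obtain t where "exec no_oracle d2 s t (H s)" "t \<le> poly p2 l" using d2(1) s by blast
      then show ?thesis using exec.Branch_True[of s x, OF 3] 3 by fastforce
    qed
  next
    fix s assume s: "s \<in> D" "s \<in> lows b"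
    show "?R s \<in> lows b"
      using d(2) d1(2) d2(2) s by (auto split: list.split)
  qed (intro polyb_intros)
qed

text \<open>The assignments are carried out one after the other but act simultaneously, because the
  targets avoid the sources \<open>xs\<close>.\<close>

lemma ok_massign:
  assumes "\<forall>g\<in>set gs. ptime a E g" and xs: "length xs = a" "set xs \<subseteq> {..<b}"
    and "y + length gs \<le> b" "\<forall>x\<in>set xs. x < y \<or> y + length gs \<le> x"
    and D: "\<And>s. s \<in> D \<Longrightarrow> s \<in> lows b \<Longrightarrow> map s xs \<in> E"
  shows "ok b D (\<lambda>s v. if y \<le> v \<and> v < y + length gs then (gs ! (v - y)) (map s xs) else s v)"
  using assms(1,4,5)
proof (induction gs rule: rev_induct)
  case Nil
  have eq: "(\<lambda>v. if y \<le> v \<and> v < y + length [] then ([] ! (v - y)) (map s xs) else s v) = s" for s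
    by (rule ext) auto
  show ?case
    unfolding eq by (rule okI[where d = Skip and P = "\<lambda>l. 1"]) (use exec.Skip in \<open>auto intro: polyb_intros\<close>)
next
  case (snoc g gs)
  let ?F = "\<lambda>gs s v. if y \<le> v \<and> v < y + length gs then (gs ! (v - y)) (map s xs) else s v"
  have keep: "map (?F gs s) xs = map s xs" for s :: store
    using snoc.prems(3) by force
  have "ok b D (\<lambda>s. (\<lambda>s. s(y + length gs := g (map s xs))) (?F gs s))"
  proof (rule ok_seq[where F = "?F gs" and E = "{s. map s xs \<in> E}"])
    show "ok b D (?F gs)"
    proof (rule snoc.IH)
      show "\<forall>x\<in>set xs. x < y \<or> y + length gs \<le> x" using snoc.prems(3) by force
    qed (use snoc.prems in auto)
    show "ok b {s. map s xs \<in> E} (\<lambda>s. s(y + length gs := g (map s xs)))"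
      by (rule ok_assign[where E = E and a = a]) (use snoc.prems xs in auto)
    show "?F gs s \<in> {s. map s xs \<in> E}" if "s \<in> D" "s \<in> lows b" for s
      using D[OF that] unfolding mem_Collect_eq keep .
  qed
  then show ?case
    by (rule ok_cong) (auto simp del: map_eq_conv simp: keep fun_eq_iff nth_append)
qed

lemma ptime_ident: "ptime 1 D (\<lambda>ws. ws ! 0)"
proof (rule ptimeI[where c = Skip and P = "\<lambda>l. 1"])
  fix ws :: "word list" assume "length ws = 1"
  then show "\<exists>t s. exec no_oracle Skip (init ws) t s \<and> s 0 = ws ! 0 \<and> t \<le> 1"
    using exec.Skip[of no_oracle "init ws"] by (intro exI[of _ 1] exI[of _ "init ws"]) (simp add: init_def)
qed (intro polyb_intros)

lemma ptime_arg: "i < a \<Longrightarrow> ptime a D (\<lambda>ws. ws ! i)"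
proof (rule ptime_ok)
  assume "i < a"
  then show "ok a UNIV (\<lambda>s. s(0 := (\<lambda>ws. ws ! 0) (map s [i])))"
    by (intro ok_assign[OF ptime_ident]) auto
qed (auto simp: init_def)

lemma ptime_comp:
  assumes f: "ptime k E f" and gs: "\<forall>g\<in>set gs. ptime a D g" "length gs = k"
    and im: "\<And>ws. ws \<in> D \<Longrightarrow> length ws = a \<Longrightarrow> map (\<lambda>g. g ws) gs \<in> E"
  shows "ptime a D (\<lambda>ws. f (map (\<lambda>g. g ws) gs))"
proof (rule ptime_ok)
  let ?b = "Suc (a + k)"
  let ?F = "\<lambda>s v. if a \<le> v \<and> v < a + length gs then (gs ! (v - a)) (map s [0..<a]) else s v"
  have args: "map (?F s) [a..<a + k] = map (\<lambda>g. g (map s [0..<a])) gs" for s :: store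
    using gs(2) by (intro nth_equalityI) auto
  show "ok ?b {s. map s [0..<a] \<in> D} (\<lambda>s. (\<lambda>s. s(0 := f (map s [a..<a + k]))) (?F s))"
  proof (rule ok_seq[where F = ?F and E = "{s. map s [a..<a + k] \<in> E}"])
    show "ok ?b {s. map s [0..<a] \<in> D} ?F"
      by (rule ok_massign[OF gs(1)]) (use gs(2) in auto)
    show "ok ?b {s. map s [a..<a + k] \<in> E} (\<lambda>s. s(0 := f (map s [a..<a + k])))"
      by (rule ok_assign[OF f]) auto
    show "?F s \<in> {s. map s [a..<a + k] \<in> E}" if "s \<in> {s. map s [0..<a] \<in> D}" for s
      using im[of "map s [0..<a]"] that unfolding mem_Collect_eq args by simp
  qed
  show "a \<le> ?b" by simp
  fix ws assume ws: "ws \<in> D" "length ws = a"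
  then have "map (init ws) [0..<a] = ws" by (intro nth_equalityI) (auto simp: init_def)
  then show "init ws \<in> {s. map s [0..<a] \<in> D} \<and>
      ((\<lambda>s. s(0 := f (map s [a..<a + k]))) (?F (init ws))) 0 = f (map (\<lambda>g. g ws) gs)"
    using ws unfolding args by simp
qed

lemma ptime_comp1:
  assumes "ptime 1 E f" "ptime a D g" "\<And>ws. ws \<in> D \<Longrightarrow> length ws = a \<Longrightarrow> [g ws] \<in> E"
  shows "ptime a D (\<lambda>ws. f [g ws])"
  using ptime_comp[OF assms(1), of "[g]" a D] assms(2,3) by simp

lemma ptime_nil: "ptime a D (\<lambda>ws. [])"
proof (rule ptimeI[where c = "clear 0" and P = "\<lambda>l. 2 * l + 1"])
  fix ws :: "word list" and l assume "wbnd l ws"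
  then have "length (init ws 0) \<le> l" using bnd_init unfolding bnd_def by blast
  then show "\<exists>t s. exec no_oracle (clear 0) (init ws) t s \<and> s 0 = [] \<and> t \<le> 2 * l + 1"
    using exec_clear[of no_oracle 0 "init ws"]
    by (intro exI[of _ "2 * length (init ws 0) + 1"] exI[of _ "(init ws)(0 := [])"]) simp
qed (intro polyb_intros)

lemma ptime_Cons:
  assumes "ptime a D f"
  shows "ptime a D (\<lambda>ws. b # f ws)"
proof -
  have "ptime 1 UNIV (\<lambda>ws. b # ws ! 0)"
  proof (rule ptimeI[where c = "Push b 0" and P = "\<lambda>l. 1"])
    fix ws :: "word list" assume "length ws = 1"
    then show "\<exists>t s. exec no_oracle (Push b 0) (init ws) t s \<and> s 0 = b # ws ! 0 \<and> t \<le> 1"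
      using exec.Push[of no_oracle b 0 "init ws"]
      by (intro exI[of _ 1] exI[of _ "(init ws)(0 := b # init ws 0)"]) (simp add: init_def)
  qed (intro polyb_intros)
  from ptime_comp1[OF this assms] show ?thesis by simp
qed

lemma ptime_tl:
  assumes "ptime a D f"
  shows "ptime a D (\<lambda>ws. tl (f ws))"
proof -
  have "ptime 1 UNIV (\<lambda>ws. tl (ws ! 0))"
  proof (rule ptimeI[where c = "Pop 0" and P = "\<lambda>l. 1"])
    fix ws :: "word list" assume "length ws = 1"
    then show "\<exists>t s. exec no_oracle (Pop 0) (init ws) t s \<and> s 0 = tl (ws ! 0) \<and> t \<le> 1"
      using exec.Pop[of no_oracle 0 "init ws"]
      by (intro exI[of _ 1] exI[of _ "(init ws)(0 := tl (init ws 0))"]) (simp add: init_def)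
  qed (intro polyb_intros)
  from ptime_comp1[OF this assms] show ?thesis by simp
qed

text \<open>Each branch has to be computable only on its own part of the domain. This is how a
  promise such as halting can be restricted to the turns on which it is available.\<close>

lemma ptime_case:
  assumes c: "ptime a D c"
    and f: "ptime a {ws \<in> D. c ws = []} f" and g: "ptime a {ws \<in> D. \<exists>w. c ws = False # w} g"
    and h: "ptime a {ws \<in> D. \<exists>w. c ws = True # w} h"
  shows "ptime a D (\<lambda>ws. case c ws of [] \<Rightarrow> f ws | b # w \<Rightarrow> if b then h ws else g ws)"
proof (rule ptime_ok)
  let ?b = "Suc a" and ?D = "{s :: store. map s [0..<a] \<in> D}"
    and ?D' = "{s :: store. map s [0..<a] \<in> D \<and> s a = c (map s [0..<a])}"
  let ?A = "\<lambda>f s. s(0 := f (map s [0..<a]))"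
  let ?B = "\<lambda>s. case s a of [] \<Rightarrow> ?A f s | b # w \<Rightarrow> if b then ?A h s else ?A g s"
  have ok_A: "ok ?b {s \<in> ?D'. P (s a)} (?A f)" if "ptime a {ws \<in> D. P (c ws)} f" for f P
    by (rule ok_assign[OF that]) auto
  have keep: "map (s(a := w)) [0..<a] = map s [0..<a]" for s :: store and w by simp
  show "ok ?b ?D (\<lambda>s. ?B (s(a := c (map s [0..<a]))))"
  proof (rule ok_seq[where F = "\<lambda>s. s(a := c (map s [0..<a]))" and E = ?D'])
    show "ok ?b ?D (\<lambda>s. s(a := c (map s [0..<a])))" by (rule ok_assign[OF c]) auto
    show "ok ?b ?D' ?B"
      by (rule ok_branch; rule ok_A) (use f g h in auto)
  qed simp
  show "a \<le> ?b" by simp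
  fix ws assume ws: "ws \<in> D" "length ws = a"
  then have "map (init ws) [0..<a] = ws" by (intro nth_equalityI) (auto simp: init_def)
  then show "init ws \<in> ?D \<and> ?B ((init ws)(a := c (map (init ws) [0..<a]))) 0 =
      (case c ws of [] \<Rightarrow> f ws | b # w \<Rightarrow> if b then h ws else g ws)"
    using ws by (simp add: keep split: list.split)
qed

text \<open>Bounded recursion on notation in the sense of Cobham, with \<open>k\<close> state words
  updated simultaneously by the bits of \<open>x ws\<close>. Partial folds must stay in the domain
  \<open>E\<close> of the step functions (\<open>inv\<close>) and below a polynomial length
  (\<open>bound\<close>).\<close>

lemma ptime_fold:
  fixes gs :: "(word list \<Rightarrow> word) list"
  defines "step \<equiv> (\<lambda>b st. map (\<lambda>g. g ([b] # st)) gs)"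
  assumes x: "ptime a D x" and ini: "\<forall>f\<in>set ini. ptime a D f" "length ini = k"
    and gs: "\<forall>g\<in>set gs. ptime (Suc k) E g" "length gs = k"
    and inv: "\<And>ws i. ws \<in> D \<Longrightarrow> length ws = a \<Longrightarrow> i < length (x ws) \<Longrightarrow>
      [x ws ! i] # fold step (take i (x ws)) (map (\<lambda>f. f ws) ini) \<in> E"
    and bound: "\<And>ws i l. ws \<in> D \<Longrightarrow> length ws = a \<Longrightarrow> i \<le> length (x ws) \<Longrightarrow> wbnd l ws \<Longrightarrow>
      wbnd (q l) (fold step (take i (x ws)) (map (\<lambda>f. f ws) ini))"
    and q: "polyb q" and r: "r < k"
  shows "ptime a D (\<lambda>ws. fold step (x ws) (map (\<lambda>f. f ws) ini) ! r)"
proof -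
  note upt_Suc [simp del]
  let ?b = "a + 2 + 2 * k"
  \<comment> \<open>Layout after the \<open>a\<close> arguments: the bits still to be read in
    \<open>X\<close>, the current bit in \<open>B\<close>, the state in \<open>st\<close>. The next
    state is built in \<open>new\<close>, since all step functions have to see the old one.\<close>
  define X B st new where "X = a" and "B = Suc a" and "st = [a + 2..<a + 2 + k]"
    and "new = [a + 2 + k..<a + 2 + 2 * k]"
  have st: "length st = k" "set st = {a + 2..<a + 2 + k}" "\<And>i. i < k \<Longrightarrow> st ! i = a + 2 + i"
    and new: "length new = k" "set new = {a + 2 + k..<a + 2 + 2 * k}"
      "\<And>i. i < k \<Longrightarrow> new ! i = a + 2 + k + i"
    by (simp_all add: st_def new_def)
  define ins where "ins = (\<lambda>s :: store. map s [0..<a])"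
  define S where "S = (\<lambda>ws i. fold step (take i (x ws)) (map (\<lambda>f. f ws) ini))"
  have len_S: "length (S ws i) = k" for ws i
  proof -
    have "length (fold step xs w) = k" if "length w = k" for xs w
      using that by (induction xs arbitrary: w) (simp_all add: step_def gs(2))
    then show ?thesis by (simp add: S_def ini(2))
  qed
  have S_Suc: "S ws (Suc i) = step (x ws ! i) (S ws i)" if "i < length (x ws)" for ws i
    using that by (simp add: S_def take_Suc_conv_app_nth)
  \<comment> \<open>The leftovers in \<open>B\<close> and \<open>new\<close> are overwritten in the
    next pass; only their lengths matter, for the bound on intermediate stores.\<close>
  define J where "J = (\<lambda>s i s'. ins s' = ins s \<and> s' X = drop i (x (ins s)) \<and>
    map s' st = S (ins s) i \<and> length (s' B) \<le> 1 \<and>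
    (\<forall>v\<in>set new. s' v = [] \<or> s' v \<in> set (S (ins s) i)) \<and> s' \<in> lows ?b)"
  let ?D0 = "{s. ins s \<in> D \<and> (\<forall>v\<ge>a. s v = [])}"
  let ?D1 = "{s. ins s \<in> D \<and> J s 0 s}"
  let ?init = "\<lambda>s v. if a \<le> v \<and> v < a + length (x # (\<lambda>_. []) # ini)
    then ((x # (\<lambda>_. []) # ini) ! (v - a)) (ins s) else s v"
  have ok_init: "ok ?b ?D0 ?init"
    unfolding ins_def
    by (rule ok_massign[where E = D]) (use x ini ptime_nil in auto)
  have init: "?init s \<in> ?D1" "ins (?init s) = ins s" if "s \<in> ?D0" for s
  proof -
    show 1: "ins (?init s) = ins s" by (simp add: ins_def)
    have "map (?init s) st = S (ins s) 0"
      by (rule nth_equalityI) (use ini(2) in \<open>simp_all add: S_def st\<close>)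
    then have "J (?init s) 0 (?init s)"
      unfolding J_def 1
      using that ini(2) by (auto simp: J_def X_def B_def new lows_def)
    then show "?init s \<in> ?D1" using that unfolding mem_Collect_eq 1 by blast
  qed
  define hdw where "hdw = (\<lambda>ws :: word list. case ws ! 0 of [] \<Rightarrow> [] | b # w \<Rightarrow> if b then [True] else [False])"
  have hdw: "ptime 1 UNIV hdw"
    unfolding hdw_def by (intro ptime_case ptime_arg ptime_Cons ptime_nil) auto
  define popb where "popb = (\<lambda>s :: store. s(B := hdw (map s [X])))"
  define pop where "pop = (\<lambda>s :: store. s(X := tl ((map s [X]) ! 0)))"
  define news where "news = (\<lambda>(s :: store) v. if a + 2 + k \<le> v \<and> v < a + 2 + k + length gs
    then (gs ! (v - (a + 2 + k))) (map s (B # st)) else s v)"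
  define projs where "projs = map (\<lambda>i (ws :: word list). ws ! i) [0..<k]"
  define mv where "mv = (\<lambda>(s :: store) v. if a + 2 \<le> v \<and> v < a + 2 + length projs
    then (projs ! (v - (a + 2))) (map s new) else s v)"
  let ?E1 = "{s. s X \<noteq> [] \<and> [hd (s X)] # map s st \<in> E}"
  let ?E2 = "{s. map s (B # st) \<in> E}"
  have ok_popb: "ok ?b ?E1 popb"
    unfolding popb_def by (rule ok_assign[OF hdw]) (auto simp: X_def B_def)
  have ok_pop: "ok ?b ?E2 pop"
    unfolding pop_def by (rule ok_assign[OF ptime_tl[OF ptime_arg[of 0 1 UNIV]]]) (auto simp: X_def)
  have ok_news: "ok ?b ?E2 news"
    unfolding news_def by (rule ok_massign[OF gs(1)]) (use gs(2) in \<open>auto simp: B_def st\<close>)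
  have ok_mv: "ok ?b UNIV mv"
    unfolding mv_def by (rule ok_massign[where a = k and E = UNIV]) (auto simp: new projs_def intro: ptime_arg)
  have "ok ?b ?E1 (\<lambda>s. mv (news (pop (popb s))))"
  proof (rule ok_seq[where F = "\<lambda>s. news (pop (popb s))", OF ok_seq[where F = "\<lambda>s. pop (popb s)",
        OF ok_seq[where F = popb, OF ok_popb ok_pop] ok_news] ok_mv])
    show "popb s \<in> ?E2" if "s \<in> ?E1" for s
    proof -
      have *: "map (popb s) (B # st) = [hd (s X)] # map s st"
        using that by (auto simp: popb_def hdw_def B_def st split: list.split)
      show ?thesis unfolding mem_Collect_eq * using that by blast
    qed
    show "pop (popb s) \<in> ?E2" if "s \<in> ?E1" for s
    proof -
      have *: "map (pop (popb s)) (B # st) = [hd (s X)] # map s st"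
        using that by (auto simp: popb_def pop_def hdw_def B_def X_def st split: list.split)
      show ?thesis unfolding mem_Collect_eq * using that by blast
    qed
  qed simp
  note ok_step = this
  have JS: "s' \<in> ?E1 \<and> J s (Suc i) (mv (news (pop (popb s'))))"
    if s: "s \<in> ?D1" and J: "J s i s'" and i: "i < length (s X)" for s i s'
  proof -
    from s have sX: "s X = x (ins s)" and sD: "ins s \<in> D" by (auto simp: J_def)
    have il: "i < length (x (ins s))" using i sX by simp
    have hd: "s' X = x (ins s) ! i # drop (Suc i) (x (ins s))"
      using J il by (simp add: J_def Cons_nth_drop_Suc)
    have st': "map s' st = S (ins s) i" using J by (simp add: J_def)
    have "length (ins s) = a" by (simp add: ins_def)
    then have E1: "s' \<in> ?E1" using inv[OF sD _ il] hd st' by (simp add: S_def)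
    define s2 where "s2 = pop (popb s')"
    have s2: "map s2 (B # st) = [x (ins s) ! i] # S (ins s) i" "s2 X = drop (Suc i) (x (ins s))"
        "ins s2 = ins s'" "s2 \<in> lows ?b"
    proof -
      have "hdw [s' X] = [x (ins s) ! i]" "tl (s' X) = drop (Suc i) (x (ins s))" "B \<noteq> X"
        unfolding hd by (simp_all add: hdw_def B_def X_def)
      then have s2_eq: "s2 = s'(B := [x (ins s) ! i], X := drop (Suc i) (x (ins s)))"
        by (simp add: s2_def pop_def popb_def)
      show "map s2 (B # st) = [x (ins s) ! i] # S (ins s) i" "s2 X = drop (Suc i) (x (ins s))"
          "ins s2 = ins s'" "s2 \<in> lows ?b"
        using J unfolding st'[symmetric] s2_eq by (auto simp: B_def X_def st ins_def J_def lows_def)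
    qed
    define s3 where "s3 = news s2"
    have s3: "map s3 new = S (ins s) (Suc i)" "s3 X = s2 X" "s3 B = s2 B" "ins s3 = ins s2" "s3 \<in> lows ?b"
    proof -
      show "map s3 new = S (ins s) (Suc i)"
        unfolding S_Suc[OF il] s3_def step_def
        by (rule nth_equalityI) (use gs(2) s2(1) in \<open>simp_all add: new news_def\<close>)
      show "s3 X = s2 X" "s3 B = s2 B" "ins s3 = ins s2" "s3 \<in> lows ?b"
        using s2(4) gs(2) by (auto simp: s3_def news_def X_def B_def ins_def lows_def)
    qed
    define s4 where "s4 = mv s3"
    have s4: "map s4 st = S (ins s) (Suc i)" "s4 X = s3 X" "s4 B = s3 B" "ins s4 = ins s3"
        "map s4 new = map s3 new" "s4 \<in> lows ?b"
    proof -
      show "map s4 st = S (ins s) (Suc i)"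
        by (rule nth_equalityI) (simp_all add: st new s4_def mv_def projs_def len_S s3(1)[symmetric])
      show "s4 X = s3 X" "s4 B = s3 B" "ins s4 = ins s3" "map s4 new = map s3 new" "s4 \<in> lows ?b"
        using s3(5) by (auto simp: s4_def mv_def projs_def X_def B_def ins_def lows_def new)
    qed
    have "\<forall>v\<in>set new. s4 v \<in> set (S (ins s) (Suc i))"
      using s4(5) unfolding s3(1) by (metis image_eqI list.set_map)
    then have "J s (Suc i) s4"
      using J s2 s3 s4 by (auto simp: J_def)
    then show ?thesis using E1 by (simp add: s4_def s3_def s2_def)
  qed
  obtain F where F: "ok ?b ?D1 F" "\<forall>s\<in>?D1 \<inter> lows ?b. J s (length (s X)) (F s)"
  proof (rule exE[OF ok_while[OF ok_step, where D = ?D1 and J = J and x = X and q = "\<lambda>l. l + q l + 1"]])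
    fix s i s' assume s: "s \<in> ?D1" and J: "J s i s'"
    then have sX: "s X = x (ins s)" and sD: "ins s \<in> D" by (auto simp: J_def)
    show "s' X = drop i (s X)" using J sX by (simp add: J_def)
    fix l assume i: "i \<le> length (s X)" and l: "bnd l s"
    have "wbnd l (ins s)" using l by (auto simp: wbnd_def bnd_def ins_def)
    then have "wbnd (q l) (S (ins s) i)"
      using bound[OF sD _ _ , of i l] i sX by (simp add: ins_def S_def)
    then have bS: "length w \<le> q l" if "w \<in> set (S (ins s) i)" for w
      using that by (simp add: wbnd_def)
    have "length (s' v) \<le> l + q l + 1" for v
    proof -
      consider "v < a" | "v = X" | "v = B" | "v \<in> set st" | "v \<in> set new" | "v \<ge> ?b"
        unfolding X_def B_def st(2) new(2) atLeastLessThan_iff by linarith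
      then show ?thesis
      proof cases
        case 1
        then have "s' v = s v" using J by (auto simp: J_def ins_def)
        moreover have "length (s v) \<le> l" using l by (simp add: bnd_def)
        ultimately show ?thesis by simp
      next
        case 2
        then have "length (s' v) \<le> length (s X)" using J sX by (simp add: J_def)
        also have "\<dots> \<le> l" using l by (simp add: bnd_def)
        finally show ?thesis by simp
      next
        case 3
        then show ?thesis using J by (simp add: J_def)
      next
        case 4
        then have "s' v \<in> set (S (ins s) i)" using J unfolding J_def by (metis image_eqI list.set_map)
        then show ?thesis using bS by fastforce
      next
        case 5
        then have "s' v = [] \<or> s' v \<in> set (S (ins s) i)" using J by (simp add: J_def)
        then show ?thesis using bS by fastforce
      next
        case 6
        then have "s' v = []" using J by (simp add: J_def lows_def)
        then show ?thesis by simp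
      qed
    qed
    then show "bnd (l + q l + 1) s'" by (simp add: bnd_def)
  qed (use JS q in \<open>auto intro!: polyb_intros\<close>)
  show ?thesis
  proof (rule ptime_ok)
    show "ok ?b ?D0 (\<lambda>s. (\<lambda>s. s(0 := (\<lambda>ws. ws ! 0) (map s [a + 2 + r]))) (F (?init s)))"
    proof (rule ok_seq[where F = "\<lambda>s. F (?init s)"])
      show "ok ?b ?D0 (\<lambda>s. F (?init s))"
        by (rule ok_seq[OF ok_init F(1)]) (use init in blast)
      show "ok ?b UNIV (\<lambda>s. s(0 := (\<lambda>ws. ws ! 0) (map s [a + 2 + r])))"
        by (rule ok_assign[OF ptime_ident]) (use r in auto)
    qed simp
    show "a \<le> ?b" by simp
    fix ws assume ws: "ws \<in> D" "length ws = a"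
    have iw: "ins (init ws) = ws" using ws(2) by (intro nth_equalityI) (auto simp: init_def ins_def)
    have D0: "init ws \<in> ?D0" using ws unfolding mem_Collect_eq iw by (simp add: init_def)
    obtain s1 where s1: "s1 = ?init (init ws)" by simp
    have i: "s1 \<in> ?D1" unfolding s1 by (rule init(1)[OF D0])
    have i2: "ins s1 = ws" unfolding s1 init(2)[OF D0] by (rule iw)
    have "s1 \<in> lows ?b" using i by (simp add: J_def)
    then have "J s1 (length (s1 X)) (F s1)" using F(2) i by blast
    moreover have "s1 X = x ws" using iw by (simp add: s1 X_def)
    ultimately have "map (F s1) st = S ws (length (x ws))"
      unfolding J_def i2 by simp
    then have "map (F s1) st ! r = S ws (length (x ws)) ! r" by (rule arg_cong)
    then have "F (?init (init ws)) (a + 2 + r) = fold step (x ws) (map (\<lambda>f. f ws) ini) ! r"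
      using r by (simp add: S_def st s1)
    then show "init ws \<in> ?D0 \<and> ((\<lambda>s. s(0 := (\<lambda>ws. ws ! 0) (map s [a + 2 + r]))) (F (?init (init ws)))) 0 =
        fold step (x ws) (map (\<lambda>f. f ws) ini) ! r"
      using D0 by simp
  qed
qed

section \<open>Replacing queries by subroutines\<close>

lemma result_eq:
  assumes "exec orc c (init ws) t s"
  shows "result orc c ws = s 0"
proof -
  have "(THE s. \<exists>t. exec orc c (init ws) t s) = s"
    by (rule the_equality) (use assms exec_deterministic in blast)+
  then show ?thesis by (simp add: result_def)
qed

text \<open>Removal of an oracle whose answers are computable from the query and \<open>z\<close>
  parameter words. The first \<open>a\<close> words of the argument list are the input of
  \<open>c\<close>, the remaining ones are the parameters. The run has polynomially many steps and
  all stacks stay polynomially long, so calling the subroutine at each query keeps the time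
  polynomial.\<close>

lemma ptime_result:
  assumes F: "ptime (Suc z) UNIV F" and a: "0 < a"
    and B: "\<And>q zs l. length zs = z \<Longrightarrow> wbnd l zs \<Longrightarrow> length (F (q # zs)) \<le> B l" "polyb B"
    and c: "\<And>ws l. ws \<in> D \<Longrightarrow> length ws = a + z \<Longrightarrow> wbnd l ws \<Longrightarrow>
      halts_within (\<lambda>q. F (q # drop a ws)) c (take a ws) (T l)" "polyb T"
  shows "ptime (a + z) D (\<lambda>ws. result (\<lambda>q. F (q # drop a ws)) c (take a ws))"
proof -
  obtain N0 where "regs_below N0 c" using ex_regs_below by blast
  then obtain N where N: "regs_below N c" "a \<le> N"
    using regs_below_mono[of N0 c "N0 + a"] by force
  \<comment> \<open>The renaming leaves a gap of \<open>z\<close> registers behind the input. The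
    argument list is therefore already in place, and the parameters survive the run.\<close>
  define r where "r = (\<lambda>v. if v < a then v else v + z)"
  let ?b = "N + z"
  have inj: "inj r" by (auto simp: r_def inj_def split: if_splits)
  have range: "v \<notin> range r \<longleftrightarrow> a \<le> v \<and> v < a + z" for v
  proof
    show "v \<notin> range r \<Longrightarrow> a \<le> v \<and> v < a + z"
      by (rule ccontr) (metis (no_types) le_add_diff_inverse2 not_le r_def range_eqI
          add_le_cancel_right add_lessD1 le_add2 order_trans)
  qed (auto simp: r_def split: if_splits)
  have "\<exists>d p. \<forall>s l. s \<in> UNIV \<longrightarrow> s \<in> lows ?b \<longrightarrow> bnd l s \<longrightarrow>
      (\<exists>t. exec no_oracle d s t (s(r y := F (map s (r x # [a..<a + z])))) \<and> t \<le> poly p l)"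
    if xy: "x < N" "y < N" for x y
  proof -
    have "ok ?b UNIV (\<lambda>s. s(r y := F (map s (r x # [a..<a + z]))))"
      by (rule ok_assign[OF F]) (use xy N(2) in \<open>auto simp: r_def\<close>)
    then show ?thesis by (rule okE) blast
  qed
  then obtain d p where d: "\<And>x y s l. x < N \<Longrightarrow> y < N \<Longrightarrow> s \<in> lows ?b \<Longrightarrow> bnd l s \<Longrightarrow>
      \<exists>t. exec no_oracle (d x y) s t (s(r y := F (map s (r x # [a..<a + z])))) \<and> t \<le> poly (p x y) l"
    by (metis UNIV_I)
  \<comment> \<open>Each pair of registers has its own subroutine with its own time bound; the sum
    dominates all of them.\<close>
  define P where "P = (\<Sum>x<N. \<Sum>y<N. p x y)"
  have P: "poly (p x y) l \<le> poly P l" if "x < N" "y < N" for x y l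
  proof -
    have "poly (p x y) l \<le> (\<Sum>y<N. poly (p x y) l)"
      by (rule member_le_sum) (use that in auto)
    also have "\<dots> \<le> (\<Sum>x<N. \<Sum>y<N. poly (p x y) l)"
      using that by (intro member_le_sum[of x _ "\<lambda>x. \<Sum>y<N. poly (p x y) l"]) auto
    finally show ?thesis by (simp add: P_def poly_sum)
  qed
  show ?thesis
  proof (rule ptimeI[where c = "translate r d c" and P = "\<lambda>l. T l * (1 + poly P (l + B l + T l))"])
    fix ws l assume ws: "ws \<in> D" "length ws = a + z" and l: "wbnd l ws"
    let ?orc = "\<lambda>q. F (q # drop a ws)"
    obtain t s where t: "exec ?orc c (init (take a ws)) t s" "t \<le> T l"
      using c(1)[OF ws l] unfolding halts_within_def by blast
    let ?W = "l + B l + t"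
    have l': "bnd (l + B l) (init (take a ws))"
      using l by (intro bnd_mono[OF bnd_init]) (auto simp: wbnd_def dest: in_set_takeD)
    have ldrop: "wbnd l (drop a ws)" using l by (auto simp: wbnd_def dest: in_set_dropD)
    have "\<exists>u S'. exec no_oracle (translate r d c) (init ws) u S' \<and> S' \<circ> r = s \<and>
        (\<forall>v. v \<notin> range r \<longrightarrow> S' v = init ws v) \<and> u \<le> t * (1 + poly P ?W)"
    proof (rule exec_translate[where N = N and W = ?W and ?S0.0 = "init ws",
          OF inj _ _ t(1) N(1) l'])
      show "\<forall>q. length (?orc q) \<le> l + B l"
        using B(1)[OF _ ldrop] ws(2) by (simp add: trans_le_add2)
      show "init ws \<circ> r = init (take a ws)"
        using ws(2) by (auto simp: r_def init_def fun_eq_iff)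
      show "\<forall>v\<ge>N. init (take a ws) v = []" using N(2) by (simp add: init_def)
      fix S x y assume xy: "x < N" "y < N" and S: "\<forall>v. v \<notin> range r \<longrightarrow> S v = init ws v"
        "bnd ?W (S \<circ> r)" "\<forall>v\<ge>N. S (r v) = []"
      have "S \<in> lows ?b"
      proof (unfold lows_def, intro CollectI allI impI)
        fix v assume "?b \<le> v"
        then have "v = r (v - z)" "N \<le> v - z" using N(2) by (auto simp: r_def)
        then show "S v = []" using S(3) by metis
      qed
      moreover have "bnd ?W S"
      proof (unfold bnd_def, intro allI)
        fix v show "length (S v) \<le> ?W"
        proof (cases "v \<in> range r")
          case True
          then show ?thesis using S(2) by (auto simp: bnd_def)
        next
          case False
          then show ?thesis using S(1) bnd_init[OF l] by (simp add: bnd_def trans_le_add1)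
        qed
      qed
      ultimately obtain u where u: "u \<le> poly (p x y) ?W"
          "exec no_oracle (d x y) S u (S(r y := F (map S (r x # [a..<a + z]))))"
        using d xy by blast
      have "map S [a..<a + z] = drop a ws"
        using S(1) ws(2) unfolding range by (intro nth_equalityI) (auto simp: init_def)
      then show "\<exists>u\<le>1 + poly P ?W. exec no_oracle (d x y) S u (S(r y := ?orc (S (r x))))"
        using u P[OF xy, of ?W] by (intro exI[of _ u]) auto
    qed simp_all
    then obtain u S' where u: "exec no_oracle (translate r d c) (init ws) u S'" "S' \<circ> r = s"
      "u \<le> t * (1 + poly P ?W)" by blast
    have "S' 0 = result ?orc c (take a ws)"
      using result_eq[OF t(1)] a by (simp add: r_def flip: u(2))
    moreover have "t * (1 + poly P ?W) \<le> T l * (1 + poly P (l + B l + T l))"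
      using t(2) by (intro mult_le_mono add_left_mono poly_mono_nat) auto
    ultimately show "\<exists>t s. exec no_oracle (translate r d c) (init ws) t s \<and>
        s 0 = result ?orc c (take a ws) \<and> t \<le> T l * (1 + poly P (l + B l + T l))"
      using u order_trans by blast
  qed (intro polyb_intros B c)
qed

section \<open>A library of polynomial-time functions\<close>

lemma ptime_comp2:
  assumes "ptime 2 UNIV h" "ptime a D f" "ptime a D g"
  shows "ptime a D (\<lambda>ws. h [f ws, g ws])"
  using ptime_comp[OF assms(1), of "[f, g]" a D] assms(2,3) by simp

text \<open>The arguments are carried along as extra state words that no step changes, which gives
  the step functions access to them.\<close>

lemma ptime_foldp:
  fixes gs :: "(word list \<Rightarrow> word) list"
  defines "step \<equiv> (\<lambda>ws b st. map (\<lambda>g. g ([b] # st @ ws)) gs)"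
  assumes x: "ptime a D x" and ini: "\<forall>f\<in>set ini. ptime a D f" "length ini = k"
    and gs: "\<forall>g\<in>set gs. ptime (Suc (k + a)) E g" "length gs = k"
    and inv: "\<And>ws i. ws \<in> D \<Longrightarrow> length ws = a \<Longrightarrow> i < length (x ws) \<Longrightarrow>
      [x ws ! i] # fold (step ws) (take i (x ws)) (map (\<lambda>f. f ws) ini) @ ws \<in> E"
    and bound: "\<And>ws i l. ws \<in> D \<Longrightarrow> length ws = a \<Longrightarrow> i \<le> length (x ws) \<Longrightarrow> wbnd l ws \<Longrightarrow>
      wbnd (q l) (fold (step ws) (take i (x ws)) (map (\<lambda>f. f ws) ini))"
    and q: "polyb q" and r: "r < k"
  shows "ptime a D (\<lambda>ws. fold (step ws) (x ws) (map (\<lambda>f. f ws) ini) ! r)"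
proof -
  define args where "args = map (\<lambda>i (ws :: word list). ws ! i) [0..<a]"
  define pars where "pars = map (\<lambda>i (ws :: word list). ws ! (Suc k + i)) [0..<a]"
  define step' where "step' = (\<lambda>b st. map (\<lambda>g. g ([b] # st)) (gs @ pars))"
  have len: "length (fold (step ws) xs w) = k" if "length w = k" for ws xs w
    using that by (induction xs arbitrary: w) (simp_all add: step_def gs(2))
  have args: "map (\<lambda>f. f ws) args = ws" if "length ws = a" for ws
    using that by (intro nth_equalityI) (auto simp: args_def)
  have step': "step' b (st @ ws) = step ws b st @ ws" if "length st = k" "length ws = a" for b st ws
    using that by (auto simp: step'_def step_def pars_def nth_append intro!: nth_equalityI)
  have fold: "fold step' xs (st @ ws) = fold (step ws) xs st @ ws"
    if "length st = k" "length ws = a" for xs st ws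
    using that
  proof (induction xs arbitrary: st)
    case (Cons b xs)
    then show ?case using len[of st ws "[b]"] by (simp add: step')
  qed simp
  have fold_ini: "fold step' xs (map (\<lambda>f. f ws) (ini @ args)) =
      fold (step ws) xs (map (\<lambda>f. f ws) ini) @ ws" if "length ws = a" for xs ws
    using fold[of "map (\<lambda>f. f ws) ini" ws xs] ini(2) that by (simp add: args)
  have "ptime a D (\<lambda>ws. fold step' (x ws) (map (\<lambda>f. f ws) (ini @ args)) ! r)"
  proof (rule ptime_fold[where gs = "gs @ pars" and q = "\<lambda>l. l + q l", OF x, folded step'_def])
    show "\<forall>f\<in>set (ini @ args). ptime a D f" using ini by (auto simp: args_def intro: ptime_arg)
    show "length (ini @ args) = k + a" by (simp add: ini args_def)
    show "\<forall>g\<in>set (gs @ pars). ptime (Suc (k + a)) E g"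
      using gs by (auto simp: pars_def intro!: ptime_arg)
    show "length (gs @ pars) = k + a" by (simp add: gs pars_def)
    show "polyb (\<lambda>l. l + q l)" by (intro polyb_intros q)
    show "r < k + a" using r by simp
  next
    fix ws i assume "ws \<in> D" "length ws = a" "i < length (x ws)"
    then show "[x ws ! i] # fold step' (take i (x ws)) (map (\<lambda>f. f ws) (ini @ args)) \<in> E"
      using inv by (simp only: fold_ini)
  next
    fix ws i l assume "ws \<in> D" "length ws = a" "i \<le> length (x ws)" "wbnd l ws"
    then have "wbnd (l + q l) (fold (step ws) (take i (x ws)) (map (\<lambda>f. f ws) ini) @ ws)"
      using bound by (fastforce simp: wbnd_def)
    then show "wbnd (l + q l) (fold step' (take i (x ws)) (map (\<lambda>f. f ws) (ini @ args)))"
      using \<open>length ws = a\<close> by (simp only: fold_ini)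
  qed
  then show ?thesis
    by (rule ptime_cong) (use r ini(2) in \<open>auto simp del: map_append simp: fold_ini nth_append len\<close>)
qed

lemma ptime_fold1:
  assumes "ptime a D x" "ptime a D s0" "ptime (Suc (Suc a)) UNIV g"
    and bound: "\<And>ws i l. ws \<in> D \<Longrightarrow> length ws = a \<Longrightarrow> i \<le> length (x ws) \<Longrightarrow> wbnd l ws \<Longrightarrow>
      length (fold (\<lambda>b s. g ([b] # s # ws)) (take i (x ws)) (s0 ws)) \<le> q l" and q: "polyb q"
  shows "ptime a D (\<lambda>ws. fold (\<lambda>b s. g ([b] # s # ws)) (x ws) (s0 ws))"
proof -
  have eq: "fold (\<lambda>b st. map (\<lambda>g. g ([b] # st @ ws)) [g]) xs [s] =
      [fold (\<lambda>b s. g ([b] # s # ws)) xs s]" for xs s ws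
    by (induction xs arbitrary: s) simp_all
  have "ptime a D (\<lambda>ws. fold (\<lambda>b st. map (\<lambda>g. g ([b] # st @ ws)) [g]) (x ws) (map (\<lambda>f. f ws) [s0]) ! 0)"
    by (rule ptime_foldp[where k = 1 and E = UNIV and q = q])
      (use assms(1-3) bound q in \<open>simp_all add: eq[simplified] wbnd_def\<close>)
  then show ?thesis by (simp add: eq[simplified])
qed

lemma ptime_const: "ptime a D (\<lambda>ws. w)"
  by (induction w) (auto intro: ptime_nil ptime_Cons)

lemma ptime_drop_const: "ptime a D f \<Longrightarrow> ptime a D (\<lambda>ws. drop n (f ws))"
proof (induction n)
  case (Suc n)
  have "drop (Suc n) w = tl (drop n w)" for w :: word by (simp add: drop_Suc drop_tl)
  then show ?case using ptime_tl[OF Suc.IH[OF Suc.prems]] by simp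
qed simp

section \<open>Decidable predicates\<close>

definition pdec :: "nat \<Rightarrow> word list set \<Rightarrow> (word list \<Rightarrow> bool) \<Rightarrow> bool" where
  "pdec a D P \<longleftrightarrow> ptime a D (\<lambda>ws. if P ws then [True] else [])"

lemma ptime_if:
  assumes "pdec a D P" "ptime a {ws \<in> D. P ws} f" "ptime a {ws \<in> D. \<not> P ws} g"
  shows "ptime a D (\<lambda>ws. if P ws then f ws else g ws)"
proof -
  have "ptime a D (\<lambda>ws. case if P ws then [True] else [] of [] \<Rightarrow> g ws | b # w \<Rightarrow> if b then f ws else [])"
    by (rule ptime_case[OF assms(1)[unfolded pdec_def]])
      (auto intro: ptime_nil ptime_subset[OF assms(2)] ptime_subset[OF assms(3)] split: if_splits)
  then show ?thesis by (rule ptime_cong) auto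
qed

lemma pdec_not:
  assumes "pdec a D P"
  shows "pdec a D (\<lambda>ws. \<not> P ws)"
proof -
  have "ptime a D (\<lambda>ws. if P ws then [] else [True])" by (intro ptime_if assms ptime_const)
  then show ?thesis unfolding pdec_def by (rule ptime_cong) simp
qed

lemma pdec_conj:
  assumes "pdec a D P" "pdec a D Q"
  shows "pdec a D (\<lambda>ws. P ws \<and> Q ws)"
proof -
  have "ptime a D (\<lambda>ws. if P ws then if Q ws then [True] else [] else [])"
    by (intro ptime_if assms ptime_const ptime_subset[OF assms(2)[unfolded pdec_def]]) auto
  then show ?thesis unfolding pdec_def by (rule ptime_cong) simp
qed

lemma pdec_null:
  assumes "ptime a D f"
  shows "pdec a D (\<lambda>ws. f ws = [])"
proof -
  have "ptime a D (\<lambda>ws. case f ws of [] \<Rightarrow> [True] | b # w \<Rightarrow> if b then [] else [])"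
    by (intro ptime_case ptime_const assms)
  then show ?thesis unfolding pdec_def by (rule ptime_cong) (auto split: list.split)
qed

lemma pdec_hd:
  assumes "ptime a D f"
  shows "pdec a D (\<lambda>ws. f ws \<noteq> [] \<and> hd (f ws))"
proof -
  have "ptime a D (\<lambda>ws. case f ws of [] \<Rightarrow> [] | b # w \<Rightarrow> if b then [True] else [])"
    by (intro ptime_case ptime_const assms)
  then show ?thesis unfolding pdec_def by (rule ptime_cong) (auto split: list.split)
qed

lemma pdec_eq_True:
  assumes "ptime a D f"
  shows "pdec a D (\<lambda>ws. f ws = [True])"
proof -
  have "w = [True] \<longleftrightarrow> (w \<noteq> [] \<and> hd w) \<and> tl w = []" for w :: word by (cases w) auto
  then show ?thesis by (simp only:) (intro pdec_conj pdec_hd pdec_null ptime_tl assms)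
qed

section \<open>List operations and unary arithmetic\<close>

lemma arg_bnd: "wbnd l ws \<Longrightarrow> i < length ws \<Longrightarrow> length (ws ! i) \<le> l"
  by (simp add: wbnd_def)

lemma ptime_rev_append: "ptime 2 UNIV (\<lambda>ws. rev (ws ! 0) @ ws ! 1)"
proof -
  let ?g = "\<lambda>ws :: word list. case ws ! 0 of [] \<Rightarrow> [] | b # w \<Rightarrow> if b then True # ws ! 1 else False # ws ! 1"
  have eq: "fold (\<lambda>b s. ?g ([b] # s # ws)) xs s = rev xs @ s" for xs s and ws :: "word list"
    by (induction xs arbitrary: s) auto
  have "ptime 2 UNIV (\<lambda>ws. fold (\<lambda>b s. ?g ([b] # s # ws)) (ws ! 0) (ws ! 1))"
  proof (rule ptime_fold1[where q = "\<lambda>l. l + l"])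
    show "ptime (Suc (Suc 2)) UNIV ?g" by (intro ptime_case ptime_arg ptime_Cons ptime_nil) auto
    show "length (fold (\<lambda>b s. ?g ([b] # s # ws)) (take i (ws ! 0)) (ws ! 1)) \<le> l + l"
      if "length ws = 2" "wbnd l ws" for ws i l
      unfolding eq using that arg_bnd[of l ws 0] arg_bnd[of l ws 1] by simp
  qed (auto intro!: ptime_arg polyb_intros)
  then show ?thesis unfolding eq .
qed

lemma ptime_rev: "ptime a D f \<Longrightarrow> ptime a D (\<lambda>ws. rev (f ws))"
  using ptime_comp2[OF ptime_rev_append, of a D f "\<lambda>ws. []"] by (simp add: ptime_nil)

lemma ptime_append: "ptime a D f \<Longrightarrow> ptime a D g \<Longrightarrow> ptime a D (\<lambda>ws. f ws @ g ws)"
  using ptime_comp2[OF ptime_rev_append ptime_rev[of a D f], of g] by simp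

lemma ptime_drop_length:
  assumes "ptime a D f" "ptime a D g"
  shows "ptime a D (\<lambda>ws. drop (length (f ws)) (g ws))"
proof -
  have eq: "fold (\<lambda>b s. tl (([b] # s # ws) ! 1)) xs s = drop (length xs) s" for xs s and ws :: "word list"
    by (induction xs arbitrary: s) (auto simp: drop_Suc)
  have "ptime 2 UNIV (\<lambda>ws. fold (\<lambda>b s. tl (([b] # s # ws) ! 1)) (ws ! 0) (ws ! 1))"
  proof (rule ptime_fold1[where q = "\<lambda>l. l"])
    show "length (fold (\<lambda>b s. tl (([b] # s # ws) ! 1)) (take i (ws ! 0)) (ws ! 1)) \<le> l"
      if "length ws = 2" "wbnd l ws" for ws i l
      unfolding eq using that arg_bnd[of l ws 1] by simp
  qed (auto intro!: ptime_tl ptime_arg polyb_intros)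
  from ptime_comp2[OF this[unfolded eq] assms] show ?thesis by simp
qed

lemma ptime_unary:
  assumes "ptime a D f"
  shows "ptime a D (\<lambda>ws. replicate (length (f ws)) c)"
proof -
  have eq: "fold (\<lambda>b s. c # ([b] # s # ws) ! 1) xs s = replicate (length xs) c @ s"
    for xs s and ws :: "word list"
    by (induction xs arbitrary: s) (auto simp: replicate_app_Cons_same)
  have "ptime 1 UNIV (\<lambda>ws. fold (\<lambda>b s. c # ([b] # s # ws) ! 1) (ws ! 0) [])"
  proof (rule ptime_fold1[where q = "\<lambda>l. l"])
    show "length (fold (\<lambda>b s. c # ([b] # s # ws) ! 1) (take i (ws ! 0)) []) \<le> l"
      if "length ws = 1" "wbnd l ws" for ws i l
      unfolding eq using that arg_bnd[of l ws 0] by simp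
  qed (auto intro!: ptime_Cons ptime_nil ptime_arg polyb_intros)
  from ptime_comp1[OF this[unfolded eq] assms] show ?thesis by simp
qed

lemma ptime_mult:
  assumes "ptime a D f" "ptime a D g"
  shows "ptime a D (\<lambda>ws. replicate (length (f ws) * length (g ws)) True)"
proof -
  let ?g = "\<lambda>v :: word list. replicate (length (v ! 3)) True @ v ! 1"
  have eq: "fold (\<lambda>b s. ?g ([b] # s # ws)) xs s = replicate (length xs * length (ws ! 1)) True @ s"
    for xs s and ws :: "word list"
    by (induction xs arbitrary: s)
      (auto simp: replicate_add[symmetric] numeral_3_eq_3 simp del: append_assoc simp add: append_assoc[symmetric] add.commute)
  have "ptime 2 UNIV (\<lambda>ws. fold (\<lambda>b s. ?g ([b] # s # ws)) (ws ! 0) [])"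
  proof (rule ptime_fold1[where q = "\<lambda>l. l * l"])
    show "length (fold (\<lambda>b s. ?g ([b] # s # ws)) (take i (ws ! 0)) []) \<le> l * l"
      if "length ws = 2" "wbnd l ws" for ws i l
      unfolding eq using that arg_bnd[of l ws 0] arg_bnd[of l ws 1] by (simp add: mult_le_mono)
  qed (auto intro!: ptime_append ptime_unary ptime_nil ptime_arg polyb_intros)
  from ptime_comp2[OF this[unfolded eq] assms] show ?thesis by simp
qed

lemma ptime_poly:
  assumes "ptime a D f"
  shows "ptime a D (\<lambda>ws. replicate (poly p (length (f ws))) True)"
proof (induction p)
  case 0
  then show ?case by (simp add: ptime_nil)
next
  case (pCons c p)
  from ptime_append[OF ptime_const ptime_mult[OF assms pCons(2)], of "replicate c True"]
  show ?case by (simp add: replicate_add)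
qed

lemma ptime_take_length:
  assumes "ptime a D f" "ptime a D g"
  shows "ptime a D (\<lambda>ws. take (length (f ws)) (g ws))"
proof -
  have eq: "take n w = rev (drop (length (drop n w)) (rev w))" for n and w :: word
    by (cases "n \<le> length w") (simp_all add: rev_drop)
  show ?thesis unfolding eq[of "length _"]
    by (intro ptime_rev ptime_drop_length assms)
qed

lemma ptime_filter_True:
  assumes "ptime a D f"
  shows "ptime a D (\<lambda>ws. filter id (f ws))"
proof -
  let ?g = "\<lambda>ws :: word list. case ws ! 0 of [] \<Rightarrow> [] | b # w \<Rightarrow> if b then True # ws ! 1 else ws ! 1"
  have eq: "fold (\<lambda>b s. ?g ([b] # s # ws)) xs s = filter id (rev xs) @ s" for xs s and ws :: "word list"
    by (induction xs arbitrary: s) auto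
  have "ptime 1 UNIV (\<lambda>ws. fold (\<lambda>b s. ?g ([b] # s # ws)) (rev (ws ! 0)) [])"
  proof (rule ptime_fold1[where q = "\<lambda>l. l"])
    show "ptime (Suc (Suc 1)) UNIV ?g" by (intro ptime_case ptime_arg ptime_Cons ptime_nil) auto
    show "length (fold (\<lambda>b s. ?g ([b] # s # ws)) (take i (rev (ws ! 0))) []) \<le> l"
      if "length ws = 1" "wbnd l ws" for ws i l
    proof -
      have "length (filter id (rev (take i (rev (ws ! 0))))) \<le> length (rev (take i (rev (ws ! 0))))"
        by (rule length_filter_le)
      then show ?thesis unfolding eq using that arg_bnd[of l ws 0] by simp
    qed
  qed (auto intro!: ptime_arg ptime_rev ptime_nil polyb_intros)
  from ptime_comp1[OF this[unfolded eq] assms] show ?thesis by simp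
qed

text \<open>A fold cannot stop early. The word itself serves as the counter: \<open>G\<close> is
  stationary as soon as the head differs from \<open>c\<close>, so performing it
  \<open>length w\<close> times does no harm.\<close>

lemma ptime_dropWhile:
  assumes "ptime a D f"
  shows "ptime a D (\<lambda>ws. dropWhile (\<lambda>b. b = c) (f ws))"
proof -
  let ?g = "\<lambda>ws :: word list. case ws ! 1 of [] \<Rightarrow> [] | b # w \<Rightarrow>
    if b then (if c then tl (ws ! 1) else ws ! 1) else (if c then ws ! 1 else tl (ws ! 1))"
  define G where "G s = (if s \<noteq> [] \<and> hd s = c then tl s else s)" for s
  have g: "?g ([b] # s # ws) = G s" for b s and ws :: "word list"
    by (cases s) (auto simp: G_def)
  have eq1: "fold (\<lambda>b. G) xs s = s" if "s = [] \<or> hd s \<noteq> c" for xs :: word and s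
    using that by (induction xs) (auto simp: G_def)
  have eq: "length s \<le> length xs \<Longrightarrow> fold (\<lambda>b. G) xs s = dropWhile (\<lambda>b. b = c) s" for xs :: word and s
  proof (induction s arbitrary: xs)
    case Nil
    then show ?case by (simp add: eq1)
  next
    case (Cons b s)
    then obtain d ys where xs: "xs = d # ys" "length s \<le> length ys" by (cases xs) auto
    show ?case
    proof (cases "b = c")
      case True
      then show ?thesis using Cons.IH[OF xs(2)] unfolding xs by (simp add: G_def)
    next
      case False
      then show ?thesis by (simp add: eq1)
    qed
  qed
  have le: "length (fold (\<lambda>b. G) xs s) \<le> length s" for xs :: word and s
  proof (induction xs arbitrary: s)
    case (Cons b xs)
    have "length (G s) \<le> length s" by (simp add: G_def)
    then show ?case using Cons.IH[of "G s"] by simp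
  qed simp
  have "ptime 1 UNIV (\<lambda>ws. fold (\<lambda>b s. ?g ([b] # s # ws)) (ws ! 0) (ws ! 0))"
  proof (rule ptime_fold1[where q = "\<lambda>l. l"])
    show "ptime (Suc (Suc 1)) UNIV ?g"
      by (cases c) (auto intro!: ptime_case ptime_arg ptime_tl ptime_nil)
    show "length (fold (\<lambda>b s. ?g ([b] # s # ws)) (take i (ws ! 0)) (ws ! 0)) \<le> l"
      if "length ws = 1" "wbnd l ws" for ws i l
      unfolding g using order_trans[OF le arg_bnd[of l ws 0]] that by simp
  qed (auto intro!: ptime_arg polyb_intros)
  from ptime_comp1[OF this[unfolded g eq[OF order_refl]] assms] show ?thesis by simp
qed

lemma ptime_takeWhile:
  assumes "ptime a D f"
  shows "ptime a D (\<lambda>ws. takeWhile (\<lambda>b. b = c) (f ws))"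
proof -
  have eq: "takeWhile P w = rev (drop (length (dropWhile P w)) (rev w))" for P and w :: word
    by (metis append_eq_conv_conj length_rev rev_append rev_rev_ident takeWhile_dropWhile_id)
  show ?thesis unfolding eq
    by (intro ptime_rev ptime_drop_length ptime_dropWhile assms)
qed

lemma pdec_length_le:
  assumes "ptime a D f" "ptime a D g"
  shows "pdec a D (\<lambda>ws. length (f ws) \<le> length (g ws))"
  using pdec_null[OF ptime_drop_length[OF assms(2,1)]] by simp

lemma pdec_length_less:
  assumes "ptime a D f" "ptime a D g"
  shows "pdec a D (\<lambda>ws. length (f ws) < length (g ws))"
  using pdec_not[OF pdec_length_le[OF assms(2,1)]] by (simp add: not_le)

lemma pdec_length_eq:
  assumes "ptime a D f" "ptime a D g"
  shows "pdec a D (\<lambda>ws. length (f ws) = length (g ws))"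
  using pdec_conj[OF pdec_length_le[OF assms] pdec_length_le[OF assms(2,1)]] by (simp add: eq_iff)

text \<open>Binary increment with the least significant bit first: the carry turns the leading ones
  into zeros and the next zero into a one. On overflow there is no such zero, and
  \<open>tl [] = []\<close> lets the word grow.\<close>

definition incr :: "word \<Rightarrow> word" where
  "incr w = replicate (length (takeWhile (\<lambda>b. b = True) w)) False @ True # tl (dropWhile (\<lambda>b. b = True) w)"

lemma bits_Suc: "bits (Suc n) = incr (bits n)"
proof (induction n rule: less_induct)
  case (less n)
  show ?case
  proof (cases n)
    case 0
    then show ?thesis by (simp add: incr_def)
  next
    case (Suc k)
    show ?thesis
    proof (cases "odd n")
      case True
      have "Suc n div 2 = Suc (n div 2)" using True by presburger
      moreover have "bits (Suc (n div 2)) = incr (bits (n div 2))" using less[of "n div 2"] Suc by simp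
      ultimately show ?thesis using True Suc by (simp add: incr_def)
    next
      case False
      then have "Suc n div 2 = n div 2" by simp
      then show ?thesis using False Suc by (simp add: incr_def)
    qed
  qed
qed

lemma length_bits_le: "length (bits n) \<le> n"
proof (induction n rule: less_induct)
  case (less n)
  then show ?case using less[of "n div 2"] by (cases n) fastforce+
qed

lemma ptime_bits:
  assumes "ptime a D f"
  shows "ptime a D (\<lambda>ws. bits (length (f ws)))"
proof -
  have eq: "fold (\<lambda>b s. incr (([b] # s # ws) ! 1)) xs (bits n) = bits (length xs + n)"
    for xs n and ws :: "word list"
    by (induction xs arbitrary: n) (auto simp: bits_Suc[symmetric] simp del: bits.simps)
  have eq0: "fold (\<lambda>b s. incr (([b] # s # ws) ! 1)) xs [] = bits (length xs)"
    for xs and ws :: "word list"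
    using eq[of ws xs 0] by simp
  have "ptime 1 UNIV (\<lambda>ws. fold (\<lambda>b s. incr (([b] # s # ws) ! 1)) (ws ! 0) [])"
  proof (rule ptime_fold1[where q = "\<lambda>l. l"])
    show "ptime (Suc (Suc 1)) UNIV (\<lambda>ws. incr (ws ! 1))" unfolding incr_def
      by (intro ptime_append ptime_unary ptime_takeWhile ptime_dropWhile ptime_Cons ptime_tl ptime_arg) simp_all
    show "length (fold (\<lambda>b s. incr (([b] # s # ws) ! 1)) (take i (ws ! 0)) []) \<le> l"
      if "length ws = 1" "wbnd l ws" for ws i l
      unfolding eq0 using that arg_bnd[of l ws 0] length_bits_le[of "length (take i (ws ! 0))"] by simp
  qed (auto intro!: ptime_arg ptime_nil polyb_intros)
  from ptime_comp1[OF this[unfolded eq0] assms] show ?thesis by simp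
qed

section \<open>The hard instances\<close>

locale hard_instance =
  fixes n j k T :: nat and acc :: "word \<Rightarrow> bool"
  assumes n2: "2 \<le> n" and jn: "j < n" and k1: "1 \<le> k"
begin

text \<open>A multiple of \<open>n\<close>, so every agent has exactly \<open>3 * T\<close> turns.
  The factor 3 leaves room for \<open>k + T\<close> turns of agent \<open>j\<close> before the
  others can reach the last \<open>T\<close> items, see \<open>m_large\<close>.\<close>

definition m :: nat where "m = 3 * n * T"

text \<open>The first \<open>j\<close> items allow for the agents who move before \<open>j\<close>
  in the first round. Block \<open>r\<close> then begins at \<open>j + r * n\<close>, the index of
  the turn of agent \<open>j\<close> in round \<open>r\<close>; by \<open>available_early\<close>
  its items are still available at that turn unless agent \<open>j\<close> owns them.\<close>

definition reg :: "nat set" where "reg = {..<j + k * n}"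

definition traps :: "nat set" where "traps = {m - T..<m}"

definition decode :: "nat set \<Rightarrow> word" where
  "decode S = map (\<lambda>r. j + 1 + r * n \<in> S) [0..<k]"

definition hval :: "nat set \<Rightarrow> nat" where
  "hval S = (if card (S \<inter> reg) < k then 2 * card (S \<inter> reg)
     else if card (S \<inter> reg) = k \<and> \<not> acc (decode S) then 2 * k - 1 else 2 * k)"

definition fj :: "nat set \<Rightarrow> nat" where
  "fj S = 3 * card (S \<inter> traps) + hval S"

text \<open>Additive with pairwise different weights that decrease in the item number: greedy play
  of the other agents becomes "take the least available item", without ties.\<close>

definition wt :: "nat set \<Rightarrow> nat" where
  "wt S = (\<Sum>x\<in>S. m - x)"

definition inst :: rr_instance where
  "inst = \<lparr>agents = n, items = m, obj = (\<lambda>i S. if i = j then real (fj S) else real (wt S)),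
     indep = (\<lambda>i. Pow {..<m})\<rparr>"

lemma inst_simps [simp]: "agents inst = n" "items inst = m" "item_set inst = {..<m}"
  "indep inst i = Pow {..<m}" "obj inst j S = real (fj S)" "i \<noteq> j \<Longrightarrow> obj inst i S = real (wt S)"
  by (simp_all add: inst_def item_set_def)

lemma decode_cong: "S \<inter> reg = S' \<inter> reg \<Longrightarrow> decode S = decode S'"
proof -
  assume eq: "S \<inter> reg = S' \<inter> reg"
  have "j + 1 + r * n \<in> reg" if "r < k" for r
  proof -
    have "(r + 1) * n \<le> k * n" using that by (intro mult_le_mono1) simp
    then show ?thesis using n2 by (simp add: reg_def)
  qed
  then have "j + 1 + r * n \<in> S \<longleftrightarrow> j + 1 + r * n \<in> S'" if "r < k" for r
    using eq that by blast
  then show ?thesis by (simp add: decode_def)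
qed

lemma hval_cong:
  assumes "S \<inter> reg = S' \<inter> reg"
  shows "hval S = hval S'"
  using decode_cong[OF assms] unfolding hval_def assms by simp

lemma finite_reg [simp]: "finite reg" by (simp add: reg_def)

lemma hval_mono:
  assumes "S \<subseteq> S'"
  shows "hval S \<le> hval S'"
proof (cases "card (S \<inter> reg) = card (S' \<inter> reg)")
  case True
  then have "S \<inter> reg = S' \<inter> reg" by (intro card_subset_eq) (use assms in auto)
  then show ?thesis using hval_cong by (metis order_refl)
next
  case False
  moreover have "card (S \<inter> reg) \<le> card (S' \<inter> reg)" by (intro card_mono) (use assms in auto)
  ultimately show ?thesis by (auto simp: hval_def)
qed

text \<open>If \<open>S\<close> and \<open>S'\<close> meet \<open>reg\<close> in the same set, both
  marginals agree. Otherwise \<open>S'\<close> has strictly more items there, and at size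
  \<open>c\<close> a new item of \<open>reg\<close> gains 2 for \<open>c < k - 1\<close>, 1 or 2 for
  \<open>c = k - 1\<close>, 0 or 1 for \<open>c = k\<close>, and 0 beyond: no possible gain at a
  larger size exceeds one at a smaller size.\<close>

lemma hval_submodular:
  assumes S: "S \<subseteq> S'" "x \<notin> S'"
  shows "hval (insert x S') + hval S \<le> hval (insert x S) + hval S'"
proof (cases "x \<in> reg")
  case False
  then have "hval (insert x S') = hval S'" "hval (insert x S) = hval S"
    by (auto intro!: hval_cong)
  then show ?thesis by simp
next
  case True
  have c: "card (insert x S \<inter> reg) = Suc (card (S \<inter> reg))"
      "card (insert x S' \<inter> reg) = Suc (card (S' \<inter> reg))"
  proof -
    have "x \<notin> S" using S by blast
    then show "card (insert x S \<inter> reg) = Suc (card (S \<inter> reg))"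
        "card (insert x S' \<inter> reg) = Suc (card (S' \<inter> reg))"
      using True S(2) by (simp_all add: Int_insert_left)
  qed
  show ?thesis
  proof (cases "card (S \<inter> reg) = card (S' \<inter> reg)")
    case True
    then have "S \<inter> reg = S' \<inter> reg" by (intro card_subset_eq) (use assms in auto)
    then have "hval S = hval S'" "hval (insert x S) = hval (insert x S')"
      by (auto intro!: hval_cong)
    then show ?thesis by simp
  next
    case False
    moreover have "card (S \<inter> reg) \<le> card (S' \<inter> reg)" by (intro card_mono) (use assms in auto)
    ultimately show ?thesis using k1 unfolding hval_def c by auto
  qed
qed

lemma fj_mono: "S \<subseteq> S' \<Longrightarrow> finite S' \<Longrightarrow> fj S \<le> fj S'"
  unfolding fj_def by (intro add_mono mult_le_mono card_mono hval_mono) auto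

lemma fj_submodular:
  assumes "S \<subseteq> S'" "x \<notin> S'" "finite S'"
  shows "fj (insert x S') + fj S \<le> fj (insert x S) + fj S'"
proof -
  have "finite S" using assms finite_subset by blast
  then have "card (insert x S' \<inter> traps) + card (S \<inter> traps) = card (insert x S \<inter> traps) + card (S' \<inter> traps)"
    using assms by (cases "x \<in> traps") (auto simp: Int_insert_left card_insert_if)
  then show ?thesis using hval_submodular[OF assms(1,2)] unfolding fj_def by linarith
qed

lemma wt_insert: "finite S \<Longrightarrow> x \<notin> S \<Longrightarrow> wt (insert x S) = m - x + wt S"
  by (simp add: wt_def)

lemma valid: "valid_instance inst"
  unfolding valid_instance_def
proof (intro allI impI conjI)
  fix i
  show "normalized (obj inst i)"
    by (cases "i = j") (use k1 in \<open>auto simp: normalized_def fj_def hval_def wt_def\<close>)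
  show "nonneg_on (item_set inst) (obj inst i)" by (cases "i = j") (auto simp: nonneg_on_def)
  show "mono_on (Pow (item_set inst)) (obj inst i)"
  proof (cases "i = j")
    case True
    then show ?thesis by (auto simp: mono_on_def intro!: fj_mono dest: finite_subset)
  next
    case False
    have "wt S \<le> wt S'" if "S \<subseteq> S'" "S' \<subseteq> {..<m}" for S S'
      unfolding wt_def by (intro sum_mono2) (use that finite_subset in auto)
    then show ?thesis using False by (auto simp: mono_on_def)
  qed
  show "submodular_on (item_set inst) (obj inst i)"
    unfolding submodular_on_def
  proof (intro allI impI, elim conjE)
    fix S S' x assume S: "S \<subseteq> S'" "S' \<subseteq> item_set inst" "x \<in> item_set inst - S'"
    have fin: "finite S'" "finite S" using S finite_subset by (auto intro: finite_subset)
    show "marginal (obj inst i) x S' \<le> marginal (obj inst i) x S"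
    proof (cases "i = j")
      case True
      then show ?thesis using fj_submodular[of S S' x] S fin by (auto simp: marginal_def)
    next
      case False
      have "x \<notin> S" "x \<notin> S'" using S by auto
      then show ?thesis using False fin by (simp add: marginal_def wt_insert)
    qed
  qed
  show "indep_system (item_set inst) (indep inst i)" by (auto simp: indep_system_def)
qed

lemma inst_in_class: "inst \<in> instances_with_additive_others n j"
proof -
  have "additive_on {..<m} (obj inst i)" if "i \<noteq> j" for i
    using that by (simp add: additive_on_def wt_def)
  moreover have "obj inst i S \<in> \<rat>" for i S by (simp add: inst_def)
  ultimately show ?thesis
    using valid by (simp add: instances_with_additive_others_def unconstrained_def rational_valued_def)
qed

lemma turns_inst: "turns inst = m"
proof -
  have "real m / real n = real (3 * T)" using n2 by (simp add: m_def)
  then have "nat \<lceil>real m / real n\<rceil> = 3 * T" by (metis ceiling_of_nat nat_int)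
  then show ?thesis by (simp add: turns_def m_def)
qed

end

section \<open>Facts about arbitrary plays\<close>

lemma length_play [simp]: "length (play I \<pi> q) = q"
  by (induction q) (auto simp: Let_def)

lemma legal_available: "legal I h ch = Some x \<Longrightarrow> x \<in> available I h"
  by (auto simp: legal_def split: option.splits if_splits)

lemma owned_append: "owned I (h @ [c]) i =
  owned I h i \<union> (if length h mod agents I = i then {x. c = Some x} else {})"
proof -
  have "x \<in> owned I (h @ [c]) i \<longleftrightarrow>
      (length h mod agents I = i \<and> c = Some x) \<or> x \<in> owned I h i" for x
    by (simp add: owned_def Ex_less_Suc nth_append cong: conj_cong)
  then show ?thesis by (intro set_eqI) (simp add: disj_commute)
qed

lemma owned_taken: "owned I h i \<subseteq> {x. Some x \<in> set h}"
  by (auto simp: owned_def in_set_conv_nth)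

lemma play_taken: "{x. Some x \<in> set (play I \<pi> q)} \<subseteq> item_set I"
proof (induction q)
  case (Suc q)
  then show ?case using legal_available[of I "play I \<pi> q"] by (auto simp: Let_def available_def)
qed simp

lemma card_taken_le: "card {x. Some x \<in> set h} \<le> length h"
proof -
  have "Some ` {x. Some x \<in> set h} \<subseteq> set h" by auto
  then have "card (Some ` {x. Some x \<in> set h}) \<le> card (set h)" by (intro card_mono) auto
  also have "\<dots> \<le> length h" by (rule card_length)
  finally show ?thesis by (simp add: card_image)
qed

lemma card_turns_le: "card {q. q < r * n + j \<and> q mod n = j} \<le> r"
proof -
  have "{q. q < r * n + j \<and> q mod n = j} \<subseteq> (\<lambda>i. i * n + j) ` {..<r}"
  proof
    fix q assume q: "q \<in> {q. q < r * n + j \<and> q mod n = j}"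
    then have "q = q div n * n + j" by (metis (mono_tags, lifting) div_mult_mod_eq mem_Collect_eq)
    moreover from this q have "q div n < r"
      by (metis (mono_tags, lifting) add_less_cancel_right mem_Collect_eq mult_less_cancel2)
    ultimately show "q \<in> (\<lambda>i. i * n + j) ` {..<r}" by blast
  qed
  then have "card {q. q < r * n + j \<and> q mod n = j} \<le> card ((\<lambda>i. i * n + j) ` {..<r})"
    by (intro card_mono) auto
  also have "\<dots> \<le> r" using card_image_le[of "{..<r}" "\<lambda>i. i * n + j"] by simp
  finally show ?thesis .
qed

section \<open>Plays of an arbitrary policy of agent j against the greedy agents\<close>

locale hard_play = hard_instance +
  fixes tb :: tie_rule and \<sigma> :: policy
  assumes tb: "tie_breaking tb"
begin

definition h :: "nat \<Rightarrow> history" where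
  "h q = play inst ((greedy tb inst)(j := \<sigma>)) q"

definition av :: "nat \<Rightarrow> nat set" where "av q = available inst (h q)"

definition ow :: "nat \<Rightarrow> nat set" where "ow q = owned inst (h q) j"

definition taken :: "nat \<Rightarrow> nat set" where "taken q = {x. Some x \<in> set (h q)}"

definition pick :: "nat \<Rightarrow> nat option" where
  "pick q = legal inst (h q) (if q mod n = j then \<sigma> (h q) else greedy tb inst (q mod n) (h q))"

lemma length_h [simp]: "length (h q) = q" by (simp add: h_def)

lemma h_0: "h 0 = []" by (simp add: h_def)

lemma h_Suc: "h (Suc q) = h q @ [pick q]"
  by (simp add: h_def pick_def Let_def)

lemma taken_sub: "taken q \<subseteq> {..<m}"
  using play_taken[of inst] by (simp add: taken_def h_def)

lemma finite_taken [simp]: "finite (taken q)" using taken_sub finite_subset by blast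

lemma av_eq: "av q = {..<m} - taken q" by (simp add: av_def available_def taken_def)

lemma ow_sub: "ow q \<subseteq> taken q" using owned_taken by (simp add: ow_def taken_def)

lemma finite_ow [simp]: "finite (ow q)" using ow_sub finite_subset finite_taken by blast

lemma taken_Suc: "taken (Suc q) = taken q \<union> {x. pick q = Some x}"
  by (auto simp: taken_def h_Suc)

lemma ow_Suc: "ow (Suc q) = ow q \<union> (if q mod n = j then {x. pick q = Some x} else {})"
  by (simp add: ow_def h_Suc owned_append)

lemma pick_av: "pick q = Some x \<Longrightarrow> x \<in> av q"
  unfolding pick_def av_def by (rule legal_available)

lemma av_mono: "q \<le> q' \<Longrightarrow> av q' \<subseteq> av q"
  by (induction q' rule: dec_induct) (auto simp: av_eq taken_Suc)

text \<open>All available items have different marginals, so the set passed to the tie-breaking rule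
  is a singleton.\<close>

lemma greedy_other:
  assumes "q mod n \<noteq> j" "av q \<noteq> {}"
  shows "pick q = Some (Min (av q))"
proof -
  let ?i = "q mod n" and ?S = "owned inst (h q) (q mod n)"
  have fin: "finite (av q)" by (simp add: av_eq)
  have S: "?S \<subseteq> taken q" using owned_taken by (simp add: taken_def)
  then have Sm: "?S \<subseteq> {..<m}" "finite ?S"
    using taken_sub finite_taken by (blast, meson finite_subset)
  have A: "{x \<in> available inst (h q). ?S \<union> {x} \<in> indep inst ?i} = av q"
    using Sm(1) by (auto simp: av_def available_def)
  have marg: "marginal (obj inst ?i) x ?S = real (m - x)" if "x \<in> av q" for x
  proof -
    have "x \<notin> ?S" using that S by (auto simp: av_eq)
    then show ?thesis using assms(1) Sm(2) by (simp add: marginal_def wt_insert)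
  qed
  have "{x \<in> av q. \<forall>y\<in>av q. marginal (obj inst ?i) y ?S \<le> marginal (obj inst ?i) x ?S} = {Min (av q)}"
    (is "?L = _")
  proof
    show "?L \<subseteq> {Min (av q)}"
    proof
      fix x assume x: "x \<in> ?L"
      then have "real (m - Min (av q)) \<le> real (m - x)"
        using marg Min_in[OF fin assms(2)] by auto
      moreover have "x < m" "Min (av q) \<le> x" using x fin by (auto simp: av_eq)
      ultimately show "x \<in> {Min (av q)}" by simp
    qed
    have "marginal (obj inst ?i) y ?S \<le> marginal (obj inst ?i) (Min (av q)) ?S" if "y \<in> av q" for y
      using Min_le[OF fin that] unfolding marg[OF that] marg[OF Min_in[OF fin assms(2)]] by simp
    then show "{Min (av q)} \<subseteq> ?L" using Min_in[OF fin assms(2)] by blast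
  qed
  moreover have "tb ?i {Min (av q)} = Min (av q)"
    using tb unfolding tie_breaking_def by (metis insert_not_empty singletonD)
  ultimately have "greedy tb inst ?i (h q) = Some (Min (av q))"
    using assms(2) unfolding greedy_def Let_def A by simp
  then show ?thesis
    using assms(1) Min_in[OF fin assms(2)] by (simp add: pick_def legal_def av_def)
qed

text \<open>An agent other than \<open>j\<close> reaches item \<open>x\<close> only after all smaller items are gone, and
  every turn removes at most one item.\<close>

lemma available_early: "x < m \<Longrightarrow> q \<le> x \<Longrightarrow> x \<notin> ow q \<Longrightarrow> x \<in> av q"
proof (induction q)
  case 0
  then show ?case by (simp add: av_eq taken_def h_0)
next
  case (Suc q)
  then have x: "x \<in> av q" by (auto simp: ow_Suc split: if_splits)
  have "pick q \<noteq> Some x"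
  proof
    assume p: "pick q = Some x"
    then have "q mod n \<noteq> j" using Suc.prems(3) by (auto simp: ow_Suc)
    then have "x = Min (av q)" using greedy_other x p by fastforce
    moreover have "finite (av q)" by (simp add: av_eq)
    ultimately have "y \<notin> av q" if "y < x" for y
      using that by (meson Min_le leD)
    then have "{..<x} \<subseteq> taken q" using Suc.prems(1) by (auto simp: av_eq)
    then have "x \<le> card (taken q)" using card_mono[of "taken q" "{..<x}"] by simp
    also have "\<dots> \<le> q" using card_taken_le[of "h q"] by (simp add: taken_def)
    finally show False using Suc.prems(2) by simp
  qed
  then show ?case using x by (auto simp: av_eq taken_Suc)
qed

text \<open>As long as some \<open>y < l\<close> is available, the least available item is below
  \<open>l\<close>, so each turn of another agent removes an item below \<open>l\<close>.\<close>

lemma card_others: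
  "y \<in> av t \<Longrightarrow> y < l \<Longrightarrow> card {q. q < t \<and> q mod n \<noteq> j} \<le> card ((taken t - ow t) \<inter> {..<l})"
proof (induction t)
  case 0
  then show ?case by simp
next
  case (Suc t)
  have y: "y \<in> av t" using Suc.prems(1) av_mono[of t "Suc t"] by auto
  note IH = Suc.IH[OF y Suc.prems(2)]
  show ?case
  proof (cases "t mod n = j")
    case True
    then have "{q. q < Suc t \<and> q mod n \<noteq> j} = {q. q < t \<and> q mod n \<noteq> j}"
      by (auto simp: less_Suc_eq)
    moreover have "taken t - ow t \<subseteq> taken (Suc t) - ow (Suc t)"
      using pick_av[of t] True by (auto simp: taken_Suc ow_Suc av_eq)
    then have "card ((taken t - ow t) \<inter> {..<l}) \<le> card ((taken (Suc t) - ow (Suc t)) \<inter> {..<l})"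
      by (intro card_mono) auto
    ultimately show ?thesis using IH by simp
  next
    case False
    then have "{q. q < Suc t \<and> q mod n \<noteq> j} = insert t {q. q < t \<and> q mod n \<noteq> j}"
      by (auto simp: less_Suc_eq)
    then have c: "card {q. q < Suc t \<and> q mod n \<noteq> j} = Suc (card {q. q < t \<and> q mod n \<noteq> j})" by simp
    let ?x = "Min (av t)"
    have fin: "finite (av t)" by (simp add: av_eq)
    have p: "pick t = Some ?x" using greedy_other[OF False] y by blast
    have x: "?x \<in> av t" "?x < l" using Min_in[OF fin] Min_le[OF fin y] y Suc.prems(2) by auto
    have "(taken (Suc t) - ow (Suc t)) \<inter> {..<l} = insert ?x ((taken t - ow t) \<inter> {..<l})"
      using x ow_sub[of t] False p by (auto simp: taken_Suc ow_Suc av_eq)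
    moreover have "?x \<notin> (taken t - ow t) \<inter> {..<l}" using x by (auto simp: av_eq)
    ultimately show ?thesis using IH c by simp
  qed
qed

text \<open>At most \<open>r\<close> of the first \<open>r * n + j\<close> turns belong to agent
  \<open>j\<close>; in each of the others an item below \<open>l\<close> was removed. These items,
  the items below \<open>l\<close> owned by agent \<open>j\<close>, and \<open>y\<close> itself are
  all different and fit into \<open>{..<l}\<close>.\<close>

lemma available_count:
  assumes "y \<in> av (r * n + j)" "y < l"
  shows "r * n + j + card (ow (r * n + j) \<inter> {..<l}) < l + r"
proof -
  let ?t = "r * n + j"
  have "{..<?t} = {q. q < ?t \<and> q mod n = j} \<union> {q. q < ?t \<and> q mod n \<noteq> j}" by auto
  then have "card {..<?t} = card {q. q < ?t \<and> q mod n = j} + card {q. q < ?t \<and> q mod n \<noteq> j}"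
    by (subst card_Un_disjoint[symmetric]) auto
  then have "?t \<le> r + card {q. q < ?t \<and> q mod n \<noteq> j}" using card_turns_le[of r n j] by simp
  also have "\<dots> \<le> r + card ((taken ?t - ow ?t) \<inter> {..<l})" using card_others[OF assms] by simp
  finally have 1: "?t \<le> r + card ((taken ?t - ow ?t) \<inter> {..<l})" .
  have "insert y ((taken ?t - ow ?t) \<inter> {..<l} \<union> ow ?t \<inter> {..<l}) \<subseteq> {..<l}" using assms by auto
  then have "card (insert y ((taken ?t - ow ?t) \<inter> {..<l} \<union> ow ?t \<inter> {..<l})) \<le> l"
    using card_mono[OF finite_lessThan] by fastforce
  moreover have "card (insert y ((taken ?t - ow ?t) \<inter> {..<l} \<union> ow ?t \<inter> {..<l})) =
      Suc (card ((taken ?t - ow ?t) \<inter> {..<l}) + card (ow ?t \<inter> {..<l}))"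
    using assms(1) ow_sub[of ?t] by (subst card_insert_disjoint) (auto simp: av_eq intro!: card_Un_disjoint)
  ultimately show ?thesis using 1 by simp
qed

lemma ow_eq: "ow t = {x. \<exists>r. r * n + j < t \<and> pick (r * n + j) = Some x}"
proof (induction t)
  case 0
  then show ?case by (auto simp: ow_def owned_def h_0)
next
  case (Suc t)
  show ?case
  proof (cases "t mod n = j")
    case True
    define r where "r = t div n"
    have t: "t = r * n + j" using True unfolding r_def by (metis div_mult_mod_eq)
    then show ?thesis using True unfolding ow_Suc Suc.IH by (auto simp: less_Suc_eq)
  next
    case False
    then have "r * n + j \<noteq> t" for r using jn by auto
    then show ?thesis using False unfolding ow_Suc Suc.IH by (auto simp: less_Suc_eq)
  qed
qed

lemma ow_turn: "ow (R * n + j) = {x. \<exists>r<R. pick (r * n + j) = Some x}"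
proof -
  have "r * n + j < R * n + j \<longleftrightarrow> r < R" for r using n2 by simp
  then show ?thesis unfolding ow_eq by simp
qed

lemma ow_final: "ow m = {x. \<exists>r<3 * T. pick (r * n + j) = Some x}"
proof -
  have m: "m = 3 * T * n" by (simp add: m_def)
  have "r * n + j < m \<longleftrightarrow> r < 3 * T" for r
  proof
    assume "r * n + j < m"
    then have "r * n < (3 * T) * n" unfolding m by (rule add_lessD1)
    then show "r < 3 * T" by simp
  next
    assume "r < 3 * T"
    then have "(r + 1) * n \<le> (3 * T) * n" by (intro mult_le_mono1) simp
    then show "r * n + j < m" using jn by (simp add: m)
  qed
  then show ?thesis by (simp add: ow_eq)
qed

lemma outcome_eq: "outcome inst ((greedy tb inst)(j := \<sigma>)) j = ow m"
  unfolding outcome_def turns_inst ow_def h_def ..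

lemma ow_sub_items: "ow t \<subseteq> {..<m}"
  by (rule order_trans[OF ow_sub taken_sub])

lemma card_ow_turn: "card (ow (r * n + j)) \<le> r"
proof -
  have "ow (r * n + j) \<subseteq> (\<lambda>r. the (pick (r * n + j))) ` {..<r}"
  proof
    fix x assume "x \<in> ow (r * n + j)"
    then obtain r' where "r' < r" "pick (r' * n + j) = Some x" unfolding ow_turn by blast
    then show "x \<in> (\<lambda>r. the (pick (r * n + j))) ` {..<r}" by (intro image_eqI[of _ _ r']) simp_all
  qed
  then have "card (ow (r * n + j)) \<le> card ((\<lambda>r. the (pick (r * n + j))) ` {..<r})"
    by (intro card_mono) auto
  also have "\<dots> \<le> r" using card_image_le[of "{..<r}" "\<lambda>r. the (pick (r * n + j))"] by simp
  finally show ?thesis .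
qed

text \<open>This closes the loophole of evading the penalty by taking more than \<open>k\<close>
  items of \<open>reg\<close>. During the first \<open>k\<close> rounds there are too few turns for
  that; later, an item of \<open>reg\<close> that is still left bounds what agent \<open>j\<close>
  owns by \<open>available_count\<close>.\<close>

lemma card_ow_reg: "card (ow t \<inter> reg) \<le> k"
proof (induction t)
  case 0
  then show ?case by (simp add: ow_eq)
next
  case (Suc t)
  show ?case
  proof (cases "t mod n = j \<and> (\<exists>x\<in>reg. pick t = Some x)")
    case False
    then have "ow (Suc t) \<inter> reg = ow t \<inter> reg" by (auto simp: ow_Suc)
    then show ?thesis using Suc by simp
  next
    case True
    then obtain x where x: "x \<in> reg" "pick t = Some x" by blast
    define r where "r = t div n"
    have t: "t = r * n + j" using True unfolding r_def by (metis div_mult_mod_eq)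
    have "ow (Suc t) \<inter> reg \<subseteq> insert x (ow t \<inter> reg)"
      using x by (auto simp: ow_Suc split: if_splits)
    then have c: "card (ow (Suc t) \<inter> reg) \<le> Suc (card (ow t \<inter> reg))"
    proof -
      have "card (ow (Suc t) \<inter> reg) \<le> card (insert x (ow t \<inter> reg))"
        by (intro card_mono) (use \<open>_ \<subseteq> insert x _\<close> in auto)
      also have "\<dots> \<le> Suc (card (ow t \<inter> reg))" by (simp add: card_insert_if)
      finally show ?thesis .
    qed
    show ?thesis
    proof (cases "r < k")
      case True
      have "card (ow t \<inter> reg) \<le> card (ow t)" by (intro card_mono) auto
      then show ?thesis using c card_ow_turn[of r] True unfolding t by linarith
    next
      case False
      \<comment> \<open>While \<open>x\<close> is left, the own items in \<open>reg\<close> number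
        fewer than \<open>k * n + r - r * n\<close>, which is at most \<open>k\<close> because
        \<open>k \<le> r\<close> and \<open>n \<ge> 2\<close>. So there is room for
        \<open>x\<close>.\<close>
      have "r * n + j + card (ow t \<inter> reg) < j + k * n + r"
        using available_count[of x r "j + k * n"] pick_av[OF x(2)] x(1) unfolding t reg_def by simp
      moreover have "k * n + (r - k) * 1 \<le> k * n + (r - k) * n" using n2 by (intro add_left_mono mult_le_mono2) simp
      moreover have "k * n + (r - k) * n = r * n" using False by (simp add: add_mult_distrib[symmetric])
      ultimately show ?thesis using c False by linarith
    qed
  qed
qed

end

section \<open>Values of greedy play and of play along a certificate\<close>

context hard_instance
begin

text \<open>The turns of agent \<open>j\<close> in the first \<open>k + T\<close> rounds come before
  turn \<open>(k + T) * n\<close>, hence no later than turn \<open>m - T\<close>. By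
  \<open>available_early\<close> no other agent has taken a trap before them.\<close>

lemma m_large: "2 * k \<le> T \<Longrightarrow> (k + T) * n + T \<le> m"
proof -
  assume "2 * k \<le> T"
  then have "(k + T) * n + T \<le> (k + T) * n + (T - k) * n + T * 1" using n2 by simp
  also have "\<dots> \<le> (k + T) * n + (T - k) * n + T * n" using n2 by (intro add_left_mono mult_le_mono2) simp
  also have "\<dots> = (k + T + (T - k) + T) * n" by (simp only: add_mult_distrib)
  also have "\<dots> = m" using \<open>2 * k \<le> T\<close> by (simp add: m_def)
  finally show ?thesis .
qed

lemma reg_le: "2 * k \<le> T \<Longrightarrow> j + k * n + T \<le> m"
proof -
  assume T: "2 * k \<le> T"
  have "j + k * n \<le> (k + 1) * n" using jn by simp
  also have "\<dots> \<le> (k + T) * n" using T k1 by (intro mult_le_mono1) simp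
  finally show ?thesis using m_large[OF T] by simp
qed

lemma turn_early: "2 * k \<le> T \<Longrightarrow> r < k + T \<Longrightarrow> r * n + j + T \<le> m"
proof -
  assume T: "2 * k \<le> T" "r < k + T"
  have "r * n + j \<le> (r + 1) * n" using jn by simp
  also have "\<dots> \<le> (k + T) * n" using T by (intro mult_le_mono1) simp
  finally show ?thesis using m_large[OF T(1)] by simp
qed

lemma card_traps: "T \<le> m \<Longrightarrow> card traps = T" by (simp add: traps_def)

lemma finite_traps [simp]: "finite traps" by (simp add: traps_def)

lemma traps_reg: "2 * k \<le> T \<Longrightarrow> traps \<inter> reg = {}"
  using reg_le by (auto simp: traps_def reg_def)

lemma fj_insert_trap:
  assumes "2 * k \<le> T" "finite S" "x \<in> traps" "x \<notin> S"
  shows "fj (insert x S) = fj S + 3"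
proof -
  have "x \<notin> reg" using traps_reg[OF assms(1)] assms(3) by blast
  then have "hval (insert x S) = hval S" by (intro hval_cong) auto
  then show ?thesis using assms by (simp add: fj_def Int_insert_left)
qed

lemma fj_insert_other:
  assumes "x \<notin> traps" "finite S"
  shows "fj (insert x S) \<le> fj S + 2"
proof -
  have "card (insert x S \<inter> reg) \<le> Suc (card (S \<inter> reg))"
    using assms(2) by (simp add: Int_insert_left card_insert_if)
  moreover have "card (S \<inter> reg) \<le> card (insert x S \<inter> reg)" by (intro card_mono) auto
  moreover have "hval (insert x S) = hval S" if "card (insert x S \<inter> reg) = card (S \<inter> reg)"
  proof -
    have "S \<inter> reg = insert x S \<inter> reg" by (rule card_subset_eq) (use that in auto)
    then show ?thesis by (metis hval_cong)
  qed
  ultimately have "hval (insert x S) \<le> hval S + 2"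
    by (cases "card (insert x S \<inter> reg) = card (S \<inter> reg)") (auto simp: hval_def le_Suc_eq)
  then show ?thesis using assms(1) by (simp add: fj_def)
qed

end

text \<open>A trap gains 3 and any other item at most 2, so each of the first \<open>T\<close> turns
  of agent \<open>j\<close> takes a trap. After these rounds the others have emptied
  \<open>reg\<close>, and the items taken later are worth nothing.\<close>

lemma (in hard_play) outcome_value_greedy:
  assumes T: "2 * k \<le> T" and \<sigma>: "\<sigma> = greedy tb inst j"
  shows "fj (ow m) = 3 * T"
proof -
  have turn_mod: "(r * n + j) mod n = j" for r using jn by simp
  have Tm: "T \<le> m" using reg_le[OF T] by simp
  have step: "\<exists>x\<in>traps - ow (r * n + j). pick (r * n + j) = Some x"
    if r: "r < T" and own: "ow (r * n + j) \<subseteq> traps" for r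
  proof -
    let ?t = "r * n + j" and ?S = "ow (r * n + j)"
    have S: "owned inst (h ?t) j = ?S" by (simp add: ow_def)
    have A: "{x \<in> available inst (h ?t). ?S \<union> {x} \<in> indep inst j} = av ?t"
      using ow_sub_items by (auto simp: av_def available_def)
    define M where "M = {x \<in> av ?t. \<forall>y\<in>av ?t. marginal (obj inst j) y ?S \<le> marginal (obj inst j) x ?S}"
    \<comment> \<open>Fewer than \<open>T\<close> turns of agent \<open>j\<close> have passed, so
      some trap is not owned yet; it lies too far back for the others to have reached it.\<close>
    have "card ?S < card traps" using card_ow_turn[of r] r card_traps[OF Tm] by simp
    then obtain y where y: "y \<in> traps" "y \<notin> ?S"
      by (metis card_mono finite_ow not_le subsetI)
    have "y \<in> av ?t"
    proof (rule available_early)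
      show "y < m" "?t \<le> y" using y(1) turn_early[OF T, of r] r by (auto simp: traps_def)
    qed (use y in simp)
    have marg_y: "marginal (obj inst j) y ?S = 3"
      using fj_insert_trap[OF T _ y] by (simp add: marginal_def)
    have M: "M \<subseteq> traps"
    proof (rule subsetI, rule ccontr)
      fix x assume x: "x \<in> M" "x \<notin> traps"
      have "marginal (obj inst j) x ?S \<le> 2"
        using fj_insert_other[OF x(2), of ?S] by (simp add: marginal_def)
      moreover have "marginal (obj inst j) y ?S \<le> marginal (obj inst j) x ?S"
        using x(1) \<open>y \<in> av ?t\<close> unfolding M_def by blast
      ultimately show False using marg_y by simp
    qed
    have "y \<in> M"
    proof -
      have "marginal (obj inst j) z ?S \<le> 3" if "z \<in> av ?t" for z
      proof (cases "z \<in> traps")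
        case True
        moreover have "z \<notin> ?S" using that ow_sub by (auto simp: av_eq)
        ultimately show ?thesis using fj_insert_trap[OF T, of ?S z] by (simp add: marginal_def)
      next
        case False
        then show ?thesis using fj_insert_other[of z ?S] by (simp add: marginal_def)
      qed
      then show ?thesis using \<open>y \<in> av ?t\<close> marg_y unfolding M_def by simp
    qed
    then have tbM: "tb j M \<in> M" using tb unfolding tie_breaking_def by blast
    then have "tb j M \<in> av ?t" by (simp add: M_def)
    have "available inst (h ?t) \<noteq> {}" using \<open>y \<in> av ?t\<close> by (auto simp: av_def)
    then have "greedy tb inst j (h ?t) = Some (tb j M)"
      using \<open>y \<in> av ?t\<close> unfolding greedy_def Let_def S A M_def by (simp add: ex_in_conv[symmetric] exI[of _ y])
    with fun_cong[OF \<sigma>] have "\<sigma> (h ?t) = Some (tb j M)" by (rule trans)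
    then have "pick ?t = Some (tb j M)"
      using turn_mod \<open>tb j M \<in> av ?t\<close> by (simp add: pick_def legal_def av_def)
    moreover have "tb j M \<notin> ?S" using \<open>tb j M \<in> av ?t\<close> ow_sub by (auto simp: av_eq)
    ultimately show ?thesis using tbM M by blast
  qed
  have own: "ow (r * n + j) \<subseteq> traps \<and> card (ow (r * n + j)) = r" if "r \<le> T" for r
    using that
  proof (induction r)
    case 0
    have "ow (0 * n + j) = {}" unfolding ow_turn by simp
    then show ?case by simp
  next
    case (Suc r)
    then obtain x where x: "x \<in> traps - ow (r * n + j)" "pick (r * n + j) = Some x"
      using step[of r] by auto
    have "ow (Suc r * n + j) = insert x (ow (r * n + j))"
      unfolding ow_turn using x(2) by (auto simp: less_Suc_eq)
    then show ?case using Suc x by simp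
  qed
  have T_sub: "ow (T * n + j) \<subseteq> ow m"
  proof -
    have "r < 3 * T" if "r < T" for r using that by simp
    then show ?thesis unfolding ow_turn ow_final by blast
  qed
  have "ow (T * n + j) = traps"
    using own[of T] card_traps[OF Tm] by (intro card_subset_eq) auto
  then have traps: "ow m \<inter> traps = traps" using T_sub by blast
  have reg: "ow m \<inter> reg = {}"
  proof (rule ccontr)
    assume "ow m \<inter> reg \<noteq> {}"
    then obtain x r where x: "x \<in> reg" "pick (r * n + j) = Some x" by (auto simp: ow_final)
    show False
    proof (cases "r < T")
      case True
      then have "x \<in> ow (T * n + j)" using x(2) unfolding ow_turn by blast
      then show False using own[of T] x(1) traps_reg[OF T] by blast
    next
      case False
      have "T * n + j \<le> r * n + j" using False by simp
      then have "x \<in> av (T * n + j)" using pick_av[OF x(2)] av_mono by blast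
      then have "T * n + j < j + k * n + T"
        using available_count[of x T "j + k * n"] x(1) by (simp add: reg_def)
      \<comment> \<open>Half of \<open>T * n\<close> covers \<open>k * n\<close> and the other half
        covers \<open>T\<close>, which contradicts the inequality just derived from an item of
        \<open>reg\<close> being left.\<close>
      moreover have "2 * (k * n) \<le> T * n" using T by (metis mult.assoc mult_le_mono1)
      moreover have "T * 2 \<le> T * n" using n2 by (rule mult_le_mono2)
      ultimately show False by linarith
    qed
  qed
  show ?thesis using traps reg card_traps[OF Tm] k1 by (simp add: fj_def hval_def)
qed

context hard_instance
begin

definition cand :: "word \<Rightarrow> nat \<Rightarrow> nat" where
  "cand v r = (if r < k then j + r * n + (if v ! r then 1 else 0) else m - T + (r - k))"

definition strategy :: "word \<Rightarrow> policy" where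
  "strategy v h = (if length h div n < k + T then Some (cand v (length h div n)) else None)"

text \<open>The candidate of round \<open>r\<close> has a number of at least
  \<open>r * n + j\<close>, the number of turns so far: for a block by the offset of
  \<open>reg\<close>, for a trap by \<open>turn_early\<close>. So \<open>available_early\<close>
  applies, provided that agent \<open>j\<close> does not own the candidate already, which is what
  injectivity of \<open>cand v\<close> is for.\<close>

lemma outcome_value_strategy:
  assumes T: "2 * k \<le> T" and tb: "tie_breaking tb" and v: "length v = k" "acc v"
  shows "fj (outcome inst ((greedy tb inst)(j := strategy v)) j) = 3 * T + 2 * k"
proof -
  interpret hard_play n j k T acc tb "strategy v" by unfold_locales (rule tb)
  have Tm: "T \<le> m" using reg_le[OF T] by simp
  have small: "cand v r < j + (r + 1) * n" "j + r * n \<le> cand v r" if "r < k" for r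
    using that n2 by (auto simp: cand_def)
  have small_reg: "cand v r \<in> reg" if "r < k" for r
  proof -
    have "(r + 1) * n \<le> k * n" using that by (intro mult_le_mono1) simp
    then show ?thesis using small[OF that] by (simp add: reg_def)
  qed
  have large: "cand v r \<in> traps" if "k \<le> r" "r < k + T" for r
    using that Tm by (auto simp: cand_def traps_def)
  have inj: "inj_on (cand v) {..<k + T}"
  proof (rule linorder_inj_onI)
    fix r r' assume rr: "r < r'" "r' \<in> {..<k + T}"
    show "cand v r \<noteq> cand v r'"
    proof (cases "r' < k")
      case True
      have "(r + 1) * n \<le> r' * n" using rr by (intro mult_le_mono1) simp
      then show ?thesis using small[of r] small[of r'] rr True by simp
    next
      case False
      then have r': "cand v r' \<in> traps" using large rr by simp
      show ?thesis
      proof (cases "r < k")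
        case True
        then show ?thesis using small_reg[of r] r' traps_reg[OF T] by auto
      next
        case r: False
        then show ?thesis using False rr by (simp add: cand_def)
      qed
    qed
  qed auto
  have pick: "pick (r * n + j) = Some (cand v r)" if "r < k + T" for r
    using that
  proof (induction r rule: less_induct)
    case (less r)
    let ?t = "r * n + j"
    have "cand v r \<in> av ?t"
    proof (rule available_early)
      show "cand v r < m"
        using small_reg[of r] large[of r] less.prems reg_le[OF T]
        by (cases "r < k") (auto simp: reg_def traps_def)
      show "?t \<le> cand v r"
        using small(2)[of r] large[of r] turn_early[OF T less.prems] less.prems
        by (cases "r < k") (auto simp: traps_def)
      show "cand v r \<notin> ow ?t"
      proof
        assume "cand v r \<in> ow ?t"
        then obtain r' where r': "r' < r" "pick (r' * n + j) = Some (cand v r)"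
          unfolding ow_turn by blast
        then have "cand v r' = cand v r" using less by simp
        then show False using inj r'(1) less.prems unfolding inj_on_def by fastforce
      qed
    qed
    moreover have "?t mod n = j" "?t div n = r" using jn by simp_all
    moreover from this have "strategy v (h ?t) = Some (cand v r)" using less.prems by (simp add: strategy_def)
    ultimately show ?case by (simp add: pick_def legal_def av_def)
  qed
  have none: "pick (r * n + j) = None" if "\<not> r < k + T" for r
  proof -
    have "(r * n + j) mod n = j" "(r * n + j) div n = r" using jn by simp_all
    moreover from this have "strategy v (h (r * n + j)) = None" using that by (simp add: strategy_def)
    ultimately show ?thesis by (simp add: pick_def legal_def)
  qed
  have S: "ow m = cand v ` {..<k + T}"
  proof -
    have "pick (r * n + j) = Some x \<longleftrightarrow> r < k + T \<and> x = cand v r" for r x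
      using pick none by (cases "r < k + T") auto
    then show ?thesis using T by (auto simp: ow_final intro!: exI image_eqI)
  qed
  have "ow m \<inter> reg = cand v ` {..<k}"
    unfolding S using small_reg large traps_reg[OF T] by (fastforce simp: not_less)
  moreover have "card (cand v ` {..<k}) = k"
    using inj by (subst card_image) (auto intro: inj_on_subset)
  ultimately have card_reg: "card (ow m \<inter> reg) = k" by simp
  have "traps \<subseteq> ow m"
  proof
    fix x assume "x \<in> traps"
    then have "x = cand v (k + (x - (m - T)))" "k + (x - (m - T)) < k + T"
      using Tm by (auto simp: cand_def traps_def)
    then show "x \<in> ow m" unfolding S by blast
  qed
  then have "ow m \<inter> traps = traps" by blast
  then have card_tr: "card (ow m \<inter> traps) = T" using card_traps[OF Tm] by simp
  have "j + 1 + r * n \<in> ow m \<longleftrightarrow> v ! r" if r: "r < k" for r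
  proof
    assume "v ! r"
    then have "cand v r = j + 1 + r * n" using r by (simp add: cand_def)
    then show "j + 1 + r * n \<in> ow m" unfolding S using r by (metis image_eqI lessThan_iff trans_less_add1)
  next
    assume "j + 1 + r * n \<in> ow m"
    then obtain r' where r': "r' < k + T" "cand v r' = j + 1 + r * n" unfolding S by auto
    have le: "(r + 1) * n \<le> k * n" using r by (intro mult_le_mono1) simp
    then have "cand v r' \<in> reg" using r' n2 by (simp add: reg_def)
    then have "r' < k" using large[of r'] r' traps_reg[OF T] by (auto simp: not_less)
    note s = small[OF this]
    \<comment> \<open>The candidates of the first \<open>k\<close> rounds lie in the disjoint
      intervals from \<open>j + r * n\<close> to \<open>j + (r + 1) * n\<close>, so the item
      determines its round.\<close>
    have "r' = r"
    proof (rule antisym)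
      have "r' * n < (r + 1) * n" using s(2) r'(2) n2 by simp
      then have "r' < r + 1" unfolding mult_less_cancel2 ..
      then show "r' \<le> r" by simp
      have "r * n < (r' + 1) * n" using s(1) r'(2) by simp
      then have "r < r' + 1" unfolding mult_less_cancel2 ..
      then show "r \<le> r'" by simp
    qed
    then show "v ! r" using r'(2) r by (simp add: cand_def split: if_splits)
  qed
  then have "decode (ow m) = v" using v(1) by (intro nth_equalityI) (auto simp: decode_def)
  then show ?thesis using card_reg card_tr v k1 unfolding outcome_eq by (simp add: fj_def hval_def)
qed

text \<open>The strategy for \<open>v\<close> shows that the threshold
  \<open>(1 + \<epsilon>) * 3 * T\<close> is attainable, so \<open>\<sigma>\<close> has to attain
  it. The threshold exceeds \<open>3 * T + 2 * k - 1\<close> and values are integers, so at least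
  \<open>3 * T + 2 * k\<close> is obtained. Traps contribute at most \<open>3 * T\<close>, which
  leaves \<open>hval\<close> at its maximum with at most \<open>k\<close> items of
  \<open>reg\<close>: exactly \<open>k\<close> of them, and no penalty.\<close>

theorem improvement_finds_accepted:
  assumes tb: "tie_breaking tb" and T: "2 * k \<le> T" and v: "length v = k" "acc v"
    and \<epsilon>: "2 * real k - 1 < 3 * \<epsilon> * real T" "3 * \<epsilon> * real T \<le> 2 * real k"
    and imp: "improvement (1 + \<epsilon>) tb inst (greedy tb inst) j \<sigma>"
  shows "acc (decode (outcome inst ((greedy tb inst)(j := \<sigma>)) j))"
proof -
  interpret g: hard_play n j k T acc tb "greedy tb inst j" by unfold_locales (rule tb)
  interpret s: hard_play n j k T acc tb \<sigma> by unfold_locales (rule tb)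
  have greedy: "fj (outcome inst ((greedy tb inst)(j := greedy tb inst j)) j) = 3 * T"
    unfolding g.outcome_eq by (rule g.outcome_value_greedy[OF T refl])
  let ?S = "outcome inst ((greedy tb inst)(j := \<sigma>)) j"
  have out: "outcome inst \<pi> j \<subseteq> {..<m}" for \<pi>
    using owned_taken play_taken[of inst \<pi>] by (fastforce simp: outcome_def)
  have "achieves (1 + \<epsilon>) tb inst (greedy tb inst) j (strategy v)"
    using out[of "(greedy tb inst)(j := strategy v)"] outcome_value_strategy[OF T tb v] greedy \<epsilon>(2)
    by (simp add: achieves_def algebra_simps)
  then have "achieves (1 + \<epsilon>) tb inst (greedy tb inst) j \<sigma>" using imp unfolding improvement_def by blast
  then have "real (fj ?S) \<ge> (1 + \<epsilon>) * real (3 * T)" unfolding achieves_def using greedy by simp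
  then have "real (3 * T + 2 * k) - 1 < real (fj ?S)" using \<epsilon>(1) by (simp add: algebra_simps)
  then have val: "3 * T + 2 * k \<le> fj ?S" by linarith
  have "card (?S \<inter> traps) \<le> card traps" by (intro card_mono) auto
  then have "card (?S \<inter> traps) \<le> T" using card_traps reg_le[OF T] by simp
  then have "2 * k \<le> hval ?S" using val by (simp add: fj_def)
  moreover have "card (?S \<inter> reg) \<le> k" unfolding s.outcome_eq by (rule s.card_ow_reg)
  ultimately show ?thesis using k1 by (auto simp: hval_def split: if_splits)
qed

end

section \<open>Computing the objectives\<close>

text \<open>Allows a step function given by its natural formula; it has to agree with the list
  \<open>gs\<close> only on argument and state lists of the right length.\<close>

lemma ptime_fold_params:
  assumes step: "\<And>ws b st. length ws = a \<Longrightarrow> length st = k \<Longrightarrow> step ws b st = map (\<lambda>g. g ([b] # st @ ws)) gs"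
    and x: "ptime a D x" and ini: "\<forall>f\<in>set ini. ptime a D f" "length ini = k"
    and gs: "\<forall>g\<in>set gs. ptime (Suc (k + a)) E g" "length gs = k"
    and inv: "\<And>ws i. ws \<in> D \<Longrightarrow> length ws = a \<Longrightarrow> i < length (x ws) \<Longrightarrow>
      [x ws ! i] # fold (step ws) (take i (x ws)) (map (\<lambda>f. f ws) ini) @ ws \<in> E"
    and bound: "\<And>ws i l. ws \<in> D \<Longrightarrow> length ws = a \<Longrightarrow> i \<le> length (x ws) \<Longrightarrow> wbnd l ws \<Longrightarrow>
      wbnd (q l) (fold (step ws) (take i (x ws)) (map (\<lambda>f. f ws) ini))"
    and q: "polyb q" and r: "r < k"
  shows "ptime a D (\<lambda>ws. fold (step ws) (x ws) (map (\<lambda>f. f ws) ini) ! r)"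
proof -
  have eq: "fold (\<lambda>b st. map (\<lambda>g. g ([b] # st @ ws)) gs) xs st = fold (step ws) xs st"
    if "length ws = a" "length st = k" for ws xs st
    using that(2) by (induction xs arbitrary: st) (simp_all add: step that(1) gs(2))
  have eq_ini: "fold (\<lambda>b st. map (\<lambda>g. g ([b] # st @ ws)) gs) xs (map (\<lambda>f. f ws) ini) =
      fold (step ws) xs (map (\<lambda>f. f ws) ini)" if "length ws = a" for ws xs
    by (rule eq) (use that ini in auto)
  have "ptime a D (\<lambda>ws. fold (\<lambda>b st. map (\<lambda>g. g ([b] # st @ ws)) gs) (x ws) (map (\<lambda>f. f ws) ini) ! r)"
    by (rule ptime_foldp[where q = q, OF x ini gs]) (use inv bound in \<open>simp_all add: eq_ini q r\<close>)
  then show ?thesis by (rule ptime_cong) (simp add: eq_ini)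
qed

text \<open>Undoes the padding of a certificate by one \<open>True\<close> and a run of
  \<open>False\<close>. A nonempty word always loses at least one bit, also if it contains no
  \<open>True\<close>, so words of length \<open>k\<close> stand for certificates of length below
  \<open>k\<close>.\<close>

definition strip :: "word \<Rightarrow> word" where
  "strip v = rev (tl (dropWhile (\<lambda>b. b = False) (rev v)))"

lemma strip_pad: "strip (u @ True # replicate i False) = u"
  by (simp add: strip_def dropWhile_append)

lemma length_strip: "length (strip v) \<le> length v - 1"
  unfolding strip_def using length_dropWhile_le[of "\<lambda>b. b = False" "rev v"] by simp

lemma ptime_strip: "ptime a D f \<Longrightarrow> ptime a D (\<lambda>ws. strip (f ws))"
  unfolding strip_def by (intro ptime_rev ptime_tl ptime_dropWhile)

definition support :: "word \<Rightarrow> nat set" where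
  "support bs = {x. x < length bs \<and> bs ! x}"

lemma card_support: "card (support bs) = length (filter id bs)"
  by (simp add: support_def length_filter_conv_card)

lemma support_take: "support bs \<inter> {..<N} = support (take N bs)"
  by (auto simp: support_def)

lemma card_support_drop: "card (support bs \<inter> {N..}) = length (filter id (drop N bs))"
proof -
  have "support bs \<inter> {N..} = (\<lambda>x. x + N) ` support (drop N bs)"
  proof (intro equalityI subsetI)
    fix x assume "x \<in> support bs \<inter> {N..}"
    then show "x \<in> (\<lambda>x. x + N) ` support (drop N bs)"
      by (intro image_eqI[of _ _ "x - N"]) (auto simp: support_def)
  qed (auto simp: support_def add.commute)
  then show ?thesis by (simp add: card_image card_support)
qed

text \<open>The form of \<open>value_code\<close> on natural numbers; the final
  \<open>[True]\<close> is the denominator 1 in binary.\<close>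

definition code :: "nat \<Rightarrow> word" where
  "code v = replicate (length (bits v)) True @ False # bits v @ [True]"

lemma value_code_nat: "value_code (real v) = code v"
proof -
  have "(THE q. of_rat q = real v) = of_nat v"
    by (rule the_equality) (simp, metis of_rat_eq_iff of_rat_of_nat_eq)
  moreover have "quotient_of (of_nat v) = (int v, 1)"
    using quotient_of_int[of "int v"] by (simp add: of_int_def flip: Fract_of_int_eq)
  ultimately show ?thesis by (simp add: value_code_def code_def Let_def)
qed

lemma length_code_le: "length (code v) \<le> 2 * v + 2"
  using length_bits_le[of v] by (simp add: code_def)

lemma ptime_code: "ptime a D f \<Longrightarrow> ptime a D (\<lambda>ws. code (length (f ws)))"
  unfolding code_def by (intro ptime_append ptime_unary ptime_bits ptime_Cons ptime_const)

text \<open>The weight \<open>m - x\<close> of an item is the length of the suffix of the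
  characteristic vector that starts at \<open>x\<close>, so \<open>wt\<close> can be accumulated in
  a single pass.\<close>

primrec tails_length :: "word \<Rightarrow> nat" where
  "tails_length [] = 0"
| "tails_length (b # bs) = (if b then Suc (length bs) else 0) + tails_length bs"

lemma tails_length_eq: "tails_length bs = (\<Sum>x\<in>support bs. length bs - x)"
proof (induction bs)
  case Nil
  then show ?case by (simp add: support_def)
next
  case (Cons b bs)
  have "support (b # bs) = (if b then {0} else {}) \<union> Suc ` support bs"
  proof (rule set_eqI)
    fix x show "x \<in> support (b # bs) \<longleftrightarrow> x \<in> (if b then {0} else {}) \<union> Suc ` support bs"
      by (cases x) (auto simp: support_def)
  qed
  moreover have "finite (support bs)" by (simp add: support_def)
  ultimately show ?case using Cons by (auto simp: sum.reindex sum.insert)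
qed

lemma tails_length_le: "tails_length bs \<le> length bs * length bs"
  by (induction bs) auto

lemma ptime_tails_length:
  assumes "ptime a D f"
  shows "ptime a D (\<lambda>ws. replicate (tails_length (f ws)) True)"
proof -
  let ?gs = "[\<lambda>v :: word list. tl (v ! 1),
    \<lambda>v. if v ! 0 \<noteq> [] \<and> hd (v ! 0) then replicate (length (v ! 1)) True @ v ! 2 else v ! 2]"
  define step where "step ws b st = [tl (st ! 0), if b then replicate (length (st ! 0)) True @ st ! 1 else st ! 1]"
    for ws :: "word list" and b and st :: "word list"
  \<comment> \<open>Bounded recursion needs a bound on every partial fold, hence the estimate of the
    accumulator for all prefixes besides its exact value at the end.\<close>
  have eq: "\<exists>i. fold (step ws) (take k xs) [xs, replicate c True] = [drop k xs, replicate i True] \<and>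
      (k \<ge> length xs \<longrightarrow> i = tails_length xs + c) \<and> i \<le> tails_length xs + c" for ws xs k c
  proof (induction xs arbitrary: k c)
    case (Cons b xs)
    show ?case
    proof (cases k)
      case (Suc k')
      let ?c = "(if b then Suc (length xs) else 0) + c"
      have "step ws b [b # xs, replicate c True] = [xs, replicate ?c True]"
        by (simp add: step_def replicate_add)
      then show ?thesis using Cons.IH[of k' ?c] by (auto simp: Suc add_ac)
    qed (intro exI[of _ c], simp)
  qed (auto intro: exI[of _ c])
  have "ptime 1 UNIV (\<lambda>ws. fold (step ws) (ws ! 0) (map (\<lambda>f. f ws) [\<lambda>ws. ws ! 0, \<lambda>ws. []]) ! 1)"
  proof (rule ptime_fold_params[where gs = ?gs and k = 2 and E = UNIV and q = "\<lambda>l. l + l * l"])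
    show "\<forall>g\<in>set ?gs. ptime (Suc (2 + 1)) UNIV g"
      by (auto intro!: ptime_tl ptime_arg ptime_if pdec_hd ptime_append ptime_unary)
    show "step ws b st = map (\<lambda>g. g ([b] # st @ ws)) ?gs" if "length st = 2" for ws b st
      using that by (simp add: step_def nth_append)
    fix ws :: "word list" and i l assume ws: "length ws = 1" "wbnd l ws"
    obtain c where c: "fold (step ws) (take i (ws ! 0)) [ws ! 0, []] = [drop i (ws ! 0), replicate c True]"
        "c \<le> tails_length (ws ! 0)"
      using eq[of ws i "ws ! 0" 0] by auto
    have "length (ws ! 0) \<le> l" using ws by (simp add: wbnd_def)
    then have "c \<le> l * l"
      using c(2) tails_length_le[of "ws ! 0"] by (meson mult_le_mono order_trans)
    then have "wbnd (l + l * l) [drop i (ws ! 0), replicate c True]"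
      using \<open>length (ws ! 0) \<le> l\<close> by (simp add: wbnd_def)
    then show "wbnd (l + l * l) (fold (step ws) (take i (ws ! 0)) (map (\<lambda>f. f ws) [\<lambda>ws. ws ! 0, \<lambda>ws. []]))"
      using c(1) by simp
  qed (auto intro!: ptime_arg ptime_nil polyb_intros)
  moreover have "fold (step ws) (ws ! 0) (map (\<lambda>f. f ws) [\<lambda>ws. ws ! 0, \<lambda>ws. []]) ! 1 =
      replicate (tails_length (ws ! 0)) True" for ws :: "word list"
    using eq[of ws "length (ws ! 0)" "ws ! 0" 0] by auto
  ultimately have "ptime 1 UNIV (\<lambda>ws. replicate (tails_length (ws ! 0)) True)" by simp
  from ptime_comp1[OF this assms] show ?thesis by simp
qed

text \<open>Every \<open>n\<close>-th bit, with \<open>False\<close> beyond the end of the word.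
  After dropping \<open>j + 1\<close> bits this reads the second item of each block, see
  \<open>decode_support\<close>.\<close>

definition samples :: "nat \<Rightarrow> nat \<Rightarrow> word \<Rightarrow> word" where
  "samples n k bs = map (\<lambda>r. drop (r * n) bs \<noteq> [] \<and> hd (drop (r * n) bs)) [0..<k]"

lemma ptime_samples:
  assumes "ptime a D f" "ptime a D g"
  shows "ptime a D (\<lambda>ws. samples n (length (f ws)) (g ws))"
proof -
  let ?gs = "[\<lambda>v :: word list. drop n (v ! 1),
    \<lambda>v. v ! 2 @ (if v ! 1 \<noteq> [] \<and> hd (v ! 1) then [True] else [False])]"
  define step where "step ws b st = [drop n (st ! 0), st ! 1 @ [st ! 0 \<noteq> [] \<and> hd (st ! 0)]]"
    for ws :: "word list" and b :: bool and st :: "word list"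
  have samples_Suc: "samples n (Suc k) bs = (bs \<noteq> [] \<and> hd bs) # samples n k (drop n bs)" for k bs
    by (simp add: samples_def upt_conv_Cons map_Suc_upt[symmetric] del: upt_Suc map_Suc_upt add: add.commute)
  have eq: "fold (step ws) xs [bs, s] = [drop (length xs * n) bs, s @ samples n (length xs) bs]" for ws xs bs s
  proof (induction xs arbitrary: bs s)
    case (Cons b xs)
    have "step ws b [bs, s] = [drop n bs, s @ [bs \<noteq> [] \<and> hd bs]]" by (simp add: step_def)
    then show ?case by (simp add: Cons samples_Suc add.commute)
  qed (simp add: samples_def)
  have "ptime 2 UNIV (\<lambda>ws. fold (step ws) (ws ! 0) (map (\<lambda>f. f ws) [\<lambda>ws. ws ! 1, \<lambda>ws. []]) ! 1)"
  proof (rule ptime_fold_params[where gs = ?gs and k = 2 and E = UNIV and q = "\<lambda>l. l"])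
    show "\<forall>g\<in>set ?gs. ptime (Suc (2 + 2)) UNIV g"
      by (auto intro!: ptime_drop_const ptime_arg ptime_if pdec_hd ptime_append ptime_const)
    show "step ws b st = map (\<lambda>g. g ([b] # st @ ws)) ?gs" if "length st = 2" for ws b st
      using that by (auto simp: step_def nth_append)
    fix ws :: "word list" and i l assume ws: "length ws = 2" "wbnd l ws"
    then have "length (ws ! 0) \<le> l" "length (ws ! 1) \<le> l" by (auto intro: arg_bnd)
    then show "wbnd l (fold (step ws) (take i (ws ! 0)) (map (\<lambda>f. f ws) [\<lambda>ws. ws ! 1, \<lambda>ws. []]))"
      by (auto simp: eq wbnd_def samples_def)
  qed (auto intro!: ptime_arg ptime_nil polyb_intros)
  then have "ptime 2 UNIV (\<lambda>ws. samples n (length (ws ! 0)) (ws ! 1))" by (simp add: eq)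
  from ptime_comp2[OF this assms] show ?thesis by simp
qed

section \<open>Answering the queries of the given program\<close>

locale reduction =
  fixes n j :: nat and V :: com and pV :: "nat poly"
  assumes n2: "2 \<le> n" and jn: "j < n"
    and V: "\<And>w u. halts_within no_oracle V [w, u] (poly pV (length w + length u))"
begin

definition accepts :: "word \<Rightarrow> word \<Rightarrow> bool" where
  "accepts w v \<longleftrightarrow> result no_oracle V [w, strip v] = [True]"

lemma pdec_accepts:
  assumes "ptime a D f" "ptime a D g"
  shows "pdec a D (\<lambda>ws. accepts (f ws) (g ws))"
proof -
  have "ptime 2 UNIV (\<lambda>ws. result no_oracle V ws)"
  proof (rule ptimeI[where c = V and P = "\<lambda>l. poly pV (l + l)"])
    fix ws :: "word list" and l assume ws: "length ws = 2" "wbnd l ws"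
    then obtain w u where wu: "ws = [w, u]" by (auto simp: numeral_2_eq_2 length_Suc_conv)
    obtain t s where t: "exec no_oracle V (init [w, u]) t s" "t \<le> poly pV (length w + length u)"
      using V unfolding halts_within_def by blast
    have "poly pV (length w + length u) \<le> poly pV (l + l)"
      by (rule poly_mono_nat) (use ws wu in \<open>auto simp: wbnd_def\<close>)
    then show "\<exists>t s. exec no_oracle V (init ws) t s \<and> s 0 = result no_oracle V ws \<and> t \<le> poly pV (l + l)"
      using t result_eq[OF t(1)] unfolding wu by (metis order_trans)
  qed (intro polyb_intros)
  from ptime_comp2[OF this assms(1) ptime_strip[OF assms(2)]]
  have "ptime a D (\<lambda>ws. result no_oracle V [f ws, strip (g ws)])" .
  then show ?thesis unfolding accepts_def by (rule pdec_eq_True)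
qed

definition num_items :: "word \<Rightarrow> nat" where "num_items tt = 3 * n * length tt"

text \<open>The value of agent \<open>j\<close> in unary, with \<open>kk\<close> and
  \<open>tt\<close> standing for \<open>k\<close> and \<open>T\<close>: three copies of the ones
  among the traps, which begin at \<open>m - T\<close>, that is \<open>(3 * n - 1) * T\<close>, and
  two copies of the ones in \<open>reg\<close>, or one of the capped values \<open>2 * k - 1\<close>
  and \<open>2 * k\<close>.\<close>

definition value_word :: "word \<Rightarrow> word \<Rightarrow> word \<Rightarrow> word \<Rightarrow> word" where
  "value_word w kk tt bs =
    (let a = filter id (take (j + length kk * n) bs); b = filter id (drop ((3 * n - 1) * length tt) bs)
     in b @ b @ b @ (if length a < length kk then a @ a
       else if length a = length kk \<and> \<not> accepts w (samples n (length kk) (drop (j + 1) bs))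
         then tl (kk @ kk) else kk @ kk))"

text \<open>The arguments are the query, \<open>w\<close>, and \<open>k\<close> and \<open>T\<close>
  in unary. The last three determine the instance and are the parameters in
  \<open>ptime_result\<close>. Tag \<open>True\<close> always yields \<open>[True]\<close>, as
  nothing is constrained.\<close>

definition answer :: "word list \<Rightarrow> word" where
  "answer v = (let i = takeWhile (\<lambda>b. b = True) (tl (v ! 0));
       bs = tl (dropWhile (\<lambda>b. b = True) (tl (v ! 0)))
     in if v ! 0 = [] then []
       else if length i < n \<and> length bs = num_items (v ! 3)
         then if v ! 0 \<noteq> [] \<and> hd (v ! 0) then [True]
           else if length i = j then code (length (value_word (v ! 1) (v ! 2) (v ! 3) bs))
             else code (tails_length bs)
         else [])"

lemma ptime_num_items:
  assumes "ptime a D f"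
  shows "ptime a D (\<lambda>ws. replicate (num_items (f ws)) True)"
  using ptime_mult[OF ptime_const[of a D "replicate (3 * n) True"] assms] by (simp add: num_items_def)

lemma ptime_value_word:
  assumes "ptime a D w" "ptime a D kk" "ptime a D tt" "ptime a D bs"
  shows "ptime a D (\<lambda>ws. value_word (w ws) (kk ws) (tt ws) (bs ws))"
proof -
  have sub: "ptime a {ws \<in> D. P ws} f" if "ptime a D f" for P f
    using ptime_subset[OF that] by auto
  have 1: "ptime a D (\<lambda>ws. take (j + length (kk ws) * n) (bs ws))"
    using ptime_take_length[OF ptime_append[OF ptime_const[of a D "replicate j True"]
      ptime_mult[OF assms(2) ptime_const[of a D "replicate n True"]]] assms(4)] by simp
  have 2: "ptime a D (\<lambda>ws. drop ((3 * n - 1) * length (tt ws)) (bs ws))"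
    using ptime_drop_length[OF ptime_mult[OF ptime_const[of a D "replicate (3 * n - 1) True"] assms(3)] assms(4)]
    by simp
  show ?thesis
    unfolding value_word_def Let_def
    by (intro ptime_append ptime_filter_True 2 ptime_if pdec_length_less pdec_length_eq pdec_conj pdec_not
        pdec_accepts ptime_samples ptime_tl ptime_drop_const sub 1 assms)
qed

lemma ptime_answer: "ptime 4 UNIV answer"
proof -
  have 1: "ptime a D (\<lambda>ws. code (tails_length (f ws)))" if "ptime a D f"
    for a D and f :: "word list \<Rightarrow> word"
    using ptime_code[OF ptime_tails_length[OF that]] by simp
  have 2: "pdec a D (\<lambda>ws. length (f ws) < n)" "pdec a D (\<lambda>ws. length (f ws) = j)"
    if "ptime a D f" for a D and f :: "word list \<Rightarrow> word"
    using pdec_length_less[OF that ptime_const[of a D "replicate n True"]]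
      pdec_length_eq[OF that ptime_const[of a D "replicate j True"]] by simp_all
  have 3: "pdec a D (\<lambda>ws. length (f ws) = num_items (g ws))"
    if "ptime a D f" "ptime a D g" for a D and f g :: "word list \<Rightarrow> word"
    using pdec_length_eq[OF that(1) ptime_num_items[OF that(2)]] by simp
  show ?thesis
    unfolding answer_def[abs_def] Let_def
    by (intro ptime_if 1 2 3 pdec_null pdec_conj pdec_hd ptime_code ptime_value_word ptime_takeWhile ptime_tl
        ptime_dropWhile ptime_const ptime_arg) simp_all
qed

lemma length_value_word_le: "length (value_word w kk tt bs) \<le> 3 * length bs + 2 * length kk"
proof -
  have "length (filter id (drop i bs)) \<le> length bs" for i
    using length_filter_le[of id "drop i bs"] by simp
  from this[of "(3 * n - 1) * length tt"] show ?thesis unfolding value_word_def Let_def by auto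
qed

text \<open>\<open>m * m\<close> bounds the additive objectives, \<open>3 * m + 2 * k\<close> bounds
  that of agent \<open>j\<close>, and the code of \<open>v\<close> has at most
  \<open>2 * v + 2\<close> bits.\<close>

definition answer_bound :: "nat \<Rightarrow> nat" where
  "answer_bound l = (let m = 3 * n * l in 2 * (m * m + 3 * m + 2 * l) + 2)"

lemma polyb_answer_bound: "polyb answer_bound"
  unfolding answer_bound_def[abs_def] Let_def by (intro polyb_intros)

lemma length_code_bound:
  assumes "v \<le> m * m + 3 * m + 2 * k" "m \<le> 3 * n * l" "k \<le> l"
  shows "length (code v) \<le> answer_bound l"
proof -
  have "length (code v) \<le> 2 * (m * m + 3 * m + 2 * k) + 2"
    using length_code_le[of v] assms(1) by simp
  also have "\<dots> \<le> answer_bound l"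
    unfolding answer_bound_def Let_def using assms(2,3)
    by (intro add_mono mult_le_mono order_refl)
  finally show ?thesis .
qed

lemma length_answer_le:
  assumes "length zs = 3" "wbnd l zs"
  shows "length (answer (q # zs)) \<le> answer_bound l"
proof -
  have l: "length (zs ! 1) \<le> l" "length (zs ! 2) \<le> l" using assms by (auto intro: arg_bnd)
  have items: "num_items (zs ! 2) \<le> 3 * n * l" unfolding num_items_def using l by (intro mult_le_mono) auto
  have "length (code (length (value_word w (zs ! 1) (zs ! 2) bs))) \<le> answer_bound l"
    "length (code (tails_length bs)) \<le> answer_bound l"
    if "length bs = num_items (zs ! 2)" for w bs
    using length_value_word_le[of w "zs ! 1" "zs ! 2" bs] tails_length_le[of bs] that
    by (auto intro!: length_code_bound[OF _ items l(1)])
  moreover have "1 \<le> answer_bound l" by (simp add: answer_bound_def Let_def)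
  ultimately show ?thesis by (simp add: answer_def Let_def numeral_3_eq_3 numeral_2_eq_2)
qed

end

section \<open>Simulating the protocol\<close>

text \<open>\<open>choice_code\<close> without its final \<open>False\<close>. This is what remains
  of a program's output when it is cut at the first \<open>False\<close>.\<close>

definition encode_choice :: "nat option \<Rightarrow> word" where
  "encode_choice ch = (case ch of None \<Rightarrow> [] | Some x \<Rightarrow> replicate (Suc x) True)"

lemma encode_choice_of_word: "encode_choice (choice_of_word u) = takeWhile (\<lambda>b. b = True) u"
proof -
  have "replicate (length (takeWhile (\<lambda>b. b = True) u)) True = takeWhile (\<lambda>b. b = True) u"
    by (rule replicate_length_same) (auto dest: set_takeWhileD)
  moreover have "takeWhile id u = takeWhile (\<lambda>b. b = True) u" by (rule takeWhile_cong) auto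
  ultimately show ?thesis
    by (cases "length (takeWhile id u)") (auto simp: encode_choice_def choice_of_word_def)
qed

text \<open>The number of the least available item is the number of leading \<open>False\<close>
  bits in the availability vector; the additional \<open>True\<close> is the offset of
  \<open>encode_choice\<close>.\<close>

lemma encode_first:
  assumes "finite A"
  shows "(if dropWhile (\<lambda>b. b = False) (map (\<lambda>x. x \<in> A \<inter> {..<m}) [0..<m]) = [] then []
      else True # replicate (length (takeWhile (\<lambda>b. b = False) (map (\<lambda>x. x \<in> A \<inter> {..<m}) [0..<m]))) True) =
    encode_choice (if A \<inter> {..<m} = {} then None else Some (Min (A \<inter> {..<m})))"
proof (cases "A \<inter> {..<m} = {}")
  case True
  then show ?thesis by (auto simp: encode_choice_def dropWhile_eq_Nil_conv)
next
  case False
  let ?B = "A \<inter> {..<m}" and ?l = "map (\<lambda>x. x \<in> A \<inter> {..<m}) [0..<m]"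
  have fin: "finite ?B" by simp
  have min: "Min ?B \<in> ?B" using Min_in[OF fin False] .
  then have l: "?l = replicate (Min ?B) False @ True # drop (Suc (Min ?B)) ?l"
  proof -
    have "?l ! i = False" if "i < Min ?B" for i
    proof -
      have "i \<notin> ?B" using that Min_le[OF fin, of i] by (meson leD)
      then show ?thesis using that min by simp
    qed
    then have "take (Min ?B) ?l = replicate (Min ?B) False"
      using min by (intro nth_equalityI) auto
    moreover have "?l = take (Min ?B) ?l @ ?l ! Min ?B # drop (Suc (Min ?B)) ?l"
      using min by (intro id_take_nth_drop) simp
    moreover have "?l ! Min ?B = True" using min by auto
    ultimately show ?thesis by metis
  qed
  have "takeWhile (\<lambda>b. b = False) ?l = replicate (Min ?B) False" "dropWhile (\<lambda>b. b = False) ?l \<noteq> []"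
    by (subst l, simp add: takeWhile_append dropWhile_append)+
  then show ?thesis using False by (simp add: encode_choice_def)
qed

lemma update_bits:
  assumes "x < m"
  shows "take x (map (\<lambda>y. y \<in> A) [0..<m]) @ b # tl (drop x (map (\<lambda>y. y \<in> A) [0..<m])) =
    map (\<lambda>y. if y = x then b else y \<in> A) [0..<m]"
proof -
  have "take x (map (\<lambda>y. y \<in> A) [0..<m]) @ b # tl (drop x (map (\<lambda>y. y \<in> A) [0..<m])) =
      (map (\<lambda>y. y \<in> A) [0..<m])[x := b]"
    using assms by (simp add: upd_conv_take_nth_drop tl_drop drop_Suc)
  also have "\<dots> = map (\<lambda>y. if y = x then b else y \<in> A) [0..<m]"
    by (rule nth_equalityI) (auto simp: nth_list_update)
  finally show ?thesis .
qed

lemma ptime_repeat: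
  assumes "ptime a D f"
  shows "ptime a D (\<lambda>ws. concat (replicate (length (f ws)) u))"
proof -
  have eq: "fold (\<lambda>b s. u @ (([b] # s # ws) ! 1)) xs s = concat (replicate (length xs) u) @ s"
    for xs s and ws :: "word list"
  proof (induction xs arbitrary: s)
    case (Cons b xs)
    have "concat (replicate i u) @ u = u @ concat (replicate i u)" for i by (induction i) auto
    then show ?case using Cons by (simp flip: append_assoc)
  qed simp
  have len: "length (concat (replicate i u)) = i * length u" for i by (induction i) auto
  have "ptime 1 UNIV (\<lambda>ws. fold (\<lambda>b s. u @ (([b] # s # ws) ! 1)) (ws ! 0) [])"
  proof (rule ptime_fold1[where q = "\<lambda>l. l * length u"])
    show "length (fold (\<lambda>b s. u @ (([b] # s # ws) ! 1)) (take i (ws ! 0)) []) \<le> l * length u"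
      if "length ws = 1" "wbnd l ws" for ws i l
      unfolding eq using that arg_bnd[of l ws 0] by (simp add: len mult_le_mono1 min.coboundedI1)
  qed (auto intro!: ptime_append ptime_const ptime_arg polyb_intros)
  from ptime_comp1[OF this[unfolded eq] assms] show ?thesis by simp
qed

text \<open>The simulation is a fold over a word with one bit per turn, set when agent
  \<open>j\<close> moves. Since \<open>n\<close> is a constant, this word arises by repeating a
  fixed one, without any division.\<close>

lemma periodic_pattern:
  "concat (replicate r (map (\<lambda>i. i = j) [0..<n])) = map (\<lambda>q. q mod n = j) [0..<r * n]"
proof (induction r)
  case (Suc r)
  have "[0..<Suc r * n] = [0..<r * n] @ map (\<lambda>i. i + r * n) [0..<n]"
    using upt_add_eq_append[of 0 "r * n" n] by (simp add: map_add_upt add.commute)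
  moreover have "map (\<lambda>i. (i + r * n) mod n = j) [0..<n] = map (\<lambda>i. i = j) [0..<n]" by simp
  moreover have "concat (replicate (Suc r) u) = concat (replicate r u) @ u" for u :: word
    by (induction r) auto
  ultimately show ?case using Suc by (simp only: map_append map_map comp_def)
qed simp

lemma halts_within_mono: "halts_within orc c ws t \<Longrightarrow> t \<le> t' \<Longrightarrow> halts_within orc c ws t'"
  unfolding halts_within_def using order_trans by blast

section \<open>The instances built from a word\<close>

context reduction
begin

abbreviation market :: "word \<Rightarrow> word \<Rightarrow> word \<Rightarrow> rr_instance" where
  "market w kk tt \<equiv> hard_instance.inst n j (length kk) (length tt) (accepts w)"

lemma hard_instance: "kk \<noteq> [] \<Longrightarrow> hard_instance n j (length kk)"
  by unfold_locales (use n2 jn in \<open>auto simp: Suc_le_eq\<close>)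

lemma num_items_eq: "kk \<noteq> [] \<Longrightarrow> hard_instance.m n (length tt) = num_items tt"
  using hard_instance.m_def[OF hard_instance] by (simp add: num_items_def)

lemma decode_support:
  "kk \<noteq> [] \<Longrightarrow> hard_instance.decode n j (length kk) (support bs) = samples n (length kk) (drop (j + 1) bs)"
  unfolding hard_instance.decode_def[OF hard_instance] samples_def
  by (rule map_cong) (auto simp: support_def hd_drop_conv_nth ac_simps)

lemma value_word_eq:
  assumes "kk \<noteq> []" "length bs = num_items tt"
  shows "length (value_word w kk tt bs) = hard_instance.fj n j (length kk) (length tt) (accepts w) (support bs)"
proof -
  interpret hard_instance n j "length kk" "length tt" "accepts w" by (rule hard_instance[OF assms(1)])
  have m: "m = num_items tt" by (simp add: m_def num_items_def)
  have d: "m - length tt = (3 * n - 1) * length tt" by (simp add: m_def diff_mult_distrib)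
  have "support bs \<subseteq> {..<m}" using assms(2) by (auto simp: support_def m)
  then have "support bs \<inter> traps = support bs \<inter> {(3 * n - 1) * length tt..}"
    unfolding traps_def d by auto
  then have "card (support bs \<inter> traps) = length (filter id (drop ((3 * n - 1) * length tt) bs))"
    by (simp add: card_support_drop)
  moreover have "card (support bs \<inter> reg) = length (filter id (take (j + length kk * n) bs))"
    unfolding reg_def support_take card_support ..
  moreover have "2 * length kk - 1 = length (tl (kk @ kk))" by simp
  ultimately show ?thesis
    unfolding fj_def hval_def value_word_def Let_def decode_support[OF assms(1)] by auto
qed

lemma query_answer_eq:
  assumes "kk \<noteq> []"
  shows "query_answer (market w kk tt) q = answer [q, w, kk, tt]"
proof (cases q)
  case Nil
  then show ?thesis by (simp add: answer_def)
next
  case (Cons tag r)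
  interpret hard_instance n j "length kk" "length tt" "accepts w" by (rule hard_instance[OF assms])
  have m: "m = num_items tt" by (simp add: m_def num_items_def)
  have id: "id = (\<lambda>b. b = True)" by auto
  define i where "i = length (takeWhile (\<lambda>b. b = True) r)"
  define bs where "bs = drop (Suc i) r"
  have bs: "bs = tl (dropWhile (\<lambda>b. b = True) r)"
    by (simp only: bs_def i_def dropWhile_eq_drop drop_Suc tl_drop)
  have S: "{x. x < length bs \<and> bs ! x} = support bs" by (simp add: support_def)
  have sub: "support bs \<subseteq> {..<m}" if "length bs = num_items tt" using that by (auto simp: support_def m)
  have wt: "wt (support bs) = tails_length bs" if "length bs = num_items tt"
    using that by (simp add: wt_def tails_length_eq m)
  have "query_answer inst q = (if i < n \<and> length bs = num_items tt
      then (if tag then [support bs \<in> indep inst i] else value_code (obj inst i (support bs))) else [])"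
    unfolding Cons query_answer.simps Let_def id i_def[symmetric] bs_def[symmetric] S by (simp add: m)
  also have "\<dots> = (if i < n \<and> length bs = num_items tt
      then (if tag then [True] else if i = j then code (length (value_word w kk tt bs)) else code (tails_length bs)) else [])"
    using sub wt value_word_eq[OF assms, of bs tt w] by (auto simp: value_code_nat)
  also have "\<dots> = answer [q, w, kk, tt]"
    unfolding answer_def Let_def Cons by (simp add: i_def bs)
  finally show ?thesis .
qed

definition size_bound :: "nat \<Rightarrow> nat" where
  "size_bound l = n + 3 * n * l + answer_bound l"

text \<open>Turns the time bound of the given program, a polynomial in \<open>instance_size\<close>,
  into a polynomial in the lengths of \<open>kk\<close> and \<open>tt\<close>, with \<open>n\<close>
  constant.\<close>

lemma instance_size_le:
  assumes "kk \<noteq> []" "length kk \<le> l" "length tt \<le> l"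
  shows "instance_size (market w kk tt) \<le> size_bound l"
proof -
  interpret hard_instance n j "length kk" "length tt" "accepts w" by (rule hard_instance[OF assms(1)])
  let ?C = "{length (value_code (obj inst i S)) | i S. i < agents inst \<and> S \<subseteq> item_set inst}"
  have m: "m \<le> 3 * n * l" unfolding m_def using assms(3) by (intro mult_le_mono) auto
  have "?C = (\<lambda>(i, S). length (value_code (obj inst i S))) ` ({..<n} \<times> Pow {..<m})" by auto
  then have fin: "finite ?C" by simp
  have "Max ?C \<le> answer_bound l"
  proof (rule Max.boundedI[OF fin])
    have "length (value_code (obj inst 0 {})) \<in> ?C"
      using n2 by (intro CollectI exI[of _ 0] exI[of _ "{}"]) simp
    then show "?C \<noteq> {}" by blast
    fix a assume "a \<in> ?C"
    then obtain i S where a: "a = length (value_code (obj inst i S))" and S: "S \<subseteq> {..<m}" by auto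
    have finS: "finite S" using S finite_subset by blast
    have cS: "card S \<le> m" using card_mono[OF _ S] by simp
    define v where "v = (if i = j then fj S else wt S)"
    have "fj S \<le> 3 * m + 2 * length kk"
    proof -
      have "card (S \<inter> traps) \<le> m" using card_mono[OF finS, of "S \<inter> traps"] cS by simp
      moreover have "hval S \<le> 2 * length kk" by (simp add: hval_def)
      ultimately show ?thesis by (simp add: fj_def)
    qed
    moreover have "wt S \<le> m * m"
    proof -
      have "wt S \<le> card S * m" unfolding wt_def by (rule sum_bounded_above[of S _ m, simplified]) simp
      also have "\<dots> \<le> m * m" using cS by simp
      finally show ?thesis .
    qed
    ultimately have "v \<le> m * m + 3 * m + 2 * length kk" by (simp add: v_def)
    from length_code_bound[OF this m assms(2)] show "a \<le> answer_bound l"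
      unfolding a by (cases "i = j") (simp_all add: v_def value_code_nat)
  qed
  then show ?thesis using m by (simp add: instance_size_def size_bound_def)
qed

end

section \<open>Turn-by-turn simulation of the given program\<close>

locale reduction_run = reduction +
  fixes tb :: tie_rule and c :: com and p :: "nat poly"
  assumes tb: "tie_breaking tb"
    and halts: "\<And>I k. I \<in> instances_with_additive_others n j \<Longrightarrow> k < turns I \<Longrightarrow> k mod agents I = j \<Longrightarrow>
      halts_within (query_answer I) c
        (input_code I (play I ((greedy tb I)(j := program_policy c I)) k)) (poly p (instance_size I))"
begin

text \<open>All agents other than \<open>j\<close> behave alike, so the single bit \<open>b\<close>
  is all that has to be known about the mover; only for agent \<open>j\<close> is the program
  run.\<close>

definition choice_word :: "word list \<Rightarrow> bool \<Rightarrow> word list \<Rightarrow> word" where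
  "choice_word ws b st = (if b
     then takeWhile (\<lambda>b. b = True) (result (\<lambda>q. answer (q # ws)) c
       [replicate n True, replicate (num_items (ws ! 2)) True, st ! 0])
     else if dropWhile (\<lambda>b. b = False) (st ! 1) = [] then []
     else True # replicate (length (takeWhile (\<lambda>b. b = False) (st ! 1))) True)"

definition play_step :: "word list \<Rightarrow> bool \<Rightarrow> word list \<Rightarrow> word list" where
  "play_step ws b st =
    (let cw = choice_word ws b st; d = drop (length (tl cw)) (st ! 1); v = (cw \<noteq> [] \<and> d \<noteq> [] \<and> hd d)
     in [st ! 0 @ (if v then cw else []) @ [False],
         if v then take (length (tl cw)) (st ! 1) @ False # tl d else st ! 1,
         if v \<and> b then take (length (tl cw)) (st ! 2) @ True # tl (drop (length (tl cw)) (st ! 2)) else st ! 2])"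

definition play_start :: "word list \<Rightarrow> word list" where
  "play_start ws = [[], replicate (num_items (ws ! 2)) True, replicate (num_items (ws ! 2)) False]"

definition turn_pattern :: "word list \<Rightarrow> word" where
  "turn_pattern ws = map (\<lambda>q. q mod n = j) [0..<num_items (ws ! 2)]"

context
  fixes w kk tt :: word
  assumes kk: "kk \<noteq> []"
begin

interpretation hard_play n j "length kk" "length tt" "accepts w" tb "program_policy c (market w kk tt)"
  by (intro hard_play.intro hard_instance[OF kk]) (unfold_locales, rule tb)

abbreviation (input) "ws0 \<equiv> [w, kk, tt]"

definition state :: "nat \<Rightarrow> word list" where
  "state q = [concat (map choice_code (h q)), map (\<lambda>x. x \<in> av q) [0..<m], map (\<lambda>x. x \<in> ow q) [0..<m]]"

lemma m_eq: "m = num_items tt" by (simp add: m_def num_items_def)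

lemma choice_word_state:
  "\<exists>ch. choice_word ws0 (q mod n = j) (state q) = encode_choice ch \<and> pick q = legal inst (h q) ch"
proof (cases "q mod n = j")
  case True
  have "query_answer inst = (\<lambda>q. answer (q # ws0))" using query_answer_eq[OF kk] by auto
  moreover have "input_code inst (h q) = [replicate n True, replicate (num_items tt) True, state q ! 0]"
    by (simp add: input_code_def state_def m_eq)
  moreover have "program_policy c inst (h q) =
      choice_of_word (result (query_answer inst) c (input_code inst (h q)))"
    by (rule program_policy_def)
  ultimately have "encode_choice (program_policy c inst (h q)) =
      takeWhile (\<lambda>b. b = True) (result (\<lambda>q. answer (q # ws0)) c
        [replicate n True, replicate (num_items tt) True, state q ! 0])"
    by (simp only: encode_choice_of_word)
  then have "choice_word ws0 True (state q) = encode_choice (program_policy c inst (h q))"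
    by (simp add: choice_word_def numeral_2_eq_2)
  then show ?thesis using True by (auto simp: pick_def)
next
  case False
  let ?ch = "if av q = {} then None else Some (Min (av q))"
  have av: "av q \<inter> {..<m} = av q" "finite (av q)" by (auto simp: av_eq)
  have "choice_word ws0 False (state q) = encode_choice ?ch"
  proof -
    have "state q ! 1 = map (\<lambda>x. x \<in> av q) [0..<m]" by (simp add: state_def)
    then show ?thesis
      using encode_first[OF av(2), of m] by (simp only: av(1) choice_word_def if_False)
  qed
  moreover have "pick q = legal inst (h q) ?ch"
  proof (cases "av q = {}")
    case True
    then have "pick q = None" using pick_av[of q] by (cases "pick q") auto
    then show ?thesis using True by (simp add: legal_def)
  next
    case ne: False
    then show ?thesis
      using greedy_other[OF False ne] Min_in[OF av(2) ne] by (simp add: legal_def av_def)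
  qed
  ultimately show ?thesis using False by auto
qed

lemma play_step_state: "play_step ws0 (q mod n = j) (state q) = state (Suc q)"
proof -
  obtain ch where ch: "choice_word ws0 (q mod n = j) (state q) = encode_choice ch"
    "pick q = legal inst (h q) ch" using choice_word_state by blast
  have av_lt: "x < m" if "x \<in> av q" for x using that by (simp add: av_eq)
  show ?thesis
  proof (cases "pick q")
    case None
    let ?d = "drop (length (tl (encode_choice ch))) (state q ! 1)"
    have "\<not> (encode_choice ch \<noteq> [] \<and> ?d \<noteq> [] \<and> hd ?d)"
      using None ch(2) by (auto simp: encode_choice_def legal_def state_def hd_drop_conv_nth
          av_def[symmetric] split: option.splits if_splits)
    then have invalid: "(encode_choice ch \<noteq> [] \<and> ?d \<noteq> [] \<and> hd ?d) = False" by blast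
    have "state (Suc q) = [state q ! 0 @ [False], state q ! 1, state q ! 2]"
      using None by (simp add: state_def h_Suc choice_code_def ow_Suc av_eq taken_Suc)
    then show ?thesis unfolding play_step_def ch(1) Let_def invalid by simp
  next
    case (Some x)
    then have x: "ch = Some x" "x \<in> av q"
      using ch(2) pick_av by (auto simp: legal_def split: option.splits if_splits)
    have e: "encode_choice ch = replicate (Suc x) True" "tl (encode_choice ch) = replicate x True"
      by (simp_all add: x(1) encode_choice_def)
    have valid: "drop x (map (\<lambda>x. x \<in> av q) [0..<m]) \<noteq> []" "hd (drop x (map (\<lambda>x. x \<in> av q) [0..<m]))"
      using x(2) av_lt[OF x(2)] by (simp_all add: hd_drop_conv_nth)
    have 1: "map (\<lambda>y. if y = x then False else y \<in> av q) [0..<m] = map (\<lambda>y. y \<in> av (Suc q)) [0..<m]"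
      using Some by (auto simp: av_eq taken_Suc)
    have 2: "map (\<lambda>y. if y = x then True else y \<in> ow q) [0..<m] = map (\<lambda>y. y \<in> ow (Suc q)) [0..<m]"
      if "q mod n = j" using Some that by (auto simp: ow_Suc)
    have 3: "ow (Suc q) = ow q" if "q mod n \<noteq> j" using that by (simp add: ow_Suc)
    show ?thesis
      unfolding play_step_def ch(1) Let_def e
      using valid update_bits[OF av_lt[OF x(2)]] 1 2 3 Some
      by (simp add: state_def h_Suc choice_code_def)
  qed
qed

lemma fold_play_step:
  "fold (play_step ws0) (map (\<lambda>q. q mod n = j) [0..<q]) (play_start ws0) = state q"
proof (induction q)
  case 0
  have "state 0 = play_start ws0"
    by (auto simp: state_def play_start_def h_0 av_eq taken_def ow_eq m_eq[symmetric] numeral_2_eq_2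
        intro!: nth_equalityI)
  then show ?case by simp
next
  case (Suc q)
  then show ?case by (simp add: play_step_state)
qed

text \<open>The length bound for the recursion: a history has at most \<open>m\<close> choices with
  codes of length at most \<open>m + 1\<close>, and the two vectors have length
  \<open>m\<close>.\<close>

lemma state_wbnd:
  assumes "length tt \<le> l" "q \<le> num_items tt"
  shows "wbnd (3 * n * l * (3 * n * l + 1) + 3 * n * l) (state q)"
proof -
  have m: "m \<le> 3 * n * l" unfolding m_def using assms(1) by (intro mult_le_mono) auto
  have choice: "length (choice_code ch) \<le> m + 1" if "ch \<in> set (h q)" for ch
  proof (cases ch)
    case (Some x)
    then have "x \<in> taken q" using that by (simp add: taken_def)
    then show ?thesis using taken_sub Some by (fastforce simp: choice_code_def)
  qed (simp add: choice_code_def)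
  then have "length (concat (map choice_code hs)) \<le> length hs * (m + 1)" if "set hs \<subseteq> set (h q)" for hs
    using that
  proof (induction hs)
    case (Cons a hs)
    have "length (choice_code a) \<le> m + 1" using Cons.prems by (intro choice) simp
    moreover have "length (concat (map choice_code hs)) \<le> length hs * (m + 1)" using Cons by simp
    ultimately show ?case by simp
  qed simp
  from this[of "h q"] have "length (concat (map choice_code (h q))) \<le> q * (m + 1)" by simp
  also have "\<dots> \<le> 3 * n * l * (3 * n * l + 1)"
    using assms(2) m m_eq by (intro mult_le_mono) auto
  finally have 1: "length (concat (map choice_code (h q))) \<le> 3 * n * l * (3 * n * l + 1)" .
  obtain X where X: "X = 3 * n * l * (3 * n * l + 1) + 3 * n * l" by blast
  have "length (concat (map choice_code (h q))) \<le> X" "m \<le> X"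
    unfolding X by (rule trans_le_add1[OF 1], rule trans_le_add2[OF m])
  then show ?thesis unfolding X[symmetric] by (simp add: wbnd_def state_def)
qed

text \<open>The simulated states carry genuine histories of the play, and on these the given program
  is known to halt in time.\<close>

lemma halts_state:
  assumes "q < num_items tt" "q mod n = j" "length kk \<le> l" "length tt \<le> l"
  shows "halts_within (\<lambda>q. answer (q # ws0)) c
    [replicate n True, replicate (num_items tt) True, state q ! 0] (poly p (size_bound l))"
proof -
  have "query_answer inst = (\<lambda>q. answer (q # ws0))" using query_answer_eq[OF kk] by auto
  moreover have "input_code inst (h q) = [replicate n True, replicate (num_items tt) True, state q ! 0]"
    by (simp add: input_code_def state_def m_eq)
  ultimately show ?thesis
    using halts[OF inst_in_class, of q] assms instance_size_le[OF kk assms(3,4), of w]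
    by (auto simp: turns_inst m_eq h_def intro: halts_within_mono poly_mono_nat)
qed

lemma final_state:
  "samples n (length kk) (drop (j + 1) (state m ! 2)) =
    decode (outcome inst ((greedy tb inst)(j := program_policy c inst)) j)"
proof -
  have "support (state m ! 2) = ow m" using ow_sub_items[of m] by (auto simp: support_def state_def)
  then show ?thesis unfolding outcome_eq decode_support[OF kk, symmetric] by simp
qed

end

text \<open>The seven words are the bit telling whether agent \<open>j\<close> moves, the three
  state words and the three parameters. The domain promises halting for the turns of agent
  \<open>j\<close> only, with a bound that depends just on the lengths of \<open>kk\<close> and
  \<open>tt\<close>.\<close>

lemma ptime_choice_word:
  "ptime 7 {v. v ! 0 = [True] \<longrightarrow> (\<forall>l. length (v ! 5) \<le> l \<longrightarrow> length (v ! 6) \<le> l \<longrightarrow>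
      halts_within (\<lambda>q. answer (q # drop 4 v)) c
        [replicate n True, replicate (num_items (v ! 6)) True, v ! 1] (poly p (size_bound l)))}
    (\<lambda>v. choice_word (drop 4 v) (v ! 0 = [True]) (take 3 (drop 1 v)))" (is "ptime 7 ?E _")
proof -
  let ?D = "{u. length u = 6 \<and> (\<forall>l. wbnd l u \<longrightarrow>
      halts_within (\<lambda>q. answer (q # drop 3 u)) c (take 3 u) (poly p (size_bound l)))}"
  let ?args = "[\<lambda>v :: word list. replicate n True, \<lambda>v. replicate (num_items (v ! 6)) True, \<lambda>v. v ! 1,
    \<lambda>v. v ! 4, \<lambda>v. v ! 5, \<lambda>v. v ! 6]"
  \<comment> \<open>Three input words of the given program, followed by the three parameters from
    which its queries are answered.\<close>
  have "ptime (3 + 3) ?D (\<lambda>u. result (\<lambda>q. answer (q # drop 3 u)) c (take 3 u))"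
  proof (rule ptime_result[where B = answer_bound and T = "\<lambda>l. poly p (size_bound l)"])
    show "ptime (Suc 3) UNIV answer" using ptime_answer by simp
    show "polyb (\<lambda>l. poly p (size_bound l))"
      unfolding size_bound_def by (intro polyb_intros polyb_answer_bound)
  qed (use length_answer_le polyb_answer_bound in auto)
  then have run: "ptime 6 ?D (\<lambda>u. result (\<lambda>q. answer (q # drop 3 u)) c (take 3 u))" by simp
  have drop4: "drop 4 v = [v ! 4, v ! 5, v ! 6]" if "length v = 7" for v :: "word list"
    by (rule nth_equalityI) (use that in \<open>auto simp: less_Suc_eq numeral_eq_Suc\<close>)
  have "ptime 7 {v \<in> ?E. v ! 0 = [True]} (\<lambda>v. (\<lambda>u. result (\<lambda>q. answer (q # drop 3 u)) c (take 3 u))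
      (map (\<lambda>g. g v) ?args))"
  proof (rule ptime_comp[OF run])
    show "\<forall>g\<in>set ?args. ptime 7 {v \<in> ?E. v ! 0 = [True]} g"
      by (auto intro!: ptime_const ptime_num_items ptime_arg)
    show "map (\<lambda>g. g v) ?args \<in> ?D" if "v \<in> {v \<in> ?E. v ! 0 = [True]}" "length v = 7" for v
      using that by (simp add: drop4 wbnd_def numeral_3_eq_3)
  qed simp
  then have run': "ptime 7 {v \<in> ?E. v ! 0 = [True]} (\<lambda>v. result (\<lambda>q. answer (q # drop 4 v)) c
      [replicate n True, replicate (num_items (v ! 6)) True, v ! 1])"
    by (rule ptime_cong) (auto simp: drop4 numeral_3_eq_3)
  have bit: "pdec 7 D (\<lambda>v. v ! 0 = [True])" for D
    by (intro pdec_eq_True ptime_arg) simp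
  have "ptime 7 ?E (\<lambda>v. if v ! 0 = [True]
      then takeWhile (\<lambda>b. b = True) (result (\<lambda>q. answer (q # drop 4 v)) c
        [replicate n True, replicate (num_items (v ! 6)) True, v ! 1])
      else if dropWhile (\<lambda>b. b = False) (v ! 2) = [] then []
      else True # replicate (length (takeWhile (\<lambda>b. b = False) (v ! 2))) True)"
    by (intro ptime_if bit ptime_takeWhile run' pdec_null ptime_dropWhile ptime_const ptime_Cons
        ptime_unary ptime_arg) simp_all
  then show ?thesis
    by (rule ptime_cong) (auto simp: choice_word_def drop4 numeral_2_eq_2)
qed

end

section \<open>The reduction\<close>

context reduction_run
begin

text \<open>Both side conditions of the recursion follow from the fact that a partial fold is the
  state of a real play: the promise of halting by \<open>halts_state\<close>, the length bound by
  \<open>state_wbnd\<close>.\<close>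

lemma ptime_final_state:
  "ptime 3 {ws. ws ! 1 \<noteq> []} (\<lambda>ws. fold (play_step ws) (turn_pattern ws) (play_start ws) ! 2)"
proof -
  let ?E = "{v :: word list. v ! 0 = [True] \<longrightarrow> (\<forall>l. length (v ! 5) \<le> l \<longrightarrow> length (v ! 6) \<le> l \<longrightarrow>
      halts_within (\<lambda>q. answer (q # drop 4 v)) c
        [replicate n True, replicate (num_items (v ! 6)) True, v ! 1] (poly p (size_bound l)))}"
  let ?D = "{ws :: word list. ws ! 1 \<noteq> []}"
  define cw where "cw = (\<lambda>v. choice_word (drop 4 v) (v ! 0 = [True]) (take 3 (drop 1 v)))"
  let ?d = "\<lambda>v. drop (length (tl (cw v))) (v ! 2)"
  define valid where "valid = (\<lambda>v. cw v \<noteq> [] \<and> ?d v \<noteq> [] \<and> hd (?d v))"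
  let ?gs = "[\<lambda>v. v ! 1 @ (if valid v then cw v else []) @ [False],
    \<lambda>v. if valid v then take (length (tl (cw v))) (v ! 2) @ False # tl (?d v) else v ! 2,
    \<lambda>v. if valid v \<and> v ! 0 = [True]
      then take (length (tl (cw v))) (v ! 3) @ True # tl (drop (length (tl (cw v))) (v ! 3)) else v ! 3]"
  let ?ini = "[\<lambda>ws. [], \<lambda>ws. replicate (num_items (ws ! 2)) True, \<lambda>ws. replicate (num_items (ws ! 2)) False]"
  have cw: "ptime 7 {v \<in> ?E. P v} cw" for P
    unfolding cw_def by (rule ptime_subset[OF ptime_choice_word]) auto
  have cw': "ptime 7 ?E cw" unfolding cw_def by (rule ptime_choice_word)
  have bit: "pdec 7 D (\<lambda>v. v ! 0 = [True])" for D
    by (intro pdec_eq_True ptime_arg) simp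
  have ok: "pdec 7 ?E valid"
    unfolding valid_def
    by (intro pdec_conj pdec_not pdec_null cw' pdec_hd ptime_drop_length ptime_tl ptime_arg) simp_all
  have start: "map (\<lambda>f. f ws) ?ini = play_start ws" for ws by (simp add: play_start_def)
  have items_word: "ptime 3 ?D (\<lambda>ws. replicate (num_items (ws ! 2)) b)" for b
    using ptime_unary[OF ptime_num_items[OF ptime_arg[of 2 3 ?D]], of b] by simp
  have pattern: "ptime 3 ?D turn_pattern"
  proof -
    have "ptime 3 ?D (\<lambda>ws. concat (replicate (length (replicate (length (replicate 3 True) * length (ws ! 2)) True))
        (map (\<lambda>i. i = j) [0..<n])))"
      by (intro ptime_repeat ptime_mult ptime_const ptime_arg) simp
    then show ?thesis
      by (rule ptime_cong) (simp add: turn_pattern_def periodic_pattern num_items_def ac_simps)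
  qed
  have split: "\<exists>w kk tt. ws = [w, kk, tt] \<and> kk \<noteq> []" if "ws \<in> ?D" "length ws = 3" for ws
    using that by (auto simp: numeral_3_eq_3 length_Suc_conv)
  have run: "fold (play_step [w, kk, tt]) (take i (turn_pattern [w, kk, tt])) (play_start [w, kk, tt]) = state w kk tt i"
    if "kk \<noteq> []" "i \<le> num_items tt" for w kk tt i
    using fold_play_step[OF that(1), of w tt i] that(2)
    by (simp add: turn_pattern_def take_map numeral_2_eq_2)
  have "ptime 3 ?D (\<lambda>ws. fold (play_step ws) (turn_pattern ws) (map (\<lambda>f. f ws) ?ini) ! 2)"
  proof (rule ptime_fold_params[where gs = ?gs and k = 3 and E = ?E
        and q = "\<lambda>l. 3 * n * l * (3 * n * l + 1) + 3 * n * l"])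
    show "play_step ws b st = map (\<lambda>g. g ([b] # st @ ws)) ?gs" if "length ws = 3" "length st = 3" for ws b st
    proof -
      have "drop 4 ([b] # st @ ws) = ws" "take 3 (drop 1 ([b] # st @ ws)) = st" using that by simp_all
      then have "cw ([b] # st @ ws) = choice_word ws b st" by (simp add: cw_def)
      then show ?thesis using that by (cases b) (simp_all add: play_step_def Let_def nth_append valid_def)
    qed
    show "\<forall>g\<in>set ?gs. ptime (Suc (3 + 3)) ?E g"
    proof -
      have "pdec 7 ?E (\<lambda>v. valid v \<and> v ! 0 = [True])" by (intro pdec_conj ok bit)
      then have g: "ptime 7 ?E g" if "g \<in> set ?gs" for g
        using that unfolding list.set insert_iff empty_iff simp_thms
        by (elim disjE; hypsubst_thin; intro ptime_append ptime_if ok ptime_take_length ptime_drop_length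
          ptime_Cons ptime_tl ptime_const ptime_arg cw cw'; (assumption | simp))
      have arity: "Suc (3 + 3) = (7 :: nat)" by simp
      show ?thesis unfolding arity by (intro ballI g)
    qed
    show "\<forall>f\<in>set ?ini. ptime 3 ?D f" using items_word by (simp add: ptime_nil)
    show "polyb (\<lambda>l. 3 * n * l * (3 * n * l + 1) + 3 * n * l)" by (intro polyb_intros)
  next
    fix ws i assume ws: "ws \<in> ?D" "length ws = 3" and i: "i < length (turn_pattern ws)"
    obtain w kk tt where w: "ws = [w, kk, tt]" "kk \<noteq> []" using split[OF ws] by blast
    have i': "i < num_items tt" using i by (simp add: turn_pattern_def w(1) numeral_2_eq_2)
    have bit_i: "turn_pattern ws ! i = (i mod n = j)"
      using i' by (simp add: turn_pattern_def w(1) numeral_2_eq_2)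
    have len: "length (state w kk tt i) = 3" by (simp add: state_def[OF w(2)])
    show "[turn_pattern ws ! i] # fold (play_step ws) (take i (turn_pattern ws)) (map (\<lambda>f. f ws) ?ini) @ ws \<in> ?E"
      unfolding start w(1) run[OF w(2) less_imp_le[OF i']]
      using halts_state[OF w(2) i'] bit_i[unfolded w(1)] len by (simp add: nth_append)
  next
    fix ws i l assume ws: "ws \<in> ?D" "length ws = 3" and i: "i \<le> length (turn_pattern ws)" and l: "wbnd l ws"
    obtain w kk tt where w: "ws = [w, kk, tt]" "kk \<noteq> []" using split[OF ws] by blast
    have i': "i \<le> num_items tt" using i by (simp add: turn_pattern_def w(1) numeral_2_eq_2)
    have "length tt \<le> l" using l by (simp add: w(1) wbnd_def)
    from state_wbnd[OF w(2) this i']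
    show "wbnd (3 * n * l * (3 * n * l + 1) + 3 * n * l)
        (fold (play_step ws) (take i (turn_pattern ws)) (map (\<lambda>f. f ws) ?ini))"
      unfolding start w(1) run[OF w(2) i'] .
  qed (use pattern in simp_all)
  then show ?thesis by (simp only: start)
qed

definition accepted :: "word list \<Rightarrow> bool" where
  "accepted ws = accepts (ws ! 0) (samples n (length (ws ! 1))
     (drop (j + 1) (fold (play_step ws) (turn_pattern ws) (play_start ws) ! 2)))"

lemma pdec_accepted: "pdec 3 {ws. ws ! 1 \<noteq> []} accepted"
  unfolding accepted_def[abs_def]
  by (intro pdec_accepts ptime_samples ptime_drop_const ptime_final_state ptime_arg) simp_all

lemma accepted_iff:
  assumes "kk \<noteq> []"
  shows "accepted [w, kk, tt] \<longleftrightarrow> accepts w (hard_instance.decode n j (length kk)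
    (outcome (market w kk tt) ((greedy tb (market w kk tt))(j := program_policy c (market w kk tt))) j))"
proof -
  have "fold (play_step [w, kk, tt]) (turn_pattern [w, kk, tt]) (play_start [w, kk, tt]) =
      state w kk tt (num_items tt)"
    using fold_play_step[OF assms, of w tt "num_items tt"] by (simp add: turn_pattern_def numeral_2_eq_2)
  then show ?thesis
    using final_state[OF assms, of w tt] by (simp add: accepted_def num_items_eq[OF assms])
qed

text \<open>A fold over a word of length \<open>K * k + 1\<close>. The number
  \<open>\<epsilon>\<close> enters only through the constant \<open>K\<close>, which is built into
  the program.\<close>

lemma ptime_search:
  "ptime 1 UNIV (\<lambda>ws. let kk = replicate (poly r (length (ws ! 0)) + 1) True in
    if \<exists>i < K * length kk + 1. accepted [ws ! 0, kk, replicate i True] then [True] else [])"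
proof -
  \<comment> \<open>The second state word counts the trial value of \<open>T\<close> in unary; the
    first remembers whether a trial has succeeded.\<close>
  define step where "step ws b st =
      [if accepted [ws ! 0, ws ! 1, st ! 1] then [True] else st ! 0, True # st ! 1]"
    for ws :: "word list" and b :: bool and st :: "word list"
  let ?gs = "[\<lambda>v :: word list. if accepted [v ! 3, v ! 4, v ! 2] then [True] else v ! 1, \<lambda>v. True # v ! 2]"
  let ?D = "{ws :: word list. ws ! 1 \<noteq> []}"
  have run: "fold (step ws) (replicate i True) [[], []] =
      [if \<exists>i'<i. accepted [ws ! 0, ws ! 1, replicate i' True] then [True] else [], replicate i True]" for ws i
  proof (induction i)
    case (Suc i)
    have "fold (step ws) (replicate (Suc i) True) [[], []] = step ws True (fold (step ws) (replicate i True) [[], []])"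
      by (simp only: replicate_Suc replicate_append_same[symmetric] fold_append o_apply fold_simps)
    then show ?case unfolding Suc.IH by (simp only:) (auto simp: step_def less_Suc_eq)
  qed simp
  have run_take: "fold (step ws) (take i (replicate N True)) (map (\<lambda>f. f ws) [\<lambda>ws. [], \<lambda>ws. []]) =
      [if \<exists>i'<i. accepted [ws ! 0, ws ! 1, replicate i' True] then [True] else [], replicate i True]"
    if "i \<le> N" for ws i N
    using that run[of ws i] by (simp add: min_def)
  have "ptime 2 ?D (\<lambda>ws. fold (step ws) (replicate (K * length (ws ! 1) + 1) True)
      (map (\<lambda>f. f ws) [\<lambda>ws. [], \<lambda>ws. []]) ! 0)"
  proof (rule ptime_fold_params[where gs = ?gs and k = 2 and E = "{v. v ! 4 \<noteq> []}" and q = "\<lambda>l. K * l + 1"])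
    show "step ws b st = map (\<lambda>g. g ([b] # st @ ws)) ?gs" if "length ws = 2" "length st = 2" for ws b st
      using that by (simp add: step_def nth_append)
    show "ptime 2 ?D (\<lambda>ws. replicate (K * length (ws ! 1) + 1) True)"
      using ptime_Cons[OF ptime_mult[OF ptime_const[of 2 ?D "replicate K True"] ptime_arg[of 1 2 ?D]]] by simp
    have "ptime 5 {v. v ! 4 \<noteq> []} (\<lambda>v. (\<lambda>ws. if accepted ws then [True] else [])
        (map (\<lambda>g. g v) [\<lambda>v. v ! 3, \<lambda>v. v ! 4, \<lambda>v. v ! 2]))"
      by (rule ptime_comp[OF pdec_accepted[unfolded pdec_def]]) (auto intro: ptime_arg)
    then have "pdec 5 {v. v ! 4 \<noteq> []} (\<lambda>v. accepted [v ! 3, v ! 4, v ! 2])" by (simp add: pdec_def)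
    then show "\<forall>g\<in>set ?gs. ptime (Suc (2 + 2)) {v. v ! 4 \<noteq> []} g"
      by (auto intro!: ptime_if ptime_const ptime_arg ptime_Cons)
  next
    fix ws :: "word list" and i assume ws: "length ws = 2" "ws \<in> ?D"
      and "i < length (replicate (K * length (ws ! 1) + 1) True)"
    then have i: "i \<le> K * length (ws ! 1) + 1" by simp
    show "[replicate (K * length (ws ! 1) + 1) True ! i] # fold (step ws)
        (take i (replicate (K * length (ws ! 1) + 1) True)) (map (\<lambda>f. f ws) [\<lambda>ws. [], \<lambda>ws. []]) @ ws \<in> {v. v ! 4 \<noteq> []}"
      unfolding run_take[OF i] using ws by simp
  next
    fix ws :: "word list" and i l assume ws: "length ws = 2"
      and i: "i \<le> length (replicate (K * length (ws ! 1) + 1) True)" and l: "wbnd l ws"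
    have "length (ws ! 1) \<le> l" using l ws by (intro arg_bnd) auto
    then have "K * length (ws ! 1) \<le> K * l" by (rule mult_le_mono2)
    moreover have i': "i \<le> K * length (ws ! 1) + 1" using i by simp
    ultimately have "i \<le> K * l + 1" by linarith
    then show "wbnd (K * l + 1) (fold (step ws) (take i (replicate (K * length (ws ! 1) + 1) True))
        (map (\<lambda>f. f ws) [\<lambda>ws. [], \<lambda>ws. []]))"
      unfolding run_take[OF i'] by (simp add: wbnd_def)
  qed (auto intro!: ptime_nil polyb_intros)
  then have search: "ptime 2 ?D (\<lambda>ws. if \<exists>i < K * length (ws ! 1) + 1. accepted [ws ! 0, ws ! 1, replicate i True]
      then [True] else [])"
    by (simp only: list.map run nth_Cons_0)
  have "ptime 1 UNIV (\<lambda>ws. replicate (poly r (length (ws ! 0)) + 1) True)"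
    using ptime_Cons[OF ptime_poly[OF ptime_arg[of 0 1 UNIV], of r]] by simp
  then have "ptime 1 UNIV (\<lambda>ws. (\<lambda>ws. if \<exists>i < K * length (ws ! 1) + 1. accepted [ws ! 0, ws ! 1, replicate i True]
      then [True] else []) (map (\<lambda>g. g ws) [\<lambda>ws. ws ! 0, \<lambda>ws. replicate (poly r (length (ws ! 0)) + 1) True]))"
    by (intro ptime_comp[OF search]) (auto intro: ptime_arg)
  then show ?thesis by (simp add: Let_def)
qed

section \<open>Correctness of the search\<close>

lemma accepted_if_certificate:
  assumes imp: "\<And>I. I \<in> instances_with_additive_others n j \<Longrightarrow>
      improvement (1 + \<epsilon>) tb I (greedy tb I) j (program_policy c I)"
    and \<epsilon>: "0 < \<epsilon>" "\<epsilon> < 3 / 10" and K: "1 / \<epsilon> \<le> real K"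
    and u: "length u < k" "result no_oracle V [w, u] = [True]"
  shows "\<exists>i < K * k + 1. accepted [w, replicate k True, replicate i True]"
proof -
  define kk where "kk = replicate k True"
  have kk: "kk \<noteq> []" "length kk = k" using u(1) by (auto simp: kk_def)
  \<comment> \<open>The largest \<open>T\<close> with \<open>3 * \<epsilon> * T \<le> 2 * k\<close>.
    The next multiple of \<open>3 * \<epsilon>\<close> lies beyond \<open>2 * k\<close> and the step
    is less than 1, so this one exceeds \<open>2 * k - 1\<close>.\<close>
  define T where "T = nat \<lfloor>2 * real k / (3 * \<epsilon>)\<rfloor>"
  \<comment> \<open>The certificate padded to the length \<open>k\<close>; there is room for the
    \<open>True\<close> because \<open>length u < k\<close>.\<close>
  define v where "v = u @ True # replicate (k - 1 - length u) False"
  interpret hard_instance n j k T "accepts w"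
    using hard_instance[OF kk(1)] unfolding kk(2) .
  have "0 \<le> 2 * real k / (3 * \<epsilon>)" using \<epsilon> by simp
  then have T: "real T \<le> 2 * real k / (3 * \<epsilon>)" "2 * real k / (3 * \<epsilon>) < real T + 1"
    unfolding T_def by linarith+
  have eT: "3 * \<epsilon> * real T \<le> 2 * real k" "2 * real k - 1 < 3 * \<epsilon> * real T"
  proof -
    show "3 * \<epsilon> * real T \<le> 2 * real k" using T(1) \<epsilon> by (simp add: field_simps)
    have "2 * real k < 3 * \<epsilon> * (real T + 1)" using T(2) \<epsilon> by (simp add: field_simps)
    then show "2 * real k - 1 < 3 * \<epsilon> * real T" using \<epsilon> by (simp add: algebra_simps)
  qed
  have "2 * k \<le> T"
  proof -
    have "real (2 * k) * (3 * \<epsilon>) \<le> real (2 * k) * 1" using \<epsilon> by (intro mult_left_mono) auto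
    then have "real (2 * k) \<le> 2 * real k / (3 * \<epsilon>)" using \<epsilon> by (simp add: pos_le_divide_eq)
    then have "real (2 * k) < real (T + 1)" using T(2) by simp
    then show ?thesis by (simp only: of_nat_less_iff)
  qed
  moreover have "length v = k" "accepts w v"
    using u by (auto simp: v_def accepts_def strip_pad)
  moreover have "improvement (1 + \<epsilon>) tb inst (greedy tb inst) j (program_policy c inst)"
    by (rule imp[OF inst_in_class])
  ultimately have acc: "accepts w (decode (outcome inst ((greedy tb inst)(j := program_policy c inst)) j))"
    using improvement_finds_accepted[OF tb] eT by blast
  have "T \<le> K * k"
  proof -
    have "real T \<le> 2 * real k / (3 * \<epsilon>)" by (rule T)
    also have "\<dots> \<le> 1 / \<epsilon> * real k" using \<epsilon> by (simp add: field_simps)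
    also have "\<dots> \<le> real K * real k" using K by (intro mult_right_mono) auto
    finally show ?thesis by (metis of_nat_le_iff of_nat_mult)
  qed
  moreover have "accepted [w, kk, replicate T True]"
    unfolding accepted_iff[OF kk(1)] kk(2) length_replicate by (rule acc)
  ultimately show ?thesis unfolding kk_def by (intro exI[of _ T]) simp
qed

text \<open>With \<open>k\<close> one more than the certificate bound, soundness rests on the
  verifier alone: whatever agent \<open>j\<close> spells for any \<open>T\<close> has length
  \<open>k\<close> and strips to a certificate of admissible length. The improvement property enters
  only in the converse, for the one suitable \<open>T\<close>.\<close>

lemma in_class_P:
  assumes imp: "\<And>I. I \<in> instances_with_additive_others n j \<Longrightarrow>
      improvement (1 + \<epsilon>) tb I (greedy tb I) j (program_policy c I)"
    and \<epsilon>: "0 < \<epsilon>" "\<epsilon> < 3 / 10"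
    and L: "\<And>w. w \<in> L \<longleftrightarrow> (\<exists>u. length u \<le> poly r (length w) \<and> result no_oracle V [w, u] = [True])"
  shows "L \<in> class_P"
proof -
  define K where "K = nat \<lceil>1 / \<epsilon>\<rceil>"
  have K: "1 / \<epsilon> \<le> real K" unfolding K_def by (rule real_nat_ceiling_ge)
  define k where "k w = poly r (length w) + 1" for w :: word
  define f where "f w = (if \<exists>i < K * k w + 1. accepted [w, replicate (k w) True, replicate i True] then [True] else [])"
    for w
  have f: "f w = [True] \<longleftrightarrow> w \<in> L" for w
  proof
    assume "f w = [True]"
    then obtain i where acc: "accepted [w, replicate (k w) True, replicate i True]"
      by (auto simp: f_def split: if_splits)
    have ne: "replicate (k w) True \<noteq> []" by (simp add: k_def)
    obtain S where S: "accepts w (hard_instance.decode n j (length (replicate (k w) True)) S)"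
      using acc[unfolded accepted_iff[OF ne]] by (rule that)
    define v where "v = hard_instance.decode n j (length (replicate (k w) True)) S"
    have v: "accepts w v" "length v = k w"
      using S hard_instance.decode_def[OF hard_instance[OF ne]] by (simp_all add: v_def)
    then have "length (strip v) \<le> poly r (length w)" using length_strip[of v] by (simp add: k_def)
    then show "w \<in> L" using v(1) unfolding L accepts_def by blast
  next
    assume "w \<in> L"
    then obtain u where "length u < k w" "result no_oracle V [w, u] = [True]"
      unfolding L k_def by (auto simp: less_Suc_eq_le)
    then show "f w = [True]" using accepted_if_certificate[OF imp \<epsilon> K] by (simp add: f_def)
  qed
  have "ptime 1 UNIV (\<lambda>ws. f (ws ! 0))"
    using ptime_search[of r K] by (simp add: f_def k_def Let_def)
  then obtain d P where d: "\<forall>ws l. ws \<in> UNIV \<longrightarrow> length ws = 1 \<longrightarrow> wbnd l ws \<longrightarrow>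
      (\<exists>t s. exec no_oracle d (init ws) t s \<and> s 0 = f (ws ! 0) \<and> t \<le> poly P l)"
    by (rule ptimeE)
  have "halts_within no_oracle d [w] (poly P (length w)) \<and> (w \<in> L \<longleftrightarrow> result no_oracle d [w] = [True])" for w
  proof -
    obtain t s where t: "exec no_oracle d (init [w]) t s" "s 0 = f w" "t \<le> poly P (length w)"
      using d[rule_format, of "[w]" "length w"] by (auto simp: wbnd_def)
    then show ?thesis using result_eq[OF t(1)] f by (auto simp: halts_within_def)
  qed
  then show ?thesis unfolding class_P_def by blast
qed

end

text \<open>The hypothesis is an inequality of classes and the reduction yields only
  \<open>class_NP \<subseteq> class_P\<close>; this is the other inclusion. The verifier erases the
  certificate and runs the decision procedure.\<close>

lemma class_P_subset_class_NP: "class_P \<subseteq> class_NP"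
proof
  fix L assume "L \<in> class_P"
  then obtain c p where c: "\<And>w. halts_within no_oracle c [w] (poly p (length w)) \<and>
      (w \<in> L \<longleftrightarrow> result no_oracle c [w] = [True])"
    unfolding class_P_def by blast
  define d where "d = Seq (clear 1) c"
  \<comment> \<open>The summand \<open>[:1, 2:]\<close> pays for clearing the certificate, which
    takes \<open>2 * length u + 1\<close> steps.\<close>
  define P where "P = [:1, 2:] + p"
  have run: "halts_within no_oracle d [w, u] (poly P (length w + length u)) \<and>
      result no_oracle d [w, u] = result no_oracle c [w]" for w u
  proof -
    obtain t s where t: "exec no_oracle c (init [w]) t s" "t \<le> poly p (length w)"
      using c unfolding halts_within_def by blast
    have "(init [w, u])(1 := []) = init [w]" by (auto simp: init_def fun_eq_iff less_Suc_eq)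
    then have "exec no_oracle (clear 1) (init [w, u]) (2 * length u + 1) (init [w])"
      using exec_clear[of no_oracle 1 "init [w, u]"] by (simp add: init_def)
    from exec.Seq[OF this t(1)] have e: "exec no_oracle d (init [w, u]) (2 * length u + 1 + t) s"
      unfolding d_def .
    have "poly p (length w) \<le> poly p (length w + length u)" by (rule poly_mono_nat) simp
    then have "2 * length u + 1 + t \<le> poly P (length w + length u)" using t(2) by (simp add: P_def)
    then show ?thesis
      using e result_eq[OF e] result_eq[OF t(1)] unfolding halts_within_def by auto
  qed
  have "w \<in> L \<longleftrightarrow> (\<exists>u. length u \<le> poly 0 (length w) \<and> result no_oracle d [w, u] = [True])" for w
    using run c by simp
  then show "L \<in> class_NP" unfolding class_NP_def using run by blast
qed

theorem theorem6:
  fixes n j :: nat and \<epsilon> :: real and tb :: tie_rule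
  assumes "n \<ge> 2" and "0 < \<epsilon>" and "\<epsilon> < 3 / 10" and "j < n"
    and "tie_breaking tb"
    and "class_P \<noteq> class_NP"
  shows "\<not> (\<exists>c. poly_time_on (instances_with_additive_others n j) (greedy tb) j c \<and>
    (\<forall>I\<in>instances_with_additive_others n j.
      improvement (1 + \<epsilon>) tb I (greedy tb I) j (program_policy c I)))"
proof
  assume "\<exists>c. poly_time_on (instances_with_additive_others n j) (greedy tb) j c \<and>
    (\<forall>I\<in>instances_with_additive_others n j.
      improvement (1 + \<epsilon>) tb I (greedy tb I) j (program_policy c I))"
  then obtain c p where c: "\<And>I k. I \<in> instances_with_additive_others n j \<Longrightarrow> k < turns I \<Longrightarrow>
        k mod agents I = j \<Longrightarrow> halts_within (query_answer I) c
          (input_code I (play I ((greedy tb I)(j := program_policy c I)) k)) (poly p (instance_size I))"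
      "\<And>I. I \<in> instances_with_additive_others n j \<Longrightarrow>
        improvement (1 + \<epsilon>) tb I (greedy tb I) j (program_policy c I)"
    unfolding poly_time_on_def by blast
  have "class_NP \<subseteq> class_P"
  proof
    fix L assume "L \<in> class_NP"
    then obtain V pV r where verifier: "\<And>w u. halts_within no_oracle V [w, u] (poly pV (length w + length u))"
        "\<And>w. w \<in> L \<longleftrightarrow> (\<exists>u. length u \<le> poly r (length w) \<and> result no_oracle V [w, u] = [True])"
      unfolding class_NP_def by blast
    interpret reduction_run n j V pV tb c p
      by unfold_locales (use assms verifier(1) c(1) in auto)
    show "L \<in> class_P" by (rule in_class_P[OF c(2) assms(2,3) verifier(2)])
  qed
  then show False using class_P_subset_class_NP assms(6) by blast
qed

end
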